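(* Let $\mathbb{K}$ be a field, let $G$ be a simple graph on the vertex set $[n]$, let $S=\mathbb{K}[x_1,\ldots,x_n,y_1,\ldots,y_n]$, and let $J_G\subseteq S$ be the binomial edge ideal of $G$. Then $$\operatorname{depth} S/J_G\geq 4r+\sum_{i=1}^{n}r_i(i+1),$$ where $r$ is the number of non-complete connected components of $G$ and, for every $1\leq i\leq n$, $r_i$ is the number of complete connected components of $G$ of size $i$ (i.e. with exactly $i$ vertices).
   Context: All graphs are finite and simple (no loops, no directed edges, no multiple edges), and $[n]=\{1,\ldots,n\}$. The binomial edge ideal of a graph $G$ on $[n]$ is $J_G=(x_iy_j-x_jy_i : \{i,j\}\in E(G),\ 1\leq i<j\leq n)\subseteq S$. The depth of $S/J_G$ is taken with respect to $\mathfrak{m}=(x_1,\ldots,x_n,y_1,\ldots,y_n)$, that is, $\operatorname{depth} S/J_G=\min\{i : H^i_{\mathfrak{m}}(S/J_G)\neq 0\}$. An isolated vertex is a complete connected component of size $1$. *)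

theory Defs
  imports
    "HOL-Algebra.Module"
    "HOL-Algebra.Ideal_Product"
    "HOL-Algebra.Subrings"
    "HOL-Library.Poly_Mapping"
    "HOL-Library.Extended_Nat"
begin

section \<open>Simple graphs on \<open>{1..n}\<close>\<close>

definition simple_graph :: "nat \<Rightarrow> nat set set \<Rightarrow> bool" where
  "simple_graph n E \<longleftrightarrow> (\<forall>e\<in>E. e \<subseteq> {1..n} \<and> card e = 2)"

definition connected_in :: "nat set set \<Rightarrow> nat \<Rightarrow> nat \<Rightarrow> bool" where
  "connected_in E = (\<lambda>i j. {i, j} \<in> E)\<^sup>*\<^sup>*"

definition components :: "nat \<Rightarrow> nat set set \<Rightarrow> nat set set" where
  "components n E = {{j \<in> {1..n}. connected_in E i j} | i. i \<in> {1..n}}"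

definition complete_on :: "nat set set \<Rightarrow> nat set \<Rightarrow> bool" where
  "complete_on E C \<longleftrightarrow> (\<forall>i\<in>C. \<forall>j\<in>C. i \<noteq> j \<longrightarrow> {i, j} \<in> E)"

definition num_noncomplete :: "nat \<Rightarrow> nat set set \<Rightarrow> nat" where
  "num_noncomplete n E = card {C \<in> components n E. \<not> complete_on E C}"

definition num_complete :: "nat \<Rightarrow> nat set set \<Rightarrow> nat \<Rightarrow> nat" where
  "num_complete n E i = card {C \<in> components n E. complete_on E C \<and> card C = i}"


section \<open>The polynomial ring and the binomial edge ideal\<close>

datatype xy_var = VarX nat | VarY nat

text \<open>A monomial is a finitely supported exponent vector, a polynomial a finitely supported
  coefficient function on monomials.  The type has infinitely many variables; the carrier of
  \<open>xy_ring n\<close> restricts them to those with index in \<open>{1..n}\<close>.\<close>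

type_synonym 'k mpoly = "(xy_var \<Rightarrow>\<^sub>0 nat) \<Rightarrow>\<^sub>0 'k"

definition vars_upto :: "nat \<Rightarrow> xy_var set" where
  "vars_upto n = VarX ` {1..n} \<union> VarY ` {1..n}"

definition xy_ring :: "nat \<Rightarrow> ('k :: field) mpoly ring" where
  "xy_ring n =
     \<lparr>carrier = {p. \<forall>m \<in> Poly_Mapping.keys p. Poly_Mapping.keys m \<subseteq> vars_upto n},
      mult = (*), one = 1, zero = 0, add = (+)\<rparr>"

definition indet :: "xy_var \<Rightarrow> ('k :: field) mpoly" where
  "indet v = Poly_Mapping.single (Poly_Mapping.single v 1) 1"

definition irrelevant_ideal :: "nat \<Rightarrow> ('k :: field) mpoly set" where
  "irrelevant_ideal n = Idl\<^bsub>xy_ring n\<^esub> (indet ` vars_upto n)"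

definition binomial_edge_ideal :: "nat \<Rightarrow> nat set set \<Rightarrow> ('k :: field) mpoly set" where
  "binomial_edge_ideal n E = Idl\<^bsub>xy_ring n\<^esub>
     {indet (VarX i) * indet (VarY j) - indet (VarX j) * indet (VarY i) | i j.
        {i, j} \<in> E \<and> 1 \<le> i \<and> i < j \<and> j \<le> n}"


section \<open>Modules\<close>

definition ring_module :: "'a ring \<Rightarrow> ('a, 'a) module" where
  "ring_module R =
     \<lparr>carrier = carrier R, mult = mult R, one = one R, zero = zero R, add = add R,
      smult = mult R\<rparr>"

text \<open>The record type for modules carries the ring fields \<open>mult\<close> and \<open>one\<close>, which have no
  meaning for modules.\<close>

definition quot_module :: "('a, 'm) module \<Rightarrow> 'm set \<Rightarrow> ('a, 'm set) module" where
  "quot_module M N =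
     \<lparr>carrier = a_rcosets\<^bsub>M\<^esub> N, mult = undefined, one = undefined, zero = N, add = set_add M,
      smult = (\<lambda>r C. \<Union>x\<in>C. N +>\<^bsub>M\<^esub> (r \<odot>\<^bsub>M\<^esub> x))\<rparr>"

definition mod_hom :: "'a ring \<Rightarrow> ('a, 'm) module \<Rightarrow> ('a, 'p) module \<Rightarrow> ('m \<Rightarrow> 'p) set" where
  "mod_hom R M N = {f \<in> carrier M \<rightarrow> carrier N.
     (\<forall>x\<in>carrier M. \<forall>y\<in>carrier M. f (x \<oplus>\<^bsub>M\<^esub> y) = f x \<oplus>\<^bsub>N\<^esub> f y) \<and>
     (\<forall>r\<in>carrier R. \<forall>x\<in>carrier M. f (r \<odot>\<^bsub>M\<^esub> x) = r \<odot>\<^bsub>N\<^esub> f x)}"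

text \<open>HOL cannot quantify over all types inside a definition, so the test modules \<open>B\<close> have
  elements in the type \<open>'u\<close> of the elements of \<open>Q\<close>.  As soon as \<open>'u\<close> is large enough to
  contain a copy of \<open>R\<close>, this is injectivity in the usual sense, by Baer's criterion; that is
  the case for the type \<open>'a list \<Rightarrow> 'm\<close> used for resolutions below, unless \<open>'m\<close> has only
  one element.\<close>

definition injective_module :: "'a ring \<Rightarrow> ('a, 'u) module \<Rightarrow> bool" where
  "injective_module R Q \<longleftrightarrow> Module.module R Q \<and>
     (\<forall>(B :: ('a, 'u) module) A f.
        Module.module R B \<and> submodule A R B \<and> f \<in> mod_hom R (B\<lparr>carrier := A\<rparr>) Q \<longrightarrow>
        (\<exists>g \<in> mod_hom R B Q. \<forall>x\<in>A. g x = f x))"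

definition injective_resolution ::
    "'a ring \<Rightarrow> ('a, 'm) module \<Rightarrow> (nat \<Rightarrow> ('a, 'u) module) \<Rightarrow> (nat \<Rightarrow> 'u \<Rightarrow> 'u) \<Rightarrow> ('m \<Rightarrow> 'u) \<Rightarrow> bool"
  where
  "injective_resolution R M Q d e \<longleftrightarrow>
     (\<forall>k. injective_module R (Q k)) \<and>
     (\<forall>k. d k \<in> mod_hom R (Q k) (Q (Suc k))) \<and>
     e \<in> mod_hom R M (Q 0) \<and>
     inj_on e (carrier M) \<and>
     e ` carrier M = a_kernel (Q 0) (Q 1) (d 0) \<and>
     (\<forall>k. d k ` carrier (Q k) = a_kernel (Q (Suc k)) (Q (Suc (Suc k))) (d (Suc k)))"


section \<open>Local cohomology and depth\<close>

text \<open>The functor \<open>\<Gamma>\<^sub>a\<close>; powers of the ideal are taken in the monoid of ideals.\<close>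

definition torsion_part :: "'a ring \<Rightarrow> 'a set \<Rightarrow> ('a, 'm) module \<Rightarrow> 'm set" where
  "torsion_part R a M =
     {x \<in> carrier M. \<exists>k::nat. \<forall>r \<in> a [^]\<^bsub>ideals_set R\<^esub> k. r \<odot>\<^bsub>M\<^esub> x = \<zero>\<^bsub>M\<^esub>}"

definition torsion_cohomology ::
    "'a ring \<Rightarrow> 'a set \<Rightarrow> (nat \<Rightarrow> ('a, 'u) module) \<Rightarrow> (nat \<Rightarrow> 'u \<Rightarrow> 'u) \<Rightarrow> nat \<Rightarrow> ('a, 'u set) module"
  where
  "torsion_cohomology R a Q d i =
     quot_module
       ((Q i)\<lparr>carrier := torsion_part R a (Q i) \<inter> a_kernel (Q i) (Q (Suc i)) (d i)\<rparr>)
       (case i of 0 \<Rightarrow> {\<zero>\<^bsub>Q 0\<^esub>} | Suc j \<Rightarrow> d j ` torsion_part R a (Q j))"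

text \<open>The right derived functors of \<open>\<Gamma>\<^sub>a\<close>, computed from some injective resolution.  If \<open>R\<close>
  contains a field \<open>K\<close>, as every \<open>xy_ring n\<close> does, the type \<open>'a list \<Rightarrow> 'm\<close> has room for one: the modules
  \<open>Hom\<^sub>K(R \<otimes>\<^sub>K \<dots> \<otimes>\<^sub>K R, M)\<close> of the cobar resolution consist of functions on lists of
  elements of \<open>R\<close> with values in \<open>M\<close>; see \<open>injective_resolution_exists\<close> below.\<close>

definition local_cohomology ::
    "'a ring \<Rightarrow> 'a set \<Rightarrow> ('a, 'm) module \<Rightarrow> nat \<Rightarrow> ('a, ('a list \<Rightarrow> 'm) set) module" where
  "local_cohomology R a M i =
     (case SOME (Q, d). \<exists>e. injective_resolution R M Q d e of
        (Q, d) \<Rightarrow> torsion_cohomology R a Q d i)"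

text \<open>The value is \<open>\<infinity>\<close> if all local cohomology modules vanish.\<close>

definition depth :: "'a ring \<Rightarrow> 'a set \<Rightarrow> ('a, 'm) module \<Rightarrow> enat" where
  "depth R a M =
     Inf {enat i | i. carrier (local_cohomology R a M i) \<noteq> {\<zero>\<^bsub>local_cohomology R a M i\<^esub>}}"


section \<open>The objects above have the expected algebraic structure\<close>

lemma quot_module_is_module:
  fixes R :: "'a ring" and M :: "('a, 'm) module"
  assumes M: "Module.module R M" and N: "submodule N R M"
  shows "Module.module R (quot_module M N)"
proof -
  interpret M: Module.module R M by fact
  interpret S: submodule N R M by fact
  interpret N: abelian_subgroup N M
    by (rule abelian_subgroupI3) (auto intro!: additive_subgroup.intro S.subgroup_axioms M.abelian_group_axioms)
  have sub: "N \<subseteq> carrier M" by (rule N.a_subset)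
  have sm: "(\<Union>y\<in>N +>\<^bsub>M\<^esub> x. N +>\<^bsub>M\<^esub> (r \<odot>\<^bsub>M\<^esub> y)) = N +>\<^bsub>M\<^esub> (r \<odot>\<^bsub>M\<^esub> x)"
    if r: "r \<in> carrier R" and x: "x \<in> carrier M" for r x
  proof -
    have "N +>\<^bsub>M\<^esub> (r \<odot>\<^bsub>M\<^esub> y) = N +>\<^bsub>M\<^esub> (r \<odot>\<^bsub>M\<^esub> x)" if y: "y \<in> N +>\<^bsub>M\<^esub> x" for y
    proof -
      obtain h where h: "h \<in> N" "y = h \<oplus>\<^bsub>M\<^esub> x" using y by (auto simp: a_r_coset_def')
      have "r \<odot>\<^bsub>M\<^esub> y = r \<odot>\<^bsub>M\<^esub> h \<oplus>\<^bsub>M\<^esub> r \<odot>\<^bsub>M\<^esub> x" "r \<odot>\<^bsub>M\<^esub> h \<in> N"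
        using h r x sub by (auto simp: M.smult_r_distr)
      then have "r \<odot>\<^bsub>M\<^esub> y \<in> N +>\<^bsub>M\<^esub> (r \<odot>\<^bsub>M\<^esub> x)" by (auto simp: a_r_coset_def')
      then show ?thesis using M.M.a_repr_independence[OF _ _ N.a_subgroup] r x by (metis M.smult_closed)
    qed
    moreover have "x \<in> N +>\<^bsub>M\<^esub> x" using N.a_rcos_self x by blast
    ultimately show ?thesis by blast
  qed
  have car: "carrier (quot_module M N) = (\<lambda>x. N +>\<^bsub>M\<^esub> x) ` carrier M"
    by (auto simp: quot_module_def A_RCOSETS_def')
  have ops: "add (quot_module M N) = set_add M" "zero (quot_module M N) = N"
    by (simp_all add: quot_module_def)
  have sm': "r \<odot>\<^bsub>quot_module M N\<^esub> (N +>\<^bsub>M\<^esub> x) = N +>\<^bsub>M\<^esub> (r \<odot>\<^bsub>M\<^esub> x)"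
    if "r \<in> carrier R" "x \<in> carrier M" for r x
    using sm[OF that] by (simp add: quot_module_def)
  have N0: "N +>\<^bsub>M\<^esub> \<zero>\<^bsub>M\<^esub> = N" using N.a_rcos_const[OF N.zero_closed] by simp
  show ?thesis
  proof (rule Module.moduleI)
    show "cring R" by (rule M.R.is_cring)
    show "abelian_group (quot_module M N)"
    proof (rule abelian_groupI)
      show "\<exists>y\<in>carrier (quot_module M N). y \<oplus>\<^bsub>quot_module M N\<^esub> x = \<zero>\<^bsub>quot_module M N\<^esub>"
        if x: "x \<in> carrier (quot_module M N)" for x
      proof -
        obtain m where m: "m \<in> carrier M" "x = N +>\<^bsub>M\<^esub> m" using x unfolding car by (rule imageE)
        have "(N +>\<^bsub>M\<^esub> (\<ominus>\<^bsub>M\<^esub> m)) \<oplus>\<^bsub>quot_module M N\<^esub> x = \<zero>\<^bsub>quot_module M N\<^esub>"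
          unfolding m(2) ops N.a_rcos_sum[OF M.M.a_inv_closed[OF m(1)] m(1)] M.M.l_neg[OF m(1)] by (rule N0)
        then show ?thesis
          by (rule bexI) (unfold car, intro imageI M.M.a_inv_closed m(1))
      qed
      show "\<zero>\<^bsub>quot_module M N\<^esub> \<in> carrier (quot_module M N)"
        unfolding car ops using N0 by (metis imageI M.M.zero_closed)
      show "\<zero>\<^bsub>quot_module M N\<^esub> \<oplus>\<^bsub>quot_module M N\<^esub> x = x"
        if x: "x \<in> carrier (quot_module M N)" for x
      proof -
        obtain m where m: "m \<in> carrier M" "x = N +>\<^bsub>M\<^esub> m" using x unfolding car by (rule imageE)
        then show ?thesis
          using N.a_rcos_sum[OF M.M.zero_closed m(1)] unfolding ops by (simp add: N0)
      qed
    qed (auto simp: car ops N.a_rcos_sum M.M.a_ac)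
  qed (auto simp: car ops N.a_rcos_sum sm' M.smult_l_distr M.smult_r_distr M.smult_assoc1)
qed

lemma cring_xy_ring: "cring (xy_ring n :: 'k :: field mpoly ring)"
proof -
  let ?R = "xy_ring n :: 'k mpoly ring"
  have single: "Poly_Mapping.single 0 c \<in> carrier ?R" for c
    by (auto simp: xy_ring_def)
  have neg: "- p \<in> carrier ?R" if "p \<in> carrier ?R" for p using that by (simp add: xy_ring_def)
  have add: "p + q \<in> carrier ?R" if "p \<in> carrier ?R" "q \<in> carrier ?R" for p q
    using that Poly_Mapping.keys_add[of p q] by (auto simp: xy_ring_def)
  have mult: "p * q \<in> carrier ?R" if p: "p \<in> carrier ?R" "q \<in> carrier ?R" for p q
  proof -
    have "Poly_Mapping.keys m \<subseteq> vars_upto n" if "m \<in> Poly_Mapping.keys (p * q)" for m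
    proof -
      obtain a b where "m = a + b" "a \<in> Poly_Mapping.keys p" "b \<in> Poly_Mapping.keys q"
        using \<open>m \<in> Poly_Mapping.keys (p * q)\<close> Poly_Mapping.keys_mult[of p q] by blast
      then show ?thesis using p Poly_Mapping.keys_add[of a b] by (fastforce simp: xy_ring_def)
    qed
    then show ?thesis by (simp add: xy_ring_def)
  qed
  have one: "(1 :: 'k mpoly) \<in> carrier ?R" using single[of 1] by simp
  have zero: "(0 :: 'k mpoly) \<in> carrier ?R" by (simp add: xy_ring_def)
  have ops: "mult ?R = (*)" "one ?R = 1" "zero ?R = 0" "add ?R = (+)" by (simp_all add: xy_ring_def)
  show ?thesis
  proof (rule cringI)
    show "abelian_group ?R"
    proof (rule abelian_groupI)
      show "\<exists>y\<in>carrier ?R. y \<oplus>\<^bsub>?R\<^esub> x = \<zero>\<^bsub>?R\<^esub>" if "x \<in> carrier ?R" for x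
        using neg[OF that] by (intro bexI[of _ "- x"]) (auto simp: ops)
    qed (auto simp: ops add zero algebra_simps)
    show "comm_monoid ?R"
      by (rule comm_monoidI) (auto simp: ops mult one algebra_simps)
  qed (auto simp: ops algebra_simps)
qed

lemma subfield_constants:
  "subfield (Set.range (Poly_Mapping.single 0)) (xy_ring n :: 'k :: field mpoly ring)"
proof -
  let ?R = "xy_ring n :: 'k mpoly ring" and ?K = "Set.range (Poly_Mapping.single 0 :: 'k \<Rightarrow> 'k mpoly)"
  interpret cring ?R by (rule cring_xy_ring)
  have ops: "mult ?R = (*)" "one ?R = 1" "zero ?R = 0" "add ?R = (+)" by (simp_all add: xy_ring_def)
  have K: "?K \<subseteq> carrier ?R" by (auto simp: xy_ring_def split: if_splits)
  have inv: "\<ominus>\<^bsub>?R\<^esub> Poly_Mapping.single 0 c = Poly_Mapping.single 0 (- c)" for c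
    by (rule minus_equality) (use K in \<open>auto simp: ops simp flip: Poly_Mapping.single_add\<close>)
  show ?thesis
  proof (rule subfieldI)
    show "subcring ?K ?R"
      by (rule subcringI', rule subringI)
        (use K in \<open>auto simp: inv ops Poly_Mapping.mult_single simp flip: Poly_Mapping.single_add Poly_Mapping.single_one\<close>)
    have "\<exists>d. Poly_Mapping.single 0 c * Poly_Mapping.single 0 d = (1 :: 'k mpoly)" if "c \<noteq> 0" for c :: 'k
      using that by (intro exI[of _ "inverse c"]) (simp add: Poly_Mapping.mult_single)
    then have unit: "Poly_Mapping.single 0 c \<in> Units (?R\<lparr>carrier := ?K\<rparr>)" if "c \<noteq> 0" for c :: 'k
      using that by (fastforce simp: Units_def ops mult.commute)
    have "?K - {0} \<subseteq> Units (?R\<lparr>carrier := ?K\<rparr>)"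
    proof
      fix x assume "x \<in> ?K - {0}"
      then obtain c where "x = Poly_Mapping.single 0 c" "x \<noteq> 0" by blast
      then show "x \<in> Units (?R\<lparr>carrier := ?K\<rparr>)" using unit[of c] by (cases "c = 0") auto
    qed
    moreover have "x \<in> ?K \<and> x \<noteq> 0" if "x \<in> Units (?R\<lparr>carrier := ?K\<rparr>)" for x
      using that by (auto simp: Units_def ops)
    ultimately show "Units (?R\<lparr>carrier := ?K\<rparr>) = ?K - {\<zero>\<^bsub>?R\<^esub>}"
      unfolding ops by blast
  qed
qed

lemma ring_module_is_module: "cring R \<Longrightarrow> Module.module R (ring_module R)"
proof -
  assume "cring R"
  then interpret cring R .
  have "abelian_group (ring_module R)"
    by (rule abelian_groupI) (auto simp: ring_module_def a_ac intro: l_neg a_inv_closed)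
  then show ?thesis
    by (rule Module.moduleI[OF \<open>cring R\<close>]) (auto simp: ring_module_def l_distr r_distr m_assoc)
qed

lemma ideal_submodule: "cring R \<Longrightarrow> ideal I R \<Longrightarrow> submodule I R (ring_module R)"
proof -
  assume R: "cring R" and "ideal I R"
  then interpret ideal I R by simp
  have "subgroup I (add_monoid (ring_module R))"
    using a_subgroup by (simp add: subgroup_def ring_module_def m_inv_def)
  then show ?thesis
    by (intro submodule.intro submodule_axioms.intro) (auto simp: ring_module_def I_l_closed)
qed

lemma indet_closed: "v \<in> vars_upto n \<Longrightarrow> indet v \<in> carrier (xy_ring n)"
  by (auto simp: xy_ring_def indet_def)

lemma ideal_irrelevant: "ideal (irrelevant_ideal n) (xy_ring n)"
  unfolding irrelevant_ideal_def
  by (intro ring.genideal_ideal cring.axioms(1) cring_xy_ring) (auto simp: indet_closed)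

lemma ideal_binomial_edge: "ideal (binomial_edge_ideal n E :: 'k :: field mpoly set) (xy_ring n)"
proof -
  let ?R = "xy_ring n :: 'k mpoly ring"
  interpret cring ?R by (rule cring_xy_ring)
  have ops: "mult ?R = (*)" "add ?R = (+)" by (simp_all add: xy_ring_def)
  have *: "p \<in> carrier ?R \<Longrightarrow> q \<in> carrier ?R \<Longrightarrow> p - q \<in> carrier ?R" for p q
    using Poly_Mapping.keys_diff[of p q] by (auto simp: xy_ring_def)
  have m: "p \<in> carrier ?R \<Longrightarrow> q \<in> carrier ?R \<Longrightarrow> p * q \<in> carrier ?R" for p q
    using m_closed by (simp add: ops)
  show ?thesis unfolding binomial_edge_ideal_def
    by (rule genideal_ideal) (auto intro!: * m indet_closed simp: vars_upto_def)
qed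


section \<open>Existence of injective resolutions\<close>

text \<open>Linear maps over a field extend from subspaces.\<close>

lemma linear_extension:
  fixes F :: "'a ring" and B :: "('a, 'b) module" and V :: "('a, 'v) module"
  assumes F: "Ring.field F" and B: "Module.module F B" and V: "Module.module F V"
    and A: "submodule A F B" and f: "f \<in> mod_hom F (B\<lparr>carrier := A\<rparr>) V"
  shows "\<exists>g \<in> mod_hom F B V. \<forall>x\<in>A. g x = f x"
proof -
  interpret F: Ring.field F by fact
  interpret B: Module.module F B by fact
  interpret V: Module.module F V by fact
  note subA = B.submoduleE[OF A]
  have subA0: "\<zero>\<^bsub>B\<^esub> \<in> A"
    using subA(2,4) B.smult_l_null subA(1) F.zero_closed by (metis all_not_in_conv subsetD)
  define P where "P G \<longleftrightarrow> G \<subseteq> carrier B \<times> carrier V \<and>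
     (\<forall>x u y v. (x,u) \<in> G \<and> (y,v) \<in> G \<longrightarrow> (x \<oplus>\<^bsub>B\<^esub> y, u \<oplus>\<^bsub>V\<^esub> v) \<in> G) \<and>
     (\<forall>c\<in>carrier F. \<forall>x u. (x,u) \<in> G \<longrightarrow> (c \<odot>\<^bsub>B\<^esub> x, c \<odot>\<^bsub>V\<^esub> u) \<in> G) \<and>
     (\<forall>u. (\<zero>\<^bsub>B\<^esub>, u) \<in> G \<longrightarrow> u = \<zero>\<^bsub>V\<^esub>)" for G
  define G0 where "G0 = {(x, f x) | x. x \<in> A}"
  have f0: "f \<zero>\<^bsub>B\<^esub> = \<zero>\<^bsub>V\<^esub>"
  proof -
    have "f (\<zero>\<^bsub>F\<^esub> \<odot>\<^bsub>B\<^esub> \<zero>\<^bsub>B\<^esub>) = \<zero>\<^bsub>F\<^esub> \<odot>\<^bsub>V\<^esub> f \<zero>\<^bsub>B\<^esub>"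
      using f subA0 F.zero_closed unfolding mod_hom_def by (simp del: B.smult_r_null B.smult_l_null V.smult_l_null)
    moreover have "f \<zero>\<^bsub>B\<^esub> \<in> carrier V" using f subA0 unfolding mod_hom_def by auto
    ultimately show ?thesis by simp
  qed
  have PG0: "P G0"
    unfolding P_def G0_def using f subA f0 unfolding mod_hom_def by (auto simp: Pi_iff)
  let ?S = "{G. P G \<and> G0 \<subseteq> G}"
  have "\<exists>G\<in>?S. \<forall>H\<in>?S. G \<subseteq> H \<longrightarrow> H = G"
  proof (rule subset_Zorn_nonempty)
    show "?S \<noteq> {}" using PG0 by auto
    fix C assume C: "C \<noteq> {}" "subset.chain ?S C"
    have inS: "\<And>G. G \<in> C \<Longrightarrow> P G \<and> G0 \<subseteq> G" using C(2) unfolding subset.chain_def by auto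
    have lin: "\<And>G H. G \<in> C \<Longrightarrow> H \<in> C \<Longrightarrow> G \<subseteq> H \<or> H \<subseteq> G" using C(2) unfolding subset.chain_def by blast
    have "P (\<Union>C)"
      unfolding P_def
    proof (intro conjI allI impI ballI)
      show "\<Union>C \<subseteq> carrier B \<times> carrier V" using inS unfolding P_def by blast
    next
      fix x u y v assume "(x,u) \<in> \<Union>C \<and> (y,v) \<in> \<Union>C"
      then obtain G H where "G \<in> C" "H \<in> C" "(x,u) \<in> G" "(y,v) \<in> H" by auto
      then obtain G' where "G' \<in> C" "(x,u) \<in> G'" "(y,v) \<in> G'" using lin by blast
      then show "(x \<oplus>\<^bsub>B\<^esub> y, u \<oplus>\<^bsub>V\<^esub> v) \<in> \<Union>C" using inS[of G'] unfolding P_def by blast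
    next
      fix c x u assume "c \<in> carrier F" "(x,u) \<in> \<Union>C"
      then show "(c \<odot>\<^bsub>B\<^esub> x, c \<odot>\<^bsub>V\<^esub> u) \<in> \<Union>C" using inS unfolding P_def by blast
    next
      fix u assume "(\<zero>\<^bsub>B\<^esub>, u) \<in> \<Union>C"
      then show "u = \<zero>\<^bsub>V\<^esub>" using inS unfolding P_def by blast
    qed
    then show "\<Union>C \<in> ?S" using inS C(1) by blast
  qed
  then obtain G where G1: "G \<in> ?S" "\<forall>H\<in>?S. G \<subseteq> H \<longrightarrow> H = G" by (rule bexE)
  have G: "P G" "G0 \<subseteq> G" using G1(1) by auto
  have max: "H = G" if "P H" "G \<subseteq> H" for H
    using G1(2) G(2) that by (metis (mono_tags, lifting) mem_Collect_eq order.trans)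
  have Gsub: "\<And>x u. (x,u) \<in> G \<Longrightarrow> x \<in> carrier B \<and> u \<in> carrier V"
    and Gadd: "\<And>x u y v. (x,u) \<in> G \<Longrightarrow> (y,v) \<in> G \<Longrightarrow> (x \<oplus>\<^bsub>B\<^esub> y, u \<oplus>\<^bsub>V\<^esub> v) \<in> G"
    and Gsm: "\<And>c x u. c \<in> carrier F \<Longrightarrow> (x,u) \<in> G \<Longrightarrow> (c \<odot>\<^bsub>B\<^esub> x, c \<odot>\<^bsub>V\<^esub> u) \<in> G"
    and Gz: "\<And>u. (\<zero>\<^bsub>B\<^esub>, u) \<in> G \<Longrightarrow> u = \<zero>\<^bsub>V\<^esub>"
    using G(1) unfolding P_def by blast+
  have G00: "(\<zero>\<^bsub>B\<^esub>, \<zero>\<^bsub>V\<^esub>) \<in> G" using G(2) subA0 f0 unfolding G0_def by force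
  have neg1: "\<And>x. x \<in> carrier B \<Longrightarrow> (\<ominus>\<^bsub>F\<^esub> \<one>\<^bsub>F\<^esub>) \<odot>\<^bsub>B\<^esub> x = \<ominus>\<^bsub>B\<^esub> x"
    and neg2: "\<And>x. x \<in> carrier V \<Longrightarrow> (\<ominus>\<^bsub>F\<^esub> \<one>\<^bsub>F\<^esub>) \<odot>\<^bsub>V\<^esub> x = \<ominus>\<^bsub>V\<^esub> x"
    by (simp_all add: B.smult_l_minus V.smult_l_minus)
  have Gfun: "u = v" if "(x,u) \<in> G" "(x,v) \<in> G" for x u v
  proof -
    have "((\<ominus>\<^bsub>F\<^esub> \<one>\<^bsub>F\<^esub>) \<odot>\<^bsub>B\<^esub> x, (\<ominus>\<^bsub>F\<^esub> \<one>\<^bsub>F\<^esub>) \<odot>\<^bsub>V\<^esub> v) \<in> G" using Gsm that by blast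
    then have "(\<ominus>\<^bsub>B\<^esub> x, \<ominus>\<^bsub>V\<^esub> v) \<in> G" using neg1 neg2 Gsub that by metis
    from Gadd[OF that(1) this] have "(\<zero>\<^bsub>B\<^esub>, u \<oplus>\<^bsub>V\<^esub> \<ominus>\<^bsub>V\<^esub> v) \<in> G"
      using Gsub[OF that(1)] by (simp add: B.M.r_neg)
    from Gz[OF this] show ?thesis
      using Gsub that V.M.minus_equality V.M.minus_minus by (metis V.M.a_inv_closed V.M.add.m_comm)
  qed
  have total: "\<exists>u. (b,u) \<in> G" if b: "b \<in> carrier B" for b
  proof (rule ccontr)
    assume nb: "\<nexists>u. (b,u) \<in> G"
    define H where "H = {(x \<oplus>\<^bsub>B\<^esub> c \<odot>\<^bsub>B\<^esub> b, u) | x u c. (x,u) \<in> G \<and> c \<in> carrier F}"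
    have "P H"
      unfolding P_def
    proof (intro conjI allI impI ballI)
      show "H \<subseteq> carrier B \<times> carrier V" unfolding H_def using Gsub b by auto
    next
      fix x u y v assume "(x,u) \<in> H \<and> (y,v) \<in> H"
      then obtain x' c y' d where *: "x = x' \<oplus>\<^bsub>B\<^esub> c \<odot>\<^bsub>B\<^esub> b" "(x',u) \<in> G" "c \<in> carrier F"
         "y = y' \<oplus>\<^bsub>B\<^esub> d \<odot>\<^bsub>B\<^esub> b" "(y',v) \<in> G" "d \<in> carrier F" unfolding H_def by auto
      have "x \<oplus>\<^bsub>B\<^esub> y = (x' \<oplus>\<^bsub>B\<^esub> y') \<oplus>\<^bsub>B\<^esub> (c \<oplus>\<^bsub>F\<^esub> d) \<odot>\<^bsub>B\<^esub> b"
        using * Gsub b by (simp add: B.smult_l_distr B.M.a_ac)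
      then show "(x \<oplus>\<^bsub>B\<^esub> y, u \<oplus>\<^bsub>V\<^esub> v) \<in> H" unfolding H_def using * Gadd F.a_closed by blast
    next
      fix c x u assume c: "c \<in> carrier F" and "(x,u) \<in> H"
      then obtain x' d where *: "x = x' \<oplus>\<^bsub>B\<^esub> d \<odot>\<^bsub>B\<^esub> b" "(x',u) \<in> G" "d \<in> carrier F"
        unfolding H_def by auto
      have "c \<odot>\<^bsub>B\<^esub> x = (c \<odot>\<^bsub>B\<^esub> x') \<oplus>\<^bsub>B\<^esub> (c \<otimes>\<^bsub>F\<^esub> d) \<odot>\<^bsub>B\<^esub> b"
        using * Gsub b c by (simp add: B.smult_r_distr B.smult_assoc1)
      then show "(c \<odot>\<^bsub>B\<^esub> x, c \<odot>\<^bsub>V\<^esub> u) \<in> H" unfolding H_def using * Gsm c F.m_closed by blast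
    next
      fix u assume "(\<zero>\<^bsub>B\<^esub>, u) \<in> H"
      then obtain x c where *: "\<zero>\<^bsub>B\<^esub> = x \<oplus>\<^bsub>B\<^esub> c \<odot>\<^bsub>B\<^esub> b" "(x,u) \<in> G" "c \<in> carrier F"
        unfolding H_def by auto
      show "u = \<zero>\<^bsub>V\<^esub>"
      proof (cases "c = \<zero>\<^bsub>F\<^esub>")
        case True
        then show ?thesis using * b Gsub Gz by (metis B.smult_l_null B.M.r_zero)
      next
        case False
        then have cu: "c \<in> Units F" using * F.field_Units by auto
        let ?i = "inv\<^bsub>F\<^esub> c"
        have i: "?i \<in> carrier F" "?i \<otimes>\<^bsub>F\<^esub> c = \<one>\<^bsub>F\<^esub>" using cu by auto
        have x: "x \<in> carrier B" using * Gsub by auto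
        have "c \<odot>\<^bsub>B\<^esub> b = \<ominus>\<^bsub>B\<^esub> x"
          using *(1,3) x b by (metis B.M.add.m_comm B.M.minus_equality B.smult_closed)
        then have "b = ?i \<odot>\<^bsub>B\<^esub> ((\<ominus>\<^bsub>F\<^esub> \<one>\<^bsub>F\<^esub>) \<odot>\<^bsub>B\<^esub> x)"
          using i b *(3) neg1[OF x] by (metis B.smult_assoc1 B.smult_one)
        then have "(b, ?i \<odot>\<^bsub>V\<^esub> ((\<ominus>\<^bsub>F\<^esub> \<one>\<^bsub>F\<^esub>) \<odot>\<^bsub>V\<^esub> u)) \<in> G"
          using Gsm[OF i(1) Gsm[OF _ *(2)]] by (metis F.add.inv_closed F.one_closed a_inv_def)
        then show ?thesis using nb by blast
      qed
    qed
    moreover have "G \<subseteq> H"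
    proof
      fix p assume "p \<in> G"
      then obtain x u where p: "p = (x,u)" "(x,u) \<in> G" by (cases p) auto
      then have "x = x \<oplus>\<^bsub>B\<^esub> \<zero>\<^bsub>F\<^esub> \<odot>\<^bsub>B\<^esub> b" using Gsub b by simp
      then show "p \<in> H" unfolding H_def using p F.zero_closed by blast
    qed
    ultimately have "H = G" using max by blast
    moreover have "(\<zero>\<^bsub>B\<^esub> \<oplus>\<^bsub>B\<^esub> \<one>\<^bsub>F\<^esub> \<odot>\<^bsub>B\<^esub> b, \<zero>\<^bsub>V\<^esub>) \<in> H" unfolding H_def using G00 F.one_closed by blast
    ultimately have "(b, \<zero>\<^bsub>V\<^esub>) \<in> G" using b by simp
    then show False using nb by blast
  qed
  define g where "g x = (THE u. (x,u) \<in> G)" for x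
  have g: "(x,u) \<in> G \<Longrightarrow> g x = u" for x u unfolding g_def using Gfun by blast
  have g': "x \<in> carrier B \<Longrightarrow> (x, g x) \<in> G" for x using total g by metis
  have "g \<in> mod_hom F B V"
    unfolding mod_hom_def
  proof (intro CollectI conjI ballI)
    show "g \<in> carrier B \<rightarrow> carrier V" using g' Gsub by blast
  next
    fix x y assume "x \<in> carrier B" "y \<in> carrier B"
    then show "g (x \<oplus>\<^bsub>B\<^esub> y) = g x \<oplus>\<^bsub>V\<^esub> g y" using g Gadd g' by blast
  next
    fix c x assume "x \<in> carrier B" "c \<in> carrier F"
    then show "g (c \<odot>\<^bsub>B\<^esub> x) = c \<odot>\<^bsub>V\<^esub> g x" using g Gsm g' by blast
  qed
  moreover have "\<forall>x\<in>A. g x = f x" using g G(2) unfolding G0_def by blast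
  ultimately show ?thesis by blast
qed


text \<open>\<open>V k\<close> is the space of \<open>k\<close>-fold \<open>K\<close>-multilinear maps from \<open>R\<close> to \<open>M\<close>, extended by zero to
  all lists; \<open>act s f\<close> is \<open>f\<close> with its first argument multiplied by \<open>s\<close>.  The differential is
  \<open>D f (a\<^sub>0, a\<^sub>1, \<dots>) = f (a\<^sub>0 a\<^sub>1, \<dots>) - D (f (a\<^sub>0, _)) (a\<^sub>1, \<dots>)\<close>; evaluating the first argument at
  \<open>1\<close> is a contracting homotopy.\<close>

locale cobar = Module.module R M for R :: "'a ring" and M :: "('a, 'm) module" +
  fixes K
  assumes K: "subfield K R"
begin

abbreviation padd (infixl "\<boxplus>" 65) where "padd f g \<equiv> (\<lambda>l::'a list. f l \<oplus>\<^bsub>M\<^esub> g l)"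
abbreviation psm (infixr "\<boxdot>" 70) where "psm c f \<equiv> (\<lambda>l::'a list. c \<odot>\<^bsub>M\<^esub> f l)"
abbreviation pneg ("\<boxminus> _" [80] 80) where "pneg f \<equiv> (\<lambda>l::'a list. \<ominus>\<^bsub>M\<^esub> f l)"
abbreviation pz where "pz \<equiv> (\<lambda>l::'a list. \<zero>\<^bsub>M\<^esub>)"

definition cut :: "'a \<Rightarrow> ('a list \<Rightarrow> 'm) \<Rightarrow> 'a list \<Rightarrow> 'm" where
  "cut a f = (\<lambda>l. f (a # l))"

definition mk :: "('a \<Rightarrow> 'a list \<Rightarrow> 'm) \<Rightarrow> 'a list \<Rightarrow> 'm" where
  "mk F = (\<lambda>l. case l of [] \<Rightarrow> \<zero>\<^bsub>M\<^esub> | a # l \<Rightarrow> if a \<in> carrier R then F a l else \<zero>\<^bsub>M\<^esub>)"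

definition act :: "'a \<Rightarrow> ('a list \<Rightarrow> 'm) \<Rightarrow> 'a list \<Rightarrow> 'm" where
  "act s f = mk (\<lambda>a. cut (s \<otimes>\<^bsub>R\<^esub> a) f)"

primrec V :: "nat \<Rightarrow> ('a list \<Rightarrow> 'm) set" where
  "V 0 = {f. f [] \<in> carrier M \<and> (\<forall>l. l \<noteq> [] \<longrightarrow> f l = \<zero>\<^bsub>M\<^esub>)}"
| "V (Suc k) = {f. f [] = \<zero>\<^bsub>M\<^esub> \<and> (\<forall>a. a \<notin> carrier R \<longrightarrow> cut a f = pz) \<and>
     (\<forall>a\<in>carrier R. cut a f \<in> V k) \<and>
     (\<forall>a\<in>carrier R. \<forall>b\<in>carrier R. cut (a \<oplus>\<^bsub>R\<^esub> b) f = cut a f \<boxplus> cut b f) \<and>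
     (\<forall>c\<in>K. \<forall>a\<in>carrier R. cut (c \<otimes>\<^bsub>R\<^esub> a) f = c \<boxdot> cut a f)}"

primrec D :: "nat \<Rightarrow> ('a list \<Rightarrow> 'm) \<Rightarrow> 'a list \<Rightarrow> 'm" where
  "D 0 f = mk (\<lambda>a. a \<boxdot> f)"
| "D (Suc k) f = mk (\<lambda>a. act a f \<boxplus> \<boxminus> D k (cut a f))"

lemma KR: "c \<in> K \<Longrightarrow> c \<in> carrier R"
  using K subfieldE(3) by blast

lemma V_closed: "f \<in> V k \<Longrightarrow> f l \<in> carrier M"
proof (induction k arbitrary: f l)
  case 0 then show ?case by (cases l) auto
next
  case (Suc k)
  show ?case
  proof (cases l)
    case Nil then show ?thesis using Suc by simp
  next
    case (Cons a l')
    have "f l = cut a f l'" by (simp add: Cons cut_def)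
    then show ?thesis using Suc by (cases "a \<in> carrier R") auto
  qed
qed

lemma cut_pw [simp]: "cut a (f \<boxplus> g) = cut a f \<boxplus> cut a g" "cut a (c \<boxdot> f) = c \<boxdot> cut a f"
  "cut a (\<boxminus> f) = \<boxminus> cut a f" "cut a pz = pz"
  by (simp_all add: cut_def)

lemma V_z: "pz \<in> V k"
  by (induction k) (auto simp: smult_r_null KR)

lemma V_add: "f \<in> V k \<Longrightarrow> g \<in> V k \<Longrightarrow> f \<boxplus> g \<in> V k"
proof (induction k arbitrary: f g)
  case 0 then show ?case by auto
next
  case (Suc k)
  then have *: "\<And>a l. a \<in> carrier R \<Longrightarrow> cut a f l \<in> carrier M" "\<And>a l. a \<in> carrier R \<Longrightarrow> cut a g l \<in> carrier M"
    using V_closed by auto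
  show ?case using Suc * by (auto simp: fun_eq_iff M.a_ac smult_r_distr KR)
qed

lemma V_neg: "f \<in> V k \<Longrightarrow> \<boxminus> f \<in> V k"
proof (induction k arbitrary: f)
  case 0 then show ?case by auto
next
  case (Suc k)
  then have *: "\<And>a l. a \<in> carrier R \<Longrightarrow> cut a f l \<in> carrier M"
    using V_closed by auto
  show ?case using Suc * by (auto simp: fun_eq_iff M.minus_add smult_r_minus KR)
qed

lemma smult_swap: "c \<in> carrier R \<Longrightarrow> d \<in> carrier R \<Longrightarrow> x \<in> carrier M \<Longrightarrow> c \<odot>\<^bsub>M\<^esub> (d \<odot>\<^bsub>M\<^esub> x) = d \<odot>\<^bsub>M\<^esub> (c \<odot>\<^bsub>M\<^esub> x)"
  by (metis R.m_comm smult_assoc1)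

lemma V_sm: "f \<in> V k \<Longrightarrow> c \<in> K \<Longrightarrow> c \<boxdot> f \<in> V k"
proof (induction k arbitrary: f)
  case 0 then show ?case by (auto simp: KR)
next
  case (Suc k)
  then have *: "\<And>a l. a \<in> carrier R \<Longrightarrow> cut a f l \<in> carrier M"
    using V_closed by auto
  have "cut a (c \<boxdot> f) \<in> V k" if "a \<in> carrier R" for a
    using Suc that by simp
  moreover have "cut (a \<oplus>\<^bsub>R\<^esub> b) (c \<boxdot> f) = cut a (c \<boxdot> f) \<boxplus> cut b (c \<boxdot> f)"
    if "a \<in> carrier R" "b \<in> carrier R" for a b
    using Suc.prems that * by (simp add: smult_r_distr KR)
  moreover have "cut (d \<otimes>\<^bsub>R\<^esub> a) (c \<boxdot> f) = d \<boxdot> cut a (c \<boxdot> f)"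
    if "a \<in> carrier R" "d \<in> K" for a d
    using Suc.prems that * by (simp add: smult_swap[of c d] KR)
  ultimately show ?case using Suc.prems KR by simp
qed

lemma cut_mk: "cut a (mk F) = (if a \<in> carrier R then F a else pz)"
  by (auto simp: cut_def mk_def)

lemma mk_V:
  assumes "\<And>a. a \<in> carrier R \<Longrightarrow> F a \<in> V k"
    "\<And>a b. a \<in> carrier R \<Longrightarrow> b \<in> carrier R \<Longrightarrow> F (a \<oplus>\<^bsub>R\<^esub> b) = F a \<boxplus> F b"
    "\<And>c a. c \<in> K \<Longrightarrow> a \<in> carrier R \<Longrightarrow> F (c \<otimes>\<^bsub>R\<^esub> a) = c \<boxdot> F a"
  shows "mk F \<in> V (Suc k)"
  using assms by (auto simp: cut_mk KR) (simp add: mk_def)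

lemma V_eqI:
  assumes "f \<in> V (Suc k)" "g \<in> V (Suc k)" "\<And>a. a \<in> carrier R \<Longrightarrow> cut a f = cut a g"
  shows "f = g"
proof
  fix l show "f l = g l"
  proof (cases l)
    case Nil then show ?thesis using assms by simp
  next
    case (Cons a l')
    have "cut a f = cut a g" using assms by (cases "a \<in> carrier R") auto
    then show ?thesis by (metis Cons cut_def)
  qed
qed

lemma cutV: "f \<in> V (Suc k) \<Longrightarrow> a \<in> carrier R \<Longrightarrow> cut a f \<in> V k" by simp
lemma cut_a: "f \<in> V (Suc k) \<Longrightarrow> a \<in> carrier R \<Longrightarrow> b \<in> carrier R \<Longrightarrow> cut (a \<oplus>\<^bsub>R\<^esub> b) f = cut a f \<boxplus> cut b f" by simp
lemma cut_s: "f \<in> V (Suc k) \<Longrightarrow> a \<in> carrier R \<Longrightarrow> c \<in> K \<Longrightarrow> cut (c \<otimes>\<^bsub>R\<^esub> a) f = c \<boxdot> cut a f" by simp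

lemma cut_act: "a \<in> carrier R \<Longrightarrow> cut a (act s f) = cut (s \<otimes>\<^bsub>R\<^esub> a) f"
  by (simp add: act_def cut_mk)

lemma act_V: "f \<in> V (Suc k) \<Longrightarrow> s \<in> carrier R \<Longrightarrow> act s f \<in> V (Suc k)"
  unfolding act_def
proof (rule mk_V, goal_cases)
  case (1 a) then show ?case by (intro cutV) auto
next
  case (2 a b) then show ?case by (simp add: r_distr cut_a del: V.simps)
next
  case (3 c a)
  then have "s \<otimes>\<^bsub>R\<^esub> (c \<otimes>\<^bsub>R\<^esub> a) = c \<otimes>\<^bsub>R\<^esub> (s \<otimes>\<^bsub>R\<^esub> a)" using KR by (simp add: m_lcomm)
  then show ?case using 3 by (simp add: cut_s del: V.simps)
qed

lemma act_add: "f \<in> V (Suc k) \<Longrightarrow> g \<in> V (Suc k) \<Longrightarrow> s \<in> carrier R \<Longrightarrow> act s (f \<boxplus> g) = act s f \<boxplus> act s g"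
  by (rule V_eqI[of _ k]) (auto simp: cut_act act_V V_add simp del: V.simps)

lemma act_neg: "f \<in> V (Suc k) \<Longrightarrow> s \<in> carrier R \<Longrightarrow> act s (\<boxminus> f) = \<boxminus> act s f"
  by (rule V_eqI[of _ k]) (auto simp: cut_act act_V V_neg simp del: V.simps)

lemma act_l: "f \<in> V (Suc k) \<Longrightarrow> s \<in> carrier R \<Longrightarrow> t \<in> carrier R \<Longrightarrow> act (s \<oplus>\<^bsub>R\<^esub> t) f = act s f \<boxplus> act t f"
  by (rule V_eqI[of _ k]) (auto simp: cut_act act_V V_add l_distr cut_a simp del: V.simps)

lemma act_act: "f \<in> V (Suc k) \<Longrightarrow> s \<in> carrier R \<Longrightarrow> t \<in> carrier R \<Longrightarrow> act (s \<otimes>\<^bsub>R\<^esub> t) f = act s (act t f)"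
  by (rule V_eqI[of _ k]) (auto simp: cut_act act_V m_assoc m_lcomm m_comm simp del: V.simps)

lemma act_one: "f \<in> V (Suc k) \<Longrightarrow> act \<one>\<^bsub>R\<^esub> f = f"
  by (rule V_eqI[of _ k]) (auto simp: cut_act act_V simp del: V.simps)

lemma act_K: "f \<in> V (Suc k) \<Longrightarrow> s \<in> carrier R \<Longrightarrow> c \<in> K \<Longrightarrow> act (c \<otimes>\<^bsub>R\<^esub> s) f = c \<boxdot> act s f"
  by (rule V_eqI[of _ k]) (auto simp: cut_act act_V V_sm KR m_assoc cut_s simp del: V.simps)

lemma act_psm: "f \<in> V (Suc k) \<Longrightarrow> s \<in> carrier R \<Longrightarrow> c \<in> K \<Longrightarrow> act s (c \<boxdot> f) = c \<boxdot> act s f"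
  by (rule V_eqI[of _ k]) (auto simp: cut_act act_V V_sm KR simp del: V.simps)

lemma D_props:
  "(f \<in> V k \<longrightarrow> D k f \<in> V (Suc k)) \<and>
   (f \<in> V k \<longrightarrow> g \<in> V k \<longrightarrow> D k (f \<boxplus> g) = D k f \<boxplus> D k g) \<and>
   (f \<in> V k \<longrightarrow> c \<in> K \<longrightarrow> D k (c \<boxdot> f) = c \<boxdot> D k f)"
proof (induction k arbitrary: f g c)
  case 0
  have A: "D 0 f \<in> V (Suc 0)" if "f \<in> V 0" for f
    unfolding D.simps
    by (rule mk_V) (use that V_closed[OF that] in \<open>auto simp: fun_eq_iff smult_l_distr smult_assoc1 KR\<close>)
  have C: "cut a (D 0 f) = a \<boxdot> f" if "a \<in> carrier R" for a f using that by (simp add: cut_mk)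
  show ?case
  proof (intro conjI impI)
    assume "f \<in> V 0" then show "D 0 f \<in> V (Suc 0)" by (rule A)
  next
    assume f: "f \<in> V 0" and g: "g \<in> V 0"
    show "D 0 (f \<boxplus> g) = D 0 f \<boxplus> D 0 g"
    proof (rule V_eqI[of _ 0], goal_cases)
      case (3 a)
      then show ?case using V_closed[OF f] V_closed[OF g] by (simp only: C cut_pw smult_r_distr)
    qed (use f g A V_add in blast)+
  next
    assume f: "f \<in> V 0" and c: "c \<in> K"
    show "D 0 (c \<boxdot> f) = c \<boxdot> D 0 f"
    proof (rule V_eqI[of _ 0], goal_cases)
      case (3 a)
      then show ?case using V_closed[OF f] KR[OF c] by (simp only: C cut_pw smult_swap[of a c])
    qed (use f c A V_sm in blast)+
  qed
next
  case (Suc k)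
  have I1: "D k f \<in> V (Suc k)" if "f \<in> V k" for f using Suc that by blast
  have I2: "D k (f \<boxplus> g) = D k f \<boxplus> D k g" if "f \<in> V k" "g \<in> V k" for f g using Suc that by blast
  have I3: "D k (c \<boxdot> f) = c \<boxdot> D k f" if "f \<in> V k" "c \<in> K" for f c using Suc that by blast
  have A: "D (Suc k) f \<in> V (Suc (Suc k))" if f: "f \<in> V (Suc k)" for f
    unfolding D.simps
  proof (rule mk_V, goal_cases)
    case (1 a) then show ?case using f by (intro V_add V_neg I1 act_V cutV)
  next
    case (2 a b)
    have "act a f l \<in> carrier M" "act b f l \<in> carrier M" "D k (cut a f) l \<in> carrier M" "D k (cut b f) l \<in> carrier M" for l
      using f 2 V_closed[OF act_V[OF f]] V_closed[OF I1[OF cutV[OF f]]] by auto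
    then show ?case using f 2
      by (simp add: act_l cut_a cutV I2 M.minus_add M.a_ac del: V.simps)
  next
    case (3 c a)
    have "act a f l \<in> carrier M" "D k (cut a f) l \<in> carrier M" for l
      using f 3 V_closed[OF act_V[OF f]] V_closed[OF I1[OF cutV[OF f]]] by auto
    then show ?case using f 3
      by (simp add: act_K cut_s cutV I3 smult_r_distr smult_r_minus KR del: V.simps)
  qed
  have C: "cut a (D (Suc k) f) = act a f \<boxplus> \<boxminus> D k (cut a f)" if "a \<in> carrier R" for a f
    using that by (simp add: cut_mk)
  show ?case
  proof (intro conjI impI)
    assume "f \<in> V (Suc k)" then show "D (Suc k) f \<in> V (Suc (Suc k))" by (rule A)
  next
    assume f: "f \<in> V (Suc k)" and g: "g \<in> V (Suc k)"
    show "D (Suc k) (f \<boxplus> g) = D (Suc k) f \<boxplus> D (Suc k) g"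
    proof (rule V_eqI[of _ "Suc k"], goal_cases)
      case (3 a)
      have "act a f l \<in> carrier M" "act a g l \<in> carrier M" "D k (cut a f) l \<in> carrier M" "D k (cut a g) l \<in> carrier M" for l
        using f g 3 V_closed[OF act_V[OF f]] V_closed[OF act_V[OF g]] V_closed[OF I1[OF cutV[OF f]]] V_closed[OF I1[OF cutV[OF g]]] by auto
      then show ?case using f g 3
        by (simp add: C I2 cutV act_add M.minus_add M.a_ac del: V.simps D.simps)
    qed (use f g A V_add in blast)+
  next
    assume f: "f \<in> V (Suc k)" and c: "c \<in> K"
    show "D (Suc k) (c \<boxdot> f) = c \<boxdot> D (Suc k) f"
    proof (rule V_eqI[of _ "Suc k"], goal_cases)
      case (3 a)
      have "act a f l \<in> carrier M" "D k (cut a f) l \<in> carrier M" for l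
        using f 3 V_closed[OF act_V[OF f]] V_closed[OF I1[OF cutV[OF f]]] by auto
      then show ?case using f c 3
        by (simp add: C I3 cutV act_psm smult_r_distr smult_r_minus KR del: V.simps D.simps)
    qed (use f c A V_sm in blast)+
  qed
qed

lemma D_V: "f \<in> V k \<Longrightarrow> D k f \<in> V (Suc k)"
  and D_add: "f \<in> V k \<Longrightarrow> g \<in> V k \<Longrightarrow> D k (f \<boxplus> g) = D k f \<boxplus> D k g"
  using D_props by blast+

lemma D_z: "D k pz = pz"
proof -
  have e: "x = \<zero>\<^bsub>M\<^esub>" if "x \<in> carrier M" "x = x \<oplus>\<^bsub>M\<^esub> x" for x
    using that by (metis M.add.r_cancel_one')
  have "D k (pz \<boxplus> pz) = D k pz \<boxplus> D k pz" by (intro D_add V_z)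
  then have "D k pz = D k pz \<boxplus> D k pz" by simp
  then show ?thesis using e V_closed[OF D_V[OF V_z]] by (metis (no_types, lifting) ext)
qed

lemma D_neg: assumes "f \<in> V k" shows "D k (\<boxminus> f) = \<boxminus> D k f"
proof
  fix l
  have "\<boxminus> f \<boxplus> f = pz" using V_closed[OF assms] by (simp add: M.l_neg)
  then have "D k (\<boxminus> f) l \<oplus>\<^bsub>M\<^esub> D k f l = \<zero>\<^bsub>M\<^esub>" using D_add[OF V_neg[OF assms] assms] D_z by metis
  then show "D k (\<boxminus> f) l = \<ominus>\<^bsub>M\<^esub> D k f l"
    using M.minus_equality V_closed[OF D_V] assms V_neg by metis
qed

lemma cut_D: "a \<in> carrier R \<Longrightarrow> cut a (D (Suc k) f) = act a f \<boxplus> \<boxminus> D k (cut a f)"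
  by (simp add: cut_mk)

lemma D_act: assumes f: "f \<in> V (Suc k)" and s: "s \<in> carrier R"
  shows "D (Suc k) (act s f) = act s (D (Suc k) f)"
  by (rule V_eqI[of _ "Suc k"])
    (use assms in \<open>auto simp: cut_D cut_act act_V D_V act_act[symmetric] m_comm simp del: V.simps D.simps\<close>)

lemma pw_cancel: "(\<And>l. f l \<in> carrier M) \<Longrightarrow> f \<boxplus> \<boxminus> f = pz" by (simp add: M.r_neg)

lemma D_D: "f \<in> V k \<Longrightarrow> D (Suc k) (D k f) = pz"
proof (induction k arbitrary: f)
  case (0 f)
  show ?case
  proof (rule V_eqI[of _ "Suc 0"], goal_cases)
    case (3 a)
    have af: "a \<boxdot> f \<in> V 0" using 0 3 by auto
    have "act a (D 0 f) = D 0 (a \<boxdot> f)"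
    proof (rule V_eqI[of _ 0], goal_cases)
      case (3 b)
      then show ?case using \<open>a \<in> carrier R\<close> V_closed[OF 0]
        by (simp add: cut_act cut_mk smult_assoc1 smult_swap[of a b])
    qed (use 0 3 af act_V D_V in blast)+
    moreover have "cut a (D 0 f) = a \<boxdot> f" using 3 by (simp add: cut_mk)
    ultimately show ?case using 3 V_closed[OF D_V[OF af]] by (simp add: cut_D M.r_neg del: D.simps)
  qed (use 0 V_z D_V in blast)+
next
  case (Suc k f)
  note f = Suc.prems
  show ?case
  proof (rule V_eqI[of _ "Suc (Suc k)"], goal_cases)
    case (3 a)
    have Vs: "act a f \<in> V (Suc k)" "cut a f \<in> V k" "D k (cut a f) \<in> V (Suc k)"
      using f 3 act_V cutV D_V by blast+
    have "D (Suc k) (cut a (D (Suc k) f)) = D (Suc k) (act a f) \<boxplus> \<boxminus> D (Suc k) (D k (cut a f))"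
      using 3 Vs by (simp add: cut_D D_add V_neg D_neg del: D.simps V.simps)
    also have "\<dots> = D (Suc k) (act a f)"
      using Suc.IH[OF Vs(2)] V_closed[OF D_V[OF Vs(1)]] M.add.inv_one
      by (simp add: a_inv_def del: D.simps)
    finally have "cut a (D (Suc (Suc k)) (D (Suc k) f)) = D (Suc k) (act a f) \<boxplus> \<boxminus> D (Suc k) (act a f)"
      using 3 f by (simp add: cut_D[of _ "Suc k"] D_act[symmetric] del: D.simps V.simps)
    then show ?case using V_closed[OF D_V[OF Vs(1)]] by (simp add: M.r_neg del: D.simps V.simps)
  qed (use f V_z D_V in blast)+
qed

lemma D_exact: assumes f: "f \<in> V (Suc k)" and "D (Suc k) f = pz" shows "f = D k (cut \<one>\<^bsub>R\<^esub> f)"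
proof
  fix l
  have Vc: "D k (cut \<one>\<^bsub>R\<^esub> f) \<in> V (Suc k)" using f cutV D_V by blast
  have "pz = f \<boxplus> \<boxminus> D k (cut \<one>\<^bsub>R\<^esub> f)"
    using cut_D[of "\<one>\<^bsub>R\<^esub>" k f] assms by (simp add: act_one del: D.simps V.simps)
  then have "f l \<oplus>\<^bsub>M\<^esub> \<ominus>\<^bsub>M\<^esub> D k (cut \<one>\<^bsub>R\<^esub> f) l = \<zero>\<^bsub>M\<^esub>" by metis
  then show "f l = D k (cut \<one>\<^bsub>R\<^esub> f) l"
    using V_closed[OF f] V_closed[OF Vc] by (metis M.a_inv_closed M.minus_equality M.minus_minus)
qed

definition Q :: "nat \<Rightarrow> ('a, 'a list \<Rightarrow> 'm) module" where
  "Q k = \<lparr>carrier = V (Suc k), mult = undefined, one = undefined, zero = pz, add = padd, smult = act\<rparr>"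

lemma Q_simps [simp]: "carrier (Q k) = V (Suc k)" "zero (Q k) = pz" "add (Q k) = padd" "smult (Q k) = act"
  by (simp_all add: Q_def)

lemma V_abelian: "carrier N = V k \<Longrightarrow> zero N = pz \<Longrightarrow> add N = padd \<Longrightarrow> abelian_group N"
  apply (rule abelian_groupI)
  subgoal by (simp add: V_add)
  subgoal by (simp add: V_z)
  subgoal for f g h using V_closed[of f k] V_closed[of g k] V_closed[of h k] by (simp add: M.a_assoc)
  subgoal for f g using V_closed[of f k] V_closed[of g k] by (simp add: M.a_comm)
  subgoal for f using V_closed[of f k] by simp
  subgoal for f using V_closed[of f k] by (intro bexI[of _ "\<boxminus> f"]) (auto simp: M.l_neg V_neg)
  done

lemma Q_module: "Module.module R (Q k)"
  apply (rule moduleI)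
        apply (rule R.is_cring)
       apply (rule V_abelian[of _ "Suc k"]; simp)
      apply (auto simp: act_V act_l act_add act_act act_one simp del: V.simps)
  done

definition W :: "nat \<Rightarrow> ('a, 'a list \<Rightarrow> 'm) module" where
  "W k = \<lparr>carrier = V k, mult = undefined, one = undefined, zero = pz, add = padd, smult = psm\<rparr>"

definition F :: "'a ring" where "F = R\<lparr>carrier := K\<rparr>"

lemma F_field: "Ring.field F"
  unfolding F_def using K R.subfield_iff(2) by blast

lemma W_module: "Module.module F (W k)"
  apply (rule moduleI)
        apply (rule field.axioms(1)[THEN domain.axioms(1), OF F_field])
       apply (rule V_abelian[of _ "k"]; simp add: W_def)
      apply (auto simp: W_def F_def V_sm V_closed fun_eq_iff KR smult_l_distr smult_r_distr smult_assoc1 simp del: V.simps)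
  done

lemma restrict_module: "Module.module R B \<Longrightarrow> Module.module F B"
  apply (rule moduleI)
        apply (rule field.axioms(1)[THEN domain.axioms(1), OF F_field])
       apply (erule Module.module.axioms)
      apply (auto simp: F_def KR Module.module.smult_closed Module.module.smult_l_distr Module.module.smult_r_distr Module.module.smult_assoc1 Module.module.smult_one)
  done

lemma Q_injective: "injective_module R (Q k)"
  unfolding injective_module_def
proof (intro conjI allI impI; (elim conjE)?)
  show "Module.module R (Q k)" by (rule Q_module)
next
  fix B :: "('a, 'a list \<Rightarrow> 'm) module" and A f
  assume B: "Module.module R B" and A: "submodule A R B" and f: "f \<in> mod_hom R (B\<lparr>carrier := A\<rparr>) (Q k)"
  interpret B: Module.module R B by fact
  note subA = B.submoduleE[OF A]
  have fV: "\<And>x. x \<in> A \<Longrightarrow> f x \<in> V (Suc k)" and fa: "\<And>x y. x \<in> A \<Longrightarrow> y \<in> A \<Longrightarrow> f (x \<oplus>\<^bsub>B\<^esub> y) = f x \<boxplus> f y"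
    and fs: "\<And>r x. r \<in> carrier R \<Longrightarrow> x \<in> A \<Longrightarrow> f (r \<odot>\<^bsub>B\<^esub> x) = act r (f x)"
    using f unfolding mod_hom_def by (auto simp del: V.simps)
  define \<phi> where "\<phi> x = cut \<one>\<^bsub>R\<^esub> (f x)" for x
  have fs': "cut s (f x) = \<phi> (s \<odot>\<^bsub>B\<^esub> x)" if "x \<in> A" "s \<in> carrier R" for s x
    using that by (simp add: \<phi>_def fs cut_act)
  have "\<exists>g \<in> mod_hom F B (W k). \<forall>x\<in>A. g x = \<phi> x"
  proof (rule linear_extension[OF F_field restrict_module[OF B] W_module])
    show "submodule A F B"
      using A unfolding submodule_def submodule_axioms_def F_def by (auto simp: KR)
    have "\<phi> (c \<odot>\<^bsub>B\<^esub> x) = c \<boxdot> \<phi> x" if "x \<in> A" "c \<in> K" for c x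
      using that fs'[of x c] cut_s[OF fV, of x "\<one>\<^bsub>R\<^esub>" c] by (simp add: KR \<phi>_def)
    then show "\<phi> \<in> mod_hom F (B\<lparr>carrier := A\<rparr>) (W k)"
      unfolding mod_hom_def W_def F_def
      by (auto simp: \<phi>_def fa cutV[OF fV] simp del: V.simps)
  qed
  then obtain g where g: "g \<in> mod_hom F B (W k)" and gA: "\<And>x. x \<in> A \<Longrightarrow> g x = \<phi> x" by blast
  have gV: "\<And>x. x \<in> carrier B \<Longrightarrow> g x \<in> V k"
    and ga: "\<And>x y. x \<in> carrier B \<Longrightarrow> y \<in> carrier B \<Longrightarrow> g (x \<oplus>\<^bsub>B\<^esub> y) = g x \<boxplus> g y"
    and gs: "\<And>c x. c \<in> K \<Longrightarrow> x \<in> carrier B \<Longrightarrow> g (c \<odot>\<^bsub>B\<^esub> x) = c \<boxdot> g x"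
    using g unfolding mod_hom_def W_def F_def by (auto simp del: V.simps)
  define G where "G x = mk (\<lambda>s. g (s \<odot>\<^bsub>B\<^esub> x))" for x
  have cG: "cut s (G x) = g (s \<odot>\<^bsub>B\<^esub> x)" if "s \<in> carrier R" for s x
    using that by (simp add: G_def cut_mk)
  have GV: "G x \<in> V (Suc k)" if x: "x \<in> carrier B" for x
    unfolding G_def by (rule mk_V) (use x in \<open>auto simp: gV ga gs B.smult_l_distr B.smult_assoc1 KR\<close>)
  have "G \<in> mod_hom R B (Q k)"
    unfolding mod_hom_def
  proof (intro CollectI conjI ballI)
    show "G \<in> carrier B \<rightarrow> carrier (Q k)" using GV by auto
  next
    fix x y assume x: "x \<in> carrier B" "y \<in> carrier B"
    show "G (x \<oplus>\<^bsub>B\<^esub> y) = G x \<oplus>\<^bsub>Q k\<^esub> G y"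
      by (rule V_eqI[of _ k]) (use x in \<open>auto simp: GV V_add cG ga B.smult_r_distr simp del: V.simps\<close>)
  next
    fix r x assume x: "r \<in> carrier R" "x \<in> carrier B"
    show "G (r \<odot>\<^bsub>B\<^esub> x) = r \<odot>\<^bsub>Q k\<^esub> G x"
      by (rule V_eqI[of _ k]) (use x in \<open>auto simp: GV act_V cG cut_act m_comm B.smult_assoc1[symmetric] simp del: V.simps\<close>)
  qed
  moreover have "G x = f x" if x: "x \<in> A" for x
  proof (rule V_eqI[of _ k])
    have xB: "x \<in> carrier B" using x subA by blast
    show "G x \<in> V (Suc k)" using GV xB by blast
    show "f x \<in> V (Suc k)" using fV x by blast
    fix s assume s: "s \<in> carrier R"
    show "cut s (G x) = cut s (f x)" using s x xB subA by (simp add: cG fs' gA)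
  qed
  ultimately show "\<exists>g\<in>mod_hom R B (Q k). \<forall>x\<in>A. g x = f x" by blast
qed

definition E :: "'m \<Rightarrow> 'a list \<Rightarrow> 'm" where
  "E m = D 0 (\<lambda>l. if l = [] then m else \<zero>\<^bsub>M\<^esub>)"

lemma a_kernel_Q: "a_kernel (Q k) (Q j) d = {f \<in> V (Suc k). d f = pz}"
  by (simp add: a_kernel_def kernel_def del: V.simps)

lemma V0: "V 0 = (\<lambda>m l. if l = [] then m else \<zero>\<^bsub>M\<^esub>) ` carrier M" (is "_ = ?i ` _")
proof -
  have "f = ?i (f [])" if "f \<in> V 0" for f using that by auto
  then show ?thesis by auto
qed

lemma D_image: "D k ` V k = {f \<in> V (Suc k). D (Suc k) f = pz}"
proof (intro equalityI subsetI)
  fix f assume "f \<in> {f \<in> V (Suc k). D (Suc k) f = pz}"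
  then have "f \<in> V (Suc k)" "f = D k (cut \<one>\<^bsub>R\<^esub> f)" using D_exact by blast+
  moreover have "cut \<one>\<^bsub>R\<^esub> f \<in> V k" using calculation(1) cutV by blast
  ultimately show "f \<in> D k ` V k" by (metis imageI)
qed (use D_V D_D in auto)

lemma resolution: "injective_resolution R M Q (\<lambda>k. D (Suc k)) E"
  unfolding injective_resolution_def
proof (intro conjI allI)
  show "injective_module R (Q k)" for k by (rule Q_injective)
  show "D (Suc k) \<in> mod_hom R (Q k) (Q (Suc k))" for k
    unfolding mod_hom_def by (auto simp: D_V D_add D_act simp del: V.simps D.simps)
  let ?i = "\<lambda>m l::'a list. if l = [] then m else \<zero>\<^bsub>M\<^esub>"
  have iV: "m \<in> carrier M \<Longrightarrow> ?i m \<in> V 0" for m by auto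
  have EV: "m \<in> carrier M \<Longrightarrow> E m \<in> V (Suc 0)" for m unfolding E_def by (intro D_V iV)
  have cE: "cut a (E m) = a \<boxdot> ?i m" if "a \<in> carrier R" for a m using that by (simp add: E_def cut_mk)
  show "E \<in> mod_hom R M (Q 0)"
    unfolding mod_hom_def
  proof (intro CollectI conjI ballI)
    show "E \<in> carrier M \<rightarrow> carrier (Q 0)" using EV by auto
  next
    fix x y assume x: "x \<in> carrier M" "y \<in> carrier M"
    have "E (x \<oplus>\<^bsub>M\<^esub> y) = E x \<boxplus> E y"
      by (rule V_eqI[of _ 0]) (use x in \<open>auto simp: EV V_add cE smult_r_distr simp del: V.simps\<close>)
    then show "E (x \<oplus>\<^bsub>M\<^esub> y) = E x \<oplus>\<^bsub>Q 0\<^esub> E y" by simp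
  next
    fix r x assume x: "r \<in> carrier R" "x \<in> carrier M"
    have "E (r \<odot>\<^bsub>M\<^esub> x) = act r (E x)"
      by (rule V_eqI[of _ 0])
        (use x in \<open>auto simp: EV act_V cE cut_act fun_eq_iff smult_assoc1 smult_swap[of _ r] simp del: V.simps\<close>)
    then show "E (r \<odot>\<^bsub>M\<^esub> x) = r \<odot>\<^bsub>Q 0\<^esub> E x" by simp
  qed
  show "inj_on E (carrier M)"
  proof (rule inj_onI)
    fix x y assume x: "x \<in> carrier M" "y \<in> carrier M" "E x = E y"
    then have "\<one>\<^bsub>R\<^esub> \<boxdot> ?i x = \<one>\<^bsub>R\<^esub> \<boxdot> ?i y" using cE[of "\<one>\<^bsub>R\<^esub>"] by (metis R.one_closed)
    from fun_cong[OF this, of "[]"] show "x = y" using x by simp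
  qed
  have "E ` carrier M = D 0 ` V 0" unfolding V0 E_def by (simp only: image_image)
  then show "E ` carrier M = a_kernel (Q 0) (Q 1) (D (Suc 0))" by (simp only: D_image a_kernel_Q)
  show "D (Suc k) ` carrier (Q k) = a_kernel (Q (Suc k)) (Q (Suc (Suc k))) (D (Suc (Suc k)))" for k
    by (simp only: D_image a_kernel_Q Q_simps)
qed

end

lemma injective_resolution_exists:
  fixes R :: "'a ring" and M :: "('a, 'm) module"
  assumes "Module.module R M" and "subfield K R"
  shows "\<exists>(Q :: nat \<Rightarrow> ('a, 'a list \<Rightarrow> 'm) module) d e. injective_resolution R M Q d e"
proof -
  interpret cobar R M K by (intro cobar.intro cobar_axioms.intro assms)
  show ?thesis using resolution by blast
qed

corollary injective_resolution_exists_binomial_edge: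
  "\<exists>Q d e. injective_resolution (xy_ring n :: 'k :: field mpoly ring)
     (quot_module (ring_module (xy_ring n)) (binomial_edge_ideal n E))
     (Q :: nat \<Rightarrow> ('k mpoly, 'k mpoly list \<Rightarrow> 'k mpoly set) module) d e"
  by (intro injective_resolution_exists[OF _ subfield_constants] quot_module_is_module
      ring_module_is_module ideal_submodule ideal_binomial_edge cring_xy_ring)

end

theory Submission
  imports Defs
begin

text \<open>
  Write \<open>R\<close> for the polynomial ring, \<open>\<mm>\<close> for its irrelevant ideal and \<open>J\<^sub>G\<close> for the binomial edge
  ideal of \<open>G\<close>.  Depth at least \<open>d\<close> follows from \<open>Ext\<^sup>i(R/\<mm>, R/I) = 0\<close> for all \<open>i < d\<close>
  (\<open>depth_ge\<close>), and this condition on an ideal \<open>I\<close>, called \<open>ext_depth_ge d I\<close> below, obeys three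
  rules, each of which comes from a short exact sequence:

  \<^item> if \<open>v \<in> \<mm>\<close> is a nonzerodivisor modulo \<open>I\<close>, then \<open>d\<close> for \<open>I + (v)\<close> gives \<open>d + 1\<close> for \<open>I\<close>
    (\<open>ext_depth_ge_regular\<close>);
  \<^item> \<open>d\<close> for \<open>I : v\<close> and for \<open>I + (v)\<close> gives \<open>d\<close> for \<open>I\<close> (\<open>ext_depth_ge_colon\<close>);
  \<^item> \<open>d\<close> for \<open>A\<close> and for \<open>B\<close> and \<open>d - 1\<close> for \<open>A + B\<close> gives \<open>d\<close> for \<open>A \<inter> B\<close>
    (\<open>ext_depth_ge_inter\<close>).

  The Ext groups are computed from a resolution of \<open>R/\<mm>\<close> by free modules.  As these are projective,
  a homomorphism into a quotient \<open>P/I\<close> of ideals lifts to one into \<open>P\<close>, so the rules can be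
  stated and proved with congruences modulo ideals of \<open>R\<close>, without quotient modules or
  resolutions of them.  The passage to local cohomology is a dimension shift along an arbitrary
  injective resolution of \<open>R/I\<close> (\<open>dimension_shift\<close>), followed by a filtration argument from \<open>\<mm>\<close> to the powers
  of \<open>\<mm>\<close> (\<open>acyclic_below_powers\<close>).

  For the graph, let \<open>v\<close> be a vertex with two non-adjacent neighbours, \<open>G\<^sub>v\<close> the graph in which the
  neighbourhood of \<open>v\<close> has been made complete, and \<open>G - v\<close> the graph without \<open>v\<close>.  Then
  \<open>J\<^sub>G\<close> is the intersection of \<open>A = J\<^bsub>G\<^sub>v\<^esub>\<close> and \<open>B = (x\<^sub>v, y\<^sub>v) + J\<^bsub>G - v\<^esub>\<close> (\<open>complete_nbhd_inter\<close>), and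
  \<open>A + B = (x\<^sub>v, y\<^sub>v) + J\<^bsub>G\<^sub>v - v\<^esub>\<close>.  The third rule reduces the bound for \<open>G\<close> to graphs with more
  edges or fewer vertices.  If no such \<open>v\<close> is left, the components are complete.  For a disjoint union
  of complete graphs the first two rules are enough: \<open>x\<^sub>v\<close> is regular, and after adding \<open>x\<^sub>v\<close>
  the colon by \<open>y\<^sub>v\<close> adds \<open>x\<^sub>i\<close> for every \<open>i\<close> in the clique of \<open>v\<close>, while the sum with \<open>y\<^sub>v\<close> just
  deletes \<open>v\<close> (\<open>clique_depth\<close>).

  The induction does not run over the components but over partitions of the vertices into blocks
  without edges between different blocks, where a block \<open>C\<close> counts \<open>|C| + 1\<close> if it is complete and \<open>4\<close>
  otherwise (\<open>block_partition_depth\<close>).  Blocks may be disconnected, and this is harmless: a block that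
  falls apart into two pieces splits into blocks of weight at least \<open>2\<close> each.  It spares the question
  which components the deletion of \<open>v\<close> produces, because the rest of its block still contains the two
  non-adjacent neighbours and therefore still counts \<open>4\<close>.
\<close>

abbreviation lookup where "lookup \<equiv> Poly_Mapping.lookup"
abbreviation keys where "keys \<equiv> Poly_Mapping.keys"
abbreviation single where "single \<equiv> Poly_Mapping.single"


section \<open>Module homomorphisms\<close>

lemma mod_homD:
  assumes "f \<in> mod_hom R M N"
  shows "x \<in> carrier M \<Longrightarrow> f x \<in> carrier N"
    and "x \<in> carrier M \<Longrightarrow> y \<in> carrier M \<Longrightarrow> f (x \<oplus>\<^bsub>M\<^esub> y) = f x \<oplus>\<^bsub>N\<^esub> f y"
    and "r \<in> carrier R \<Longrightarrow> x \<in> carrier M \<Longrightarrow> f (r \<odot>\<^bsub>M\<^esub> x) = r \<odot>\<^bsub>N\<^esub> f x"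
  using assms unfolding mod_hom_def by auto

lemma mod_homI:
  assumes "\<And>x. x \<in> carrier M \<Longrightarrow> f x \<in> carrier N"
    and "\<And>x y. x \<in> carrier M \<Longrightarrow> y \<in> carrier M \<Longrightarrow> f (x \<oplus>\<^bsub>M\<^esub> y) = f x \<oplus>\<^bsub>N\<^esub> f y"
    and "\<And>r x. r \<in> carrier R \<Longrightarrow> x \<in> carrier M \<Longrightarrow> f (r \<odot>\<^bsub>M\<^esub> x) = r \<odot>\<^bsub>N\<^esub> f x"
  shows "f \<in> mod_hom R M N"
  using assms unfolding mod_hom_def by auto

lemma mod_hom_comp:
  "f \<in> mod_hom R L M \<Longrightarrow> g \<in> mod_hom R M N \<Longrightarrow> (\<lambda>x. g (f x)) \<in> mod_hom R L N"
  unfolding mod_hom_def by (auto simp: Pi_iff)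

lemma mod_hom_zero:
  assumes "Module.module R M" "Module.module R N" "f \<in> mod_hom R M N"
  shows "f \<zero>\<^bsub>M\<^esub> = \<zero>\<^bsub>N\<^esub>"
proof -
  interpret M: Module.module R M by fact
  interpret N: Module.module R N by fact
  have "f (\<zero>\<^bsub>R\<^esub> \<odot>\<^bsub>M\<^esub> \<zero>\<^bsub>M\<^esub>) = \<zero>\<^bsub>R\<^esub> \<odot>\<^bsub>N\<^esub> f \<zero>\<^bsub>M\<^esub>"
    by (rule mod_homD(3)[OF assms(3)]) auto
  then show ?thesis using mod_homD(1)[OF assms(3), of "\<zero>\<^bsub>M\<^esub>"] by simp
qed

lemma mod_hom_uminus:
  assumes "Module.module R M" "Module.module R N" "f \<in> mod_hom R M N" "x \<in> carrier M"
  shows "f (\<ominus>\<^bsub>M\<^esub> x) = \<ominus>\<^bsub>N\<^esub> f x"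
proof -
  interpret M: Module.module R M by fact
  interpret N: Module.module R N by fact
  note h = mod_homD[OF assms(3)]
  have "f (\<ominus>\<^bsub>M\<^esub> x) \<oplus>\<^bsub>N\<^esub> f x = \<zero>\<^bsub>N\<^esub>"
    using h(2)[of "\<ominus>\<^bsub>M\<^esub> x" x] assms(4) mod_hom_zero[OF assms(1-3)] by (simp add: M.M.l_neg)
  then show ?thesis using h(1) assms(4) by (metis M.M.a_inv_closed N.M.minus_equality)
qed

lemma mod_hom_diff:
  assumes "Module.module R M" "Module.module R N" "f \<in> mod_hom R M N" "g \<in> mod_hom R M N"
  shows "(\<lambda>x. f x \<ominus>\<^bsub>N\<^esub> g x) \<in> mod_hom R M N"
proof -
  interpret M: Module.module R M by fact
  interpret N: Module.module R N by fact
  note h = mod_homD[OF assms(3)] and k = mod_homD[OF assms(4)]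
  show ?thesis
    by (rule mod_homI)
      (simp_all add: h k N.M.minus_closed a_minus_def N.M.minus_add N.M.a_ac N.smult_r_distr N.smult_r_minus)
qed

section \<open>Rings on a type with ring operations\<close>

text \<open>A ring whose operations are those of the type class, while its carrier may be smaller
  than the type.  Computations can then use the simplifier's algebra for the type.\<close>

locale typed_cring = cring R for R :: "'a :: comm_ring_1 ring" (structure) +
  assumes ops: "mult R = (*)" "one R = 1" "zero R = 0" "add R = (+)"
begin

lemma uminus_R: "x \<in> carrier R \<Longrightarrow> \<ominus> x = - x"
  using l_neg[of x] by (simp add: ops eq_neg_iff_add_eq_0)

lemma R_closed:
  "x \<in> carrier R \<Longrightarrow> y \<in> carrier R \<Longrightarrow> x + y \<in> carrier R"
  "x \<in> carrier R \<Longrightarrow> y \<in> carrier R \<Longrightarrow> x * y \<in> carrier R"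
  "x \<in> carrier R \<Longrightarrow> y \<in> carrier R \<Longrightarrow> x - y \<in> carrier R"
  "x \<in> carrier R \<Longrightarrow> - x \<in> carrier R"
  "0 \<in> carrier R" "1 \<in> carrier R"
proof -
  show A: "x + y \<in> carrier R" if "x \<in> carrier R" "y \<in> carrier R" for x y
    using a_closed[OF that] by (simp add: ops)
  show "x * y \<in> carrier R" if "x \<in> carrier R" "y \<in> carrier R" for x y
    using m_closed[OF that] by (simp add: ops)
  show N: "- x \<in> carrier R" if "x \<in> carrier R" for x
    using a_inv_closed[OF that] by (simp add: uminus_R that)
  show "x - y \<in> carrier R" if "x \<in> carrier R" "y \<in> carrier R" for x y
    using A[OF that(1) N[OF that(2)]] by simp
qed (use zero_closed one_closed in \<open>simp_all add: ops\<close>)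

lemma ideal_closed:
  assumes "ideal I R"
  shows "I \<subseteq> carrier R" "0 \<in> I" "x \<in> I \<Longrightarrow> y \<in> I \<Longrightarrow> x + y \<in> I" "x \<in> I \<Longrightarrow> y \<in> I \<Longrightarrow> x - y \<in> I"
    "x \<in> I \<Longrightarrow> - x \<in> I" "r \<in> carrier R \<Longrightarrow> x \<in> I \<Longrightarrow> r * x \<in> I" "r \<in> carrier R \<Longrightarrow> x \<in> I \<Longrightarrow> x * r \<in> I"
proof -
  interpret I: ideal I R by fact
  show S: "I \<subseteq> carrier R" by (rule I.a_subset)
  show "0 \<in> I" using I.zero_closed by (simp add: ops)
  show A: "x + y \<in> I" if "x \<in> I" "y \<in> I" for x y using I.a_closed[OF that] by (simp add: ops)
  show M: "r * x \<in> I" if "r \<in> carrier R" "x \<in> I" for r x using I.I_l_closed[OF that(2,1)] by (simp add: ops)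
  show "x * r \<in> I" if "r \<in> carrier R" "x \<in> I" for r x using M[OF that] by (simp add: mult.commute)
  show N: "- x \<in> I" if "x \<in> I" for x using M[of "-1" x] that R_closed by simp
  show "x - y \<in> I" if "x \<in> I" "y \<in> I" for x y using A[OF that(1) N[OF that(2)]] by simp
qed

lemma idealI':
  assumes "I \<subseteq> carrier R" "0 \<in> I" "\<And>x y. x \<in> I \<Longrightarrow> y \<in> I \<Longrightarrow> x + y \<in> I"
    "\<And>r x. r \<in> carrier R \<Longrightarrow> x \<in> I \<Longrightarrow> r * x \<in> I"
  shows "ideal I R"
proof (rule idealI)
  show "subgroup I (add_monoid R)"
  proof (rule add.subgroupI)
    show "\<ominus> a \<in> I" if "a \<in> I" for a
      using assms(4)[of "-1" a] that assms(1) R_closed by (auto simp: uminus_R)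
  qed (use assms in \<open>auto simp: ops\<close>)
  show "x \<otimes> a \<in> I" if "a \<in> I" "x \<in> carrier R" for a x using assms(4)[OF that(2,1)] by (simp add: ops)
  show "a \<otimes> x \<in> I" if "a \<in> I" "x \<in> carrier R" for a x
    using assms(4)[OF that(2,1)] by (simp add: ops mult.commute[of a])
qed (rule ring_axioms)

lemma ideal_sum:
  assumes A: "ideal A R" and B: "ideal B R"
  shows "ideal {a + b | a b. a \<in> A \<and> b \<in> B} R" (is "ideal ?K R")
proof (rule idealI')
  note a = ideal_closed[OF A] and b = ideal_closed[OF B]
  show "?K \<subseteq> carrier R" using a(1) b(1) R_closed(1) by blast
  show "0 \<in> ?K" using a(2) b(2) by force
next
  note a = ideal_closed[OF A] and b = ideal_closed[OF B]
  fix x y assume "x \<in> ?K" "y \<in> ?K"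
  then obtain p q r s where "p \<in> A" "q \<in> B" "x = p + q" "r \<in> A" "s \<in> B" "y = r + s" by blast
  moreover from this have "p + q + (r + s) = (p + r) + (q + s)" by (simp only: add_ac)
  ultimately show "x + y \<in> ?K" using a(3) b(3) by blast
next
  note a = ideal_closed[OF A] and b = ideal_closed[OF B]
  fix r x assume "r \<in> carrier R" "x \<in> ?K"
  then show "r * x \<in> ?K" using a(6) b(6) distrib_left by blast
qed

lemma ideal_adjoin:
  assumes I: "ideal I R" and v: "v \<in> carrier R"
  shows "ideal {a + v * r | a r. a \<in> I \<and> r \<in> carrier R} R" (is "ideal ?K R")
proof (rule idealI')
  note i = ideal_closed[OF I]
  show "?K \<subseteq> carrier R" using i v by (auto intro!: R_closed)
  show "0 \<in> ?K"
    using i(2) R_closed(5) by (intro CollectI exI[of _ 0]) simp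
next
  note i = ideal_closed[OF I]
  fix x y assume "x \<in> ?K" "y \<in> ?K"
  then obtain a r b s where "a \<in> I" "r \<in> carrier R" "x = a + v * r" "b \<in> I" "s \<in> carrier R" "y = b + v * s" by blast
  then show "x + y \<in> ?K"
    using i(3) R_closed(1)
    by (intro CollectI, rule_tac x="a + b" in exI, rule_tac x="r + s" in exI) (simp add: algebra_simps)
next
  note i = ideal_closed[OF I]
  fix c x assume "x \<in> ?K" and c: "c \<in> carrier R"
  then obtain a r where "a \<in> I" "r \<in> carrier R" "x = a + v * r" by blast
  then show "c * x \<in> ?K"
    using i(6)[OF c] R_closed(2)[OF c]
    by (intro CollectI, rule_tac x="c * a" in exI, rule_tac x="c * r" in exI) (simp add: distrib_left mult.left_commute)
qed

lemma ideal_colon: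
  assumes I: "ideal I R" and v: "v \<in> carrier R"
  shows "ideal {p \<in> carrier R. v * p \<in> I} R" (is "ideal ?K R")
proof (rule idealI')
  show "0 \<in> ?K" using ideal_closed(2)[OF I] R_closed(5) by simp
  show "x + y \<in> ?K" if "x \<in> ?K" "y \<in> ?K" for x y
    using that ideal_closed(3)[OF I] R_closed(1) by (simp add: distrib_left)
  show "r * x \<in> ?K" if "r \<in> carrier R" "x \<in> ?K" for r x
    using that ideal_closed(6)[OF I, of r "v * x"] R_closed(2) by (simp add: mult.left_commute)
qed auto

lemma R_power_closed: "x \<in> carrier R \<Longrightarrow> x ^ k \<in> carrier R"
  by (induction k) (simp_all add: R_closed)

lemma ideal_power:
  assumes a: "ideal a R"
  shows "ideal (a [^]\<^bsub>ideals_set R\<^esub> k) R"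
    and "x \<in> a \<Longrightarrow> x ^ k \<in> a [^]\<^bsub>ideals_set R\<^esub> k"
    and "a [^]\<^bsub>ideals_set R\<^esub> (k + l) \<subseteq> a [^]\<^bsub>ideals_set R\<^esub> k"
proof -
  interpret S: comm_monoid "ideals_set R" by (rule ideals_set_is_comm_monoid)
  have c: "a \<in> carrier (ideals_set R)" using a by (simp add: ideals_set_def)
  have c': "ideal (a [^]\<^bsub>ideals_set R\<^esub> k) R" for k :: nat
    using S.nat_pow_closed[OF c] by (simp add: ideals_set_def)
  show "ideal (a [^]\<^bsub>ideals_set R\<^esub> k) R" by (rule c')
  show "x ^ k \<in> a [^]\<^bsub>ideals_set R\<^esub> k" if x: "x \<in> a"
  proof (induction k)
    case 0
    then show ?case using R_closed(6) by (simp add: ideals_set_def)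
  next
    case (Suc k)
    have "(x ^ k) \<otimes> x \<in> (a [^]\<^bsub>ideals_set R\<^esub> k) \<cdot> a" by (rule ideal_prod.prod[OF Suc x])
    then show ?case by (simp add: ideals_set_def ops mult.commute)
  qed
  have "a [^]\<^bsub>ideals_set R\<^esub> (k + l) = (a [^]\<^bsub>ideals_set R\<^esub> k) \<cdot> (a [^]\<^bsub>ideals_set R\<^esub> l)"
    using S.nat_pow_mult[OF c, of k l] by (simp add: ideals_set_def)
  then show "a [^]\<^bsub>ideals_set R\<^esub> (k + l) \<subseteq> a [^]\<^bsub>ideals_set R\<^esub> k"
    using ideal_prod_inter[OF c'[of k] c'[of l]] by simp
qed

abbreviation RM :: "('a, 'a) module" where "RM \<equiv> ring_module R"

lemma RM_module: "Module.module R RM"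
  by (rule ring_module_is_module) (rule is_cring)

lemma RM_simps [simp]: "carrier RM = carrier R" "add RM = (+)" "zero RM = 0" "smult RM = (*)"
  by (simp_all add: ring_module_def ops)

section \<open>A free module of large rank\<close>

text \<open>The free module with basis all lists over the ring.  It has two uses: over an infinite type it is
  big enough to have every one of its own submodules as a quotient, so one module serves in all degrees of a
  resolution, and its elements, read as functions on lists with singleton values, embed into the
  type \<open>'a list \<Rightarrow> 'a set\<close> over which injectivity of the modules in a resolution is tested.\<close>

definition Free :: "('a, 'a list \<Rightarrow>\<^sub>0 'a) module" where
  "Free = \<lparr>carrier = {f. \<forall>l. lookup f l \<in> carrier R}, mult = undefined, one = undefined,
     zero = 0, add = (+), smult = (\<lambda>r. Poly_Mapping.map ((*) r))\<rparr>"

lemma lookup_scale: "lookup (Poly_Mapping.map ((*) r) f) l = r * lookup f l" for r :: 'a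
  by (transfer) (simp add: when_def)

lemma Free_simps:
  "f \<in> carrier Free \<longleftrightarrow> (\<forall>l. lookup f l \<in> carrier R)"
  "add Free = (+)" "zero Free = 0" "smult Free = (\<lambda>r. Poly_Mapping.map ((*) r))"
  by (simp_all add: Free_def)

lemma Free_closed:
  "f \<in> carrier Free \<Longrightarrow> g \<in> carrier Free \<Longrightarrow> f + g \<in> carrier Free"
  "f \<in> carrier Free \<Longrightarrow> g \<in> carrier Free \<Longrightarrow> f - g \<in> carrier Free"
  "f \<in> carrier Free \<Longrightarrow> - f \<in> carrier Free"
  "0 \<in> carrier Free" "r \<in> carrier R \<Longrightarrow> single l r \<in> carrier Free"
  by (auto simp: Free_simps lookup_add lookup_minus lookup_single when_def R_closed)

lemma Free_module: "Module.module R Free"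
proof (rule moduleI)
  show "abelian_group Free"
  proof (rule abelian_groupI)
    show "\<exists>y\<in>carrier Free. y \<oplus>\<^bsub>Free\<^esub> x = \<zero>\<^bsub>Free\<^esub>" if "x \<in> carrier Free" for x
      using Free_closed(3)[OF that] by (intro bexI[of _ "- x"]) (auto simp: Free_simps)
  qed (auto simp: Free_simps lookup_add R_closed add.assoc add.commute)
next
  show "a \<odot>\<^bsub>Free\<^esub> x \<in> carrier Free" if "a \<in> carrier R" "x \<in> carrier Free" for a x
    using that by (simp add: Free_simps lookup_scale R_closed)
qed (rule is_cring, unfold Free_simps ops, (rule poly_mapping_eqI,
     simp add: lookup_scale lookup_add distrib_left distrib_right mult.assoc)+)

lemma Free_minus: "f \<in> carrier Free \<Longrightarrow> g \<in> carrier Free \<Longrightarrow> f \<ominus>\<^bsub>Free\<^esub> g = f - g"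
proof -
  assume f: "f \<in> carrier Free" "g \<in> carrier Free"
  interpret Module.module R Free by (rule Free_module)
  have "\<ominus>\<^bsub>Free\<^esub> g = - g" by (rule M.minus_equality) (use f Free_closed in \<open>auto simp: Free_simps(2,3)\<close>)
  then show ?thesis by (simp add: a_minus_def Free_simps(2))
qed

abbreviation basis :: "'a list \<Rightarrow> 'a list \<Rightarrow>\<^sub>0 'a" where "basis l \<equiv> single l 1"

lemma scale_basis: "r \<odot>\<^bsub>Free\<^esub> basis l = single l r"
  by (rule poly_mapping_eqI) (simp add: Free_simps lookup_scale lookup_single when_def)

lemma Free_induct [consumes 1, case_names zero scale add]:
  assumes f: "f \<in> carrier Free" and "P 0"
    and "\<And>r l. r \<in> carrier R \<Longrightarrow> P (r \<odot>\<^bsub>Free\<^esub> basis l)"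
    and "\<And>f g. f \<in> carrier Free \<Longrightarrow> g \<in> carrier Free \<Longrightarrow> P f \<Longrightarrow> P g \<Longrightarrow> P (f + g)"
  shows "P f"
  using f
proof (induction "card (keys f)" arbitrary: f rule: less_induct)
  case less
  show ?case
  proof (cases "f = 0")
    case False
    then obtain l where l: "l \<in> keys f" by (metis keys_eq_empty equals0I)
    let ?s = "single l (lookup f l)"
    have s: "?s \<in> carrier Free" using less(2) by (intro Free_closed) (auto simp: Free_simps)
    have k: "keys (f - ?s) = keys f - {l}"
      by (auto simp: in_keys_iff lookup_minus lookup_single when_def split: if_splits)
    then have "card (keys (f - ?s)) < card (keys f)"
      using l by (simp add: card_Diff1_less del: card_Diff_insert)
    then have "P (f - ?s)" using less(1) Free_closed(2)[OF less(2) s] by simp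
    moreover have "P ?s" using assms(3)[of "lookup f l" l] less(2) unfolding scale_basis by (auto simp: Free_simps)
    ultimately have "P (f - ?s + ?s)" using assms(4)[OF Free_closed(2)[OF less(2) s] s] by simp
    then show ?thesis by simp
  qed (use assms in simp)
qed

lemma hom_eqI:
  assumes N: "Module.module R N" and h: "h \<in> mod_hom R Free N" "h' \<in> mod_hom R Free N"
    and "\<And>l. h (basis l) = h' (basis l)" and f: "f \<in> carrier Free"
  shows "h f = h' f"
  using f
proof (induction rule: Free_induct)
  case zero
  show ?case using mod_hom_zero[OF Free_module N h(1)] mod_hom_zero[OF Free_module N h(2)] by (simp add: Free_simps)
next
  case (scale r l)
  then show ?case using mod_homD(3)[OF h(1)] mod_homD(3)[OF h(2)] assms(4) Free_closed R_closed by simp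
next
  case (add f g)
  then show ?case using mod_homD(2)[OF h(1)] mod_homD(2)[OF h(2)] by (simp add: Free_simps(2))
qed

definition lin :: "('a, 'n) module \<Rightarrow> ('a list \<Rightarrow> 'n) \<Rightarrow> ('a list \<Rightarrow>\<^sub>0 'a) \<Rightarrow> 'n" where
  "lin N b f = finsum N (\<lambda>l. lookup f l \<odot>\<^bsub>N\<^esub> b l) (keys f)"

lemma lin_superset:
  assumes N: "Module.module R N" and b: "\<And>l. b l \<in> carrier N" and f: "f \<in> carrier Free"
    and A: "finite A" "keys f \<subseteq> A"
  shows "lin N b f = finsum N (\<lambda>l. lookup f l \<odot>\<^bsub>N\<^esub> b l) A"
proof -
  interpret N: Module.module R N by fact
  have z: "0 \<odot>\<^bsub>N\<^esub> b l = \<zero>\<^bsub>N\<^esub>" for l using N.smult_l_null[OF b] by (simp add: ops)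
  show ?thesis unfolding lin_def
    by (rule N.M.add.finprod_mono_neutral_cong_left)
      (use assms z in \<open>auto simp: Free_simps in_keys_iff\<close>)
qed

lemma lin_hom:
  assumes N: "Module.module R N" and b: "\<And>l. b l \<in> carrier N"
  shows "lin N b \<in> mod_hom R Free N" and "lin N b (basis l) = b l"
proof -
  interpret N: Module.module R N by fact
  have c: "lookup f l \<odot>\<^bsub>N\<^esub> b l \<in> carrier N" if "f \<in> carrier Free" for f l
    using that b by (auto simp: Free_simps)
  show "lin N b \<in> mod_hom R Free N"
  proof (rule mod_homI)
    show "lin N b f \<in> carrier N" if "f \<in> carrier Free" for f
      unfolding lin_def by (rule N.M.finsum_closed) (use c that in auto)
    show "lin N b (f \<oplus>\<^bsub>Free\<^esub> g) = lin N b f \<oplus>\<^bsub>N\<^esub> lin N b g"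
      if fg: "f \<in> carrier Free" "g \<in> carrier Free" for f g
    proof -
      let ?A = "keys f \<union> keys g"
      have s: "f + g \<in> carrier Free" using fg by (rule Free_closed)
      have "lin N b (f + g) = finsum N (\<lambda>l. lookup f l \<odot>\<^bsub>N\<^esub> b l \<oplus>\<^bsub>N\<^esub> lookup g l \<odot>\<^bsub>N\<^esub> b l) ?A"
        unfolding lin_superset[OF N b s _ Poly_Mapping.keys_add, simplified]
        using fg b by (intro N.M.finsum_cong') (auto simp: lookup_add ops Free_simps N.smult_l_distr[unfolded ops])
      also have "\<dots> = finsum N (\<lambda>l. lookup f l \<odot>\<^bsub>N\<^esub> b l) ?A \<oplus>\<^bsub>N\<^esub> finsum N (\<lambda>l. lookup g l \<odot>\<^bsub>N\<^esub> b l) ?A"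
        by (rule N.M.finsum_addf) (use c fg in auto)
      finally show ?thesis
        using lin_superset[OF N b fg(1), of ?A] lin_superset[OF N b fg(2), of ?A] by (simp add: Free_simps(2))
    qed
    show "lin N b (r \<odot>\<^bsub>Free\<^esub> f) = r \<odot>\<^bsub>N\<^esub> lin N b f" if rf: "r \<in> carrier R" "f \<in> carrier Free" for r f
    proof -
      have s: "r \<odot>\<^bsub>Free\<^esub> f \<in> carrier Free" using rf Module.module.smult_closed[OF Free_module] by blast
      have k: "keys (r \<odot>\<^bsub>Free\<^esub> f) \<subseteq> keys f"
        by (auto simp: in_keys_iff Free_simps lookup_scale)
      have "lin N b (r \<odot>\<^bsub>Free\<^esub> f) = finsum N (\<lambda>l. r \<odot>\<^bsub>N\<^esub> (lookup f l \<odot>\<^bsub>N\<^esub> b l)) (keys f)"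
        unfolding lin_superset[OF N b s _ k, simplified]
        using rf b by (intro N.M.finsum_cong') (auto simp: Free_simps lookup_scale N.smult_assoc1[unfolded ops])
      then show ?thesis unfolding lin_def
        by (subst N.finsum_smult_ldistr) (use rf c in auto)
    qed
  qed
  show "lin N b (basis l) = b l"
  proof -
    have o: "1 \<odot>\<^bsub>N\<^esub> b l = b l" using N.smult_one[OF b] by (simp add: ops)
    have "lin N b (basis l) = finsum N (\<lambda>k. lookup (basis l) k \<odot>\<^bsub>N\<^esub> b k) {l}"
      by (rule lin_superset[OF N b]) (auto intro: Free_closed R_closed)
    then show ?thesis using o b by simp
  qed
qed

lemma projective:
  assumes B: "Module.module R B" and C: "Module.module R C"
    and h: "h \<in> mod_hom R Free C" and p: "p \<in> mod_hom R B C"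
    and im: "\<And>f. f \<in> carrier Free \<Longrightarrow> h f \<in> p ` carrier B"
  obtains g where "g \<in> mod_hom R Free B" "\<And>f. f \<in> carrier Free \<Longrightarrow> p (g f) = h f"
proof -
  have "\<forall>l. \<exists>x\<in>carrier B. p x = h (basis l)"
    using im[OF Free_closed(5)[OF R_closed(6)]] by (metis imageE)
  then obtain b where b: "\<And>l. b l \<in> carrier B" "\<And>l. p (b l) = h (basis l)" by metis
  note g = lin_hom[OF B b(1)]
  have "p (lin B b f) = h f" if "f \<in> carrier Free" for f
    by (rule hom_eqI[OF C mod_hom_comp[OF g(1) p] h _ that]) (simp add: g(2) b(2))
  then show ?thesis by (rule that[OF g(1)])
qed

end

text \<open>This is what lets the lists, the basis of the free module, also enumerate all its
  elements.\<close>

section \<open>A free resolution of the residue ring\<close>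

lemma ex_surj_list_poly_mapping:
  assumes "infinite (UNIV :: 'a :: comm_ring_1 set)"
  shows "\<exists>s :: 'a list \<Rightarrow> ('a list \<Rightarrow>\<^sub>0 'a). surj s"
proof -
  obtain h :: "'a \<Rightarrow> 'a" where h: "bij_betw h UNIV (UNIV - {0})"
    using infinite_imp_bij_betw[OF assms] by blast
  \<comment> \<open>Reading \<open>0\<close> as a separator makes a list over \<open>'a\<close> a list of lists; a chunk \<open>r # l\<close> then
    stands for the multiple of the basis element \<open>l\<close> by \<open>r\<close>.\<close>
  define go :: "'a list \<Rightarrow> ('a list \<Rightarrow>\<^sub>0 'a) \<times> 'a list" where
    "go = rec_list (0, []) (\<lambda>a _ (f, l). if a = 0 then (f + single (tl l) (hd l), [])
       else (f, inv_into UNIV h a # l))"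
  have go0: "go [] = (0, [])" and go1: "go (0 # as) = (fst (go as) + single (tl (snd (go as))) (hd (snd (go as))), [])" for as
    by (simp_all add: go_def split_beta)
  have "h c \<noteq> 0" "inv_into UNIV h (h c) = c" for c
    using h by (auto simp: bij_betw_def)
  then have go2: "go (h c # as) = (fst (go as), c # snd (go as))" for c as
    by (simp add: go_def split_beta)
  have go3: "go (map h l @ as) = (fst (go as), l @ snd (go as))" for l as
    by (induction l) (simp_all add: go2)
  have "\<exists>as. go as = (f, [])" for f
  proof (induction f rule: update_induct)
    case const
    show ?case using go0 by blast
  next
    case (update f l r)
    then obtain as where "go as = (f, [])" by blast
    then have "go (0 # map h (r # l) @ as) = (f + single l r, [])"
      by (simp only: go1 go3 fst_conv snd_conv) simp
    moreover have "f + single l r = Poly_Mapping.update l r f"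
      using update(1) by (intro poly_mapping_eqI) (auto simp: lookup_add lookup_update lookup_single when_def in_keys_iff)
    ultimately show ?case by metis
  qed
  then have "surj (\<lambda>as. fst (go as))" by (metis fst_conv surjI)
  then show ?thesis by blast
qed

locale residue_resolution = typed_cring +
  fixes \<mm>
  assumes ideal_m: "ideal \<mm> R" and infinite_type: "infinite (UNIV :: 'a set)"
begin

definition enum :: "'a list \<Rightarrow> 'a list \<Rightarrow>\<^sub>0 'a" where "enum = (SOME s. surj s)"

lemma surj_enum: "surj enum"
  unfolding enum_def by (rule someI_ex[OF ex_surj_list_poly_mapping[OF infinite_type]])

text \<open>Elements of \<open>A\<close> are hit by the basis vectors that enumerate them; the other basis vectors
  go to \<open>0\<close>.\<close>

definition cover :: "('a list \<Rightarrow>\<^sub>0 'a) set \<Rightarrow> ('a list \<Rightarrow>\<^sub>0 'a) \<Rightarrow> 'a list \<Rightarrow>\<^sub>0 'a" where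
  "cover A = lin Free (\<lambda>l. if enum l \<in> A then enum l else 0)"

lemma cover:
  assumes A: "submodule A R Free"
  shows "cover A \<in> mod_hom R Free Free" and "cover A ` carrier Free = A"
proof -
  interpret F: Module.module R Free by (rule Free_module)
  note sub = F.submoduleE[OF A]
  have z: "0 \<in> A" using A by (metis submodule.axioms(1) subgroup.one_closed Free_simps(3) monoid.simps(2))
  let ?b = "\<lambda>l. if enum l \<in> A then enum l else 0"
  have b: "?b l \<in> carrier Free" "?b l \<in> A" for l using z sub(1) by auto
  note L = lin_hom[OF Free_module b(1)]
  show C: "cover A \<in> mod_hom R Free Free" unfolding cover_def by (rule L(1))
  note h = mod_homD[OF C]
  have "cover A f \<in> A" if "f \<in> carrier Free" for f
    using that
  proof (induction rule: Free_induct)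
    case zero show ?case using mod_hom_zero[OF Free_module Free_module C] z by (simp add: Free_simps)
  next
    case (scale r l)
    then show ?case using h(3)[OF scale Free_closed(5)[OF R_closed(6)]] sub(4)[OF scale b(2)[of l]]
      unfolding cover_def L(2) by metis
  next
    case (add f g) then show ?case using h(2)[of f g] sub(5) by (simp add: Free_simps(2))
  qed
  moreover have "f \<in> cover A ` carrier Free" if f: "f \<in> A" for f
  proof -
    obtain l where "f = enum l" using surj_enum by (metis surjD)
    then have "cover A (basis l) = f" unfolding cover_def L(2) using f by simp
    then show ?thesis using Free_closed(5)[OF R_closed(6)] by (metis imageI)
  qed
  ultimately show "cover A ` carrier Free = A" by blast
qed

text \<open>\<open>syz 0\<close> is the kernel of the map \<open>Free \<rightarrow> R/\<mm>\<close> that reads off the coefficient of the empty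
  list, and \<open>syz (Suc i)\<close> is the kernel of the cover of \<open>syz i\<close>.  Hence
  \<open>\<dots> \<rightarrow> Free \<rightarrow> Free \<rightarrow> R/\<mm>\<close> with the differentials \<open>dd\<close> is exact; the convention \<open>dd 0 = 0\<close> makes the
  coboundaries in degree \<open>0\<close> trivial.\<close>

primrec syz :: "nat \<Rightarrow> ('a list \<Rightarrow>\<^sub>0 'a) set" where
  "syz 0 = {f \<in> carrier Free. lookup f [] \<in> \<mm>}"
| "syz (Suc i) = {f \<in> carrier Free. cover (syz i) f = 0}"

definition dd :: "nat \<Rightarrow> ('a list \<Rightarrow>\<^sub>0 'a) \<Rightarrow> 'a list \<Rightarrow>\<^sub>0 'a" where
  "dd i = (case i of 0 \<Rightarrow> (\<lambda>f. 0) | Suc j \<Rightarrow> cover (syz j))"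

lemma kernel_submodule:
  assumes N: "Module.module R N" and h: "h \<in> mod_hom R Free N"
  shows "submodule {f \<in> carrier Free. h f = \<zero>\<^bsub>N\<^esub>} R Free"
proof -
  interpret F: Module.module R Free by (rule Free_module)
  interpret N: Module.module R N by fact
  show ?thesis
  proof (rule F.submoduleI)
    show "\<zero>\<^bsub>Free\<^esub> \<in> {f \<in> carrier Free. h f = \<zero>\<^bsub>N\<^esub>}" using mod_hom_zero[OF Free_module N h] by simp
  qed (use mod_hom_uminus[OF Free_module N h] mod_homD[OF h] in auto)
qed

lemma syz_submodule: "submodule (syz i) R Free"
proof (induction i)
  case 0
  interpret F: Module.module R Free by (rule Free_module)
  note I = ideal_closed[OF ideal_m]
  show ?case unfolding syz.simps
  proof (rule F.submoduleI)
    fix f assume f: "f \<in> {f \<in> carrier Free. lookup f [] \<in> \<mm>}"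
    then have "\<ominus>\<^bsub>Free\<^esub> f = - f"
      using Free_minus[of 0 f] Free_closed F.M.minus_eq[of 0 f] F.M.l_zero by (simp add: Free_simps(2))
    then show "\<ominus>\<^bsub>Free\<^esub> f \<in> {f \<in> carrier Free. lookup f [] \<in> \<mm>}"
      using f Free_closed(3) I(5) by simp
  qed (use I in \<open>auto simp: Free_simps lookup_add lookup_scale R_closed\<close>)
next
  case (Suc i)
  show ?case
    using kernel_submodule[OF Free_module cover(1)[OF Suc]] by (simp add: Free_simps(3))
qed

lemma syz_Free: "f \<in> syz i \<Longrightarrow> f \<in> carrier Free"
  by (cases i) auto

lemma dd_hom: "dd i \<in> mod_hom R Free Free"
proof (cases i)
  case 0
  then show ?thesis unfolding dd_def
    by (intro mod_homI) (auto simp: Free_simps R_closed intro!: poly_mapping_eqI simp: lookup_scale)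
qed (use cover(1)[OF syz_submodule] in \<open>simp add: dd_def\<close>)

lemma dd_closed: "f \<in> carrier Free \<Longrightarrow> dd i f \<in> carrier Free"
  by (rule mod_homD(1)[OF dd_hom])

lemma dd_image: "dd (Suc i) ` carrier Free = syz i"
  using cover(2)[OF syz_submodule] by (simp add: dd_def)

lemma dd_syz: "f \<in> carrier Free \<Longrightarrow> dd (Suc i) f \<in> syz i"
  using dd_image by blast

lemma dd_zero: "f \<in> syz i \<Longrightarrow> dd i f = 0"
  by (cases i) (auto simp: dd_def)

lemma syz_Suc_iff: "f \<in> syz (Suc i) \<longleftrightarrow> f \<in> carrier Free \<and> dd (Suc i) f = 0"
  by (simp add: dd_def)

text \<open>Multiplication by an element of \<open>\<mm>\<close> is zero on \<open>R/\<mm>\<close>, hence null-homotopic on the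
  resolution.  This is what makes multiplication by \<open>v \<in> \<mm>\<close> vanish on Ext.\<close>

lemma homotopy:
  assumes v: "v \<in> \<mm>"
  shows "\<exists>h h'. h \<in> mod_hom R Free Free \<and> h' \<in> mod_hom R Free Free \<and>
    (\<forall>f\<in>carrier Free. v \<odot>\<^bsub>Free\<^esub> f = dd (Suc i) (h f) + h' (dd i f))"
proof (induction i)
  interpret F: Module.module R Free by (rule Free_module)
  have vR: "v \<in> carrier R" using v ideal_closed(1)[OF ideal_m] by blast
  have vh: "(\<lambda>f. v \<odot>\<^bsub>Free\<^esub> f) \<in> mod_hom R Free Free"
    by (intro mod_homI) (use vR in \<open>auto simp: F.smult_r_distr F.smult_assoc1[symmetric] m_comm\<close>)
  {
    case 0
    have "v \<odot>\<^bsub>Free\<^esub> f \<in> dd (Suc 0) ` carrier Free" if "f \<in> carrier Free" for f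
      unfolding dd_image using that vR v ideal_closed(7)[OF ideal_m]
      by (auto simp: Free_simps lookup_scale R_closed)
    then obtain h where "h \<in> mod_hom R Free Free" "\<And>f. f \<in> carrier Free \<Longrightarrow> dd (Suc 0) (h f) = v \<odot>\<^bsub>Free\<^esub> f"
      by (rule projective[OF Free_module Free_module vh dd_hom]) auto
    then show ?case using dd_hom[of 0] by (intro exI[of _ h] exI[of _ "dd 0"]) (auto simp: dd_def)
  next
    case (Suc i)
    then obtain h h' where h: "h \<in> mod_hom R Free Free" "h' \<in> mod_hom R Free Free"
      "\<And>f. f \<in> carrier Free \<Longrightarrow> v \<odot>\<^bsub>Free\<^esub> f = dd (Suc i) (h f) + h' (dd i f)" by blast
    note d = mod_homD[OF dd_hom]
    \<comment> \<open>\<open>?g\<close> takes values in the cycles, which the next differential covers.\<close>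
    let ?g = "\<lambda>f. v \<odot>\<^bsub>Free\<^esub> f \<ominus>\<^bsub>Free\<^esub> h (dd (Suc i) f)"
    have g: "?g \<in> mod_hom R Free Free"
      by (rule mod_hom_diff[OF Free_module Free_module vh mod_hom_comp[OF dd_hom h(1)]])
    have "?g f \<in> dd (Suc (Suc i)) ` carrier Free" if f: "f \<in> carrier Free" for f
    proof -
      have e: "v \<odot>\<^bsub>Free\<^esub> dd (Suc i) f = dd (Suc i) (h (dd (Suc i) f))"
        using h(3)[OF d(1)[OF f]] dd_zero[OF dd_syz[OF f]] mod_hom_zero[OF Free_module Free_module h(2)]
        by (simp add: Free_simps(3))
      have c: "h (dd (Suc i) f) \<in> carrier Free" "v \<odot>\<^bsub>Free\<^esub> f \<in> carrier Free"
        using mod_homD(1)[OF h(1)] d(1) f vR by blast+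
      have "dd (Suc i) (?g f) = dd (Suc i) (v \<odot>\<^bsub>Free\<^esub> f) \<ominus>\<^bsub>Free\<^esub> dd (Suc i) (h (dd (Suc i) f))"
        using d(2)[OF c(2) F.M.a_inv_closed[OF c(1)]] mod_hom_uminus[OF Free_module Free_module dd_hom c(1)]
        unfolding a_minus_def by metis
      also have "\<dots> = 0" unfolding d(3)[OF vR f] e
        using F.M.r_neg[OF d(1)[OF c(1)]] by (simp add: a_minus_def Free_simps(3))
      finally show ?thesis unfolding dd_image using mod_homD(1)[OF g f] by (simp add: syz_Suc_iff del: syz.simps)
    qed
    then obtain k where k: "k \<in> mod_hom R Free Free" "\<And>f. f \<in> carrier Free \<Longrightarrow> dd (Suc (Suc i)) (k f) = ?g f"
      by (rule projective[OF Free_module Free_module g dd_hom]) auto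
    have "v \<odot>\<^bsub>Free\<^esub> f = dd (Suc (Suc i)) (k f) + h (dd (Suc i) f)" if f: "f \<in> carrier Free" for f
      using k(2)[OF f] Free_minus[of "v \<odot>\<^bsub>Free\<^esub> f" "h (dd (Suc i) f)"] mod_homD(1)[OF h(1) d(1)[OF f]] f vR by simp
    then show ?case using k(1) h(1) by blast
  }
qed

section \<open>Vanishing of Ext\<close>

abbreviation Hom :: "(('a list \<Rightarrow>\<^sub>0 'a) \<Rightarrow> 'a) set" where "Hom \<equiv> mod_hom R Free RM"

lemma HomD:
  assumes "h \<in> Hom"
  shows "f \<in> carrier Free \<Longrightarrow> h f \<in> carrier R"
    "f \<in> carrier Free \<Longrightarrow> g \<in> carrier Free \<Longrightarrow> h (f + g) = h f + h g"
    "r \<in> carrier R \<Longrightarrow> f \<in> carrier Free \<Longrightarrow> h (r \<odot>\<^bsub>Free\<^esub> f) = r * h f" "h 0 = 0"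
  using mod_homD[OF assms] mod_hom_zero[OF Free_module RM_module assms] by (simp_all add: Free_simps(2,3))

lemma HomI:
  assumes "\<And>f. f \<in> carrier Free \<Longrightarrow> h f \<in> carrier R"
    "\<And>f g. f \<in> carrier Free \<Longrightarrow> g \<in> carrier Free \<Longrightarrow> h (f + g) = h f + h g"
    "\<And>r f. r \<in> carrier R \<Longrightarrow> f \<in> carrier Free \<Longrightarrow> h (r \<odot>\<^bsub>Free\<^esub> f) = r * h f"
  shows "h \<in> Hom"
  by (rule mod_homI) (use assms in \<open>simp_all add: Free_simps(2)\<close>)

lemma Hom_comp: "h \<in> Hom \<Longrightarrow> g \<in> mod_hom R Free Free \<Longrightarrow> (\<lambda>f. h (g f)) \<in> Hom"
  by (rule mod_hom_comp)

lemma Hom_diff: "h \<in> Hom \<Longrightarrow> g \<in> Hom \<Longrightarrow> (\<lambda>f. h f - g f) \<in> Hom"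
  by (rule HomI) (simp_all add: HomD R_closed algebra_simps)

lemma Hom_add: "h \<in> Hom \<Longrightarrow> g \<in> Hom \<Longrightarrow> (\<lambda>f. h f + g f) \<in> Hom"
  by (rule HomI) (simp_all add: HomD R_closed algebra_simps)

lemma Hom_scale: "h \<in> Hom \<Longrightarrow> v \<in> carrier R \<Longrightarrow> (\<lambda>f. v * h f) \<in> Hom"
  by (rule HomI) (simp_all add: HomD R_closed algebra_simps)

lemma Hom_into_ideal:
  assumes "h \<in> Hom" "ideal I R" "\<And>l. h (basis l) \<in> I" "f \<in> carrier Free"
  shows "h f \<in> I"
  using assms(4)
proof (induction rule: Free_induct)
  case (scale r l)
  then show ?case
    using assms ideal_closed(6)[OF assms(2)] HomD(3)[OF assms(1)] Free_closed(5)[OF R_closed(6)] by simp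
next
  case (add f g)
  then show ?case using HomD(2)[OF assms(1)] ideal_closed(3)[OF assms(2)] by simp
qed (use HomD(4)[OF assms(1)] ideal_closed(2)[OF assms(2)] in simp)

text \<open>Projectivity of the free module in the form used for ideals: a homomorphism into
  \<open>A + v B\<close> is a sum of homomorphisms into \<open>A\<close> and \<open>v B\<close>.\<close>

lemma Hom_decompose:
  assumes h: "h \<in> Hom" and A: "ideal A R" and B: "ideal B R" and v: "v \<in> carrier R"
    and dec: "\<And>f. f \<in> carrier Free \<Longrightarrow> \<exists>a\<in>A. \<exists>b\<in>B. h f = a + v * b"
  obtains \<alpha> \<beta> where "\<alpha> \<in> Hom" "\<beta> \<in> Hom" "\<And>f. f \<in> carrier Free \<Longrightarrow> \<alpha> f \<in> A"
    "\<And>f. f \<in> carrier Free \<Longrightarrow> \<beta> f \<in> B" "\<And>f. f \<in> carrier Free \<Longrightarrow> h f = \<alpha> f + v * \<beta> f"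
proof -
  have "\<forall>l. \<exists>a b. a \<in> A \<and> b \<in> B \<and> h (basis l) = a + v * b"
    using dec[OF Free_closed(5)[OF R_closed(6)]] by blast
  then obtain a b where ab: "\<And>l. a l \<in> A" "\<And>l. b l \<in> B" "\<And>l. h (basis l) = a l + v * b l" by metis
  have ca: "a l \<in> carrier RM" "b l \<in> carrier RM" for l
    using ab ideal_closed(1)[OF A] ideal_closed(1)[OF B] by auto
  note \<alpha> = lin_hom[OF RM_module ca(1)] and \<beta> = lin_hom[OF RM_module ca(2)]
  show ?thesis
  proof (rule that[OF \<alpha>(1) \<beta>(1)])
    show "lin RM a f \<in> A" if "f \<in> carrier Free" for f
      by (rule Hom_into_ideal[OF \<alpha>(1) A _ that]) (simp only: \<alpha>(2) ab)
    show "lin RM b f \<in> B" if "f \<in> carrier Free" for f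
      by (rule Hom_into_ideal[OF \<beta>(1) B _ that]) (simp only: \<beta>(2) ab)
    show "h f = lin RM a f + v * lin RM b f" if "f \<in> carrier Free" for f
      by (rule hom_eqI[OF RM_module h Hom_add[OF \<alpha>(1) Hom_scale[OF \<beta>(1) v]] _ that])
        (simp only: \<alpha>(2) \<beta>(2) ab)
  qed
qed

text \<open>\<open>Ext\<^sup>i(R/\<mm>, P/I) = 0\<close> for ideals \<open>I \<subseteq> P\<close>.  A cochain with values in \<open>P/I\<close> is represented
  by a homomorphism to \<open>P\<close>; it is a cocycle if it maps the syzygies \<open>syz i\<close>, the image of the next
  differential, into \<open>I\<close>.\<close>

definition ext_zero :: "nat \<Rightarrow> 'a set \<Rightarrow> 'a set \<Rightarrow> bool" where
  "ext_zero i P I \<longleftrightarrow> (\<forall>h\<in>Hom. (\<forall>f\<in>carrier Free. h f \<in> P) \<longrightarrow> (\<forall>f\<in>syz i. h f \<in> I) \<longrightarrow>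
     (\<exists>g\<in>Hom. (\<forall>f\<in>carrier Free. g f \<in> P) \<and> (\<forall>f\<in>carrier Free. h f - g (dd i f) \<in> I)))"

lemma ext_zeroD:
  assumes "ext_zero i P I" "h \<in> Hom" "\<And>f. f \<in> carrier Free \<Longrightarrow> h f \<in> P" "\<And>f. f \<in> syz i \<Longrightarrow> h f \<in> I"
  obtains g where "g \<in> Hom" "\<And>f. f \<in> carrier Free \<Longrightarrow> g f \<in> P" "\<And>f. f \<in> carrier Free \<Longrightarrow> h f - g (dd i f) \<in> I"
  using assms unfolding ext_zero_def by blast

text \<open>The middle term of \<open>0 \<rightarrow> P/I \<rightarrow> T/I \<rightarrow> T/P \<rightarrow> 0\<close>: a cocycle is made to vanish modulo \<open>P\<close> by a
  coboundary, and what is left is a cocycle with values in \<open>P/I\<close>.\<close>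

lemma ext_zero_extension:
  assumes T: "ideal T R" and PT: "P \<subseteq> T" and IP: "I \<subseteq> P"
    and PI: "ext_zero i P I" and TP: "ext_zero i T P"
  shows "ext_zero i T I"
  unfolding ext_zero_def
proof (intro ballI impI)
  fix h assume h: "h \<in> Hom" "\<forall>f\<in>carrier Free. h f \<in> T" "\<forall>f\<in>syz i. h f \<in> I"
  from TP h(1) obtain g where g: "g \<in> Hom" "\<And>f. f \<in> carrier Free \<Longrightarrow> g f \<in> T"
    "\<And>f. f \<in> carrier Free \<Longrightarrow> h f - g (dd i f) \<in> P"
    by (rule ext_zeroD) (use h IP in auto)
  from PI Hom_diff[OF h(1) Hom_comp[OF g(1) dd_hom]]
  obtain k where k: "k \<in> Hom" "\<And>f. f \<in> carrier Free \<Longrightarrow> k f \<in> P"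
    "\<And>f. f \<in> carrier Free \<Longrightarrow> h f - g (dd i f) - k (dd i f) \<in> I"
    by (rule ext_zeroD) (use g h HomD(4)[OF g(1)] in \<open>auto simp: dd_zero\<close>)
  show "\<exists>g\<in>Hom. (\<forall>f\<in>carrier Free. g f \<in> T) \<and> (\<forall>f\<in>carrier Free. h f - g (dd i f) \<in> I)"
    by (intro bexI[of _ "\<lambda>f. g f + k f"] Hom_add g(1) k(1))
      (use g k PT ideal_closed(3)[OF T] in \<open>auto simp: diff_diff_eq subset_iff\<close>)
qed

text \<open>The first term of \<open>0 \<rightarrow> P/I \<rightarrow> T/I \<rightarrow> T/P \<rightarrow> 0\<close>: the connecting map shifts the degree of
  \<open>T/P\<close> by one.\<close>

lemma ext_zero_sub:
  assumes P: "ideal P R" and IP: "I \<subseteq> P" and PT: "P \<subseteq> T"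
    and TI: "ext_zero i T I" and TP: "\<And>j. i = Suc j \<Longrightarrow> ext_zero j T P"
  shows "ext_zero i P I"
  unfolding ext_zero_def
proof (intro ballI impI)
  fix h assume h: "h \<in> Hom" "\<forall>f\<in>carrier Free. h f \<in> P" "\<forall>f\<in>syz i. h f \<in> I"
  from TI h(1) obtain g where g: "g \<in> Hom" "\<And>f. f \<in> carrier Free \<Longrightarrow> g f \<in> T"
    "\<And>f. f \<in> carrier Free \<Longrightarrow> h f - g (dd i f) \<in> I"
    by (rule ext_zeroD) (use h PT in auto)
  show "\<exists>g\<in>Hom. (\<forall>f\<in>carrier Free. g f \<in> P) \<and> (\<forall>f\<in>carrier Free. h f - g (dd i f) \<in> I)"
  proof (cases i)
    case 0
    then have "h f \<in> I" if "f \<in> carrier Free" for f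
      using g(3)[OF that] HomD(4)[OF g(1)] by (simp add: dd_def)
    then show ?thesis using h HomD(4)[OF h(1)] 0 by (intro bexI[of _ h]) (auto simp: dd_def)
  next
    case (Suc j)
    have "g f \<in> P" if f: "f \<in> syz j" for f
    proof -
      obtain f' where f': "f' \<in> carrier Free" "f = dd i f'" using f dd_image[of j] Suc by blast
      have "g f = h f' - (h f' - g (dd i f'))" using f' by simp
      then show ?thesis using h(2) g(3)[OF f'(1)] f'(1) IP ideal_closed(4)[OF P] by (metis subsetD)
    qed
    with TP[OF Suc] g(1,2) obtain k where k: "k \<in> Hom" "\<And>f. f \<in> carrier Free \<Longrightarrow> k f \<in> T"
      "\<And>f. f \<in> carrier Free \<Longrightarrow> g f - k (dd j f) \<in> P"
      by (rule ext_zeroD) auto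
    have "k (dd j (dd i f)) = 0" if "f \<in> carrier Free" for f
      using dd_zero[OF dd_syz[OF that]] HomD(4)[OF k(1)] Suc by simp
    then show ?thesis
      by (intro bexI[of _ "\<lambda>f. g f - k (dd j f)"] Hom_diff g(1) Hom_comp[OF k(1) dd_hom])
        (use g k in auto)
  qed
qed

text \<open>The isomorphism of \<open>A/(A \<inter> B)\<close> with \<open>(A + B)/B\<close>.\<close>

lemma ext_zero_second_isomorphism:
  assumes A: "ideal A R" and B: "ideal B R" and "A \<subseteq> C" and C: "\<And>c. c \<in> C \<Longrightarrow> \<exists>a\<in>A. \<exists>b\<in>B. c = a + b"
    and CB: "ext_zero i C B"
  shows "ext_zero i A (A \<inter> B)"
  unfolding ext_zero_def
proof (intro ballI impI)
  fix h assume h: "h \<in> Hom" "\<forall>f\<in>carrier Free. h f \<in> A" "\<forall>f\<in>syz i. h f \<in> A \<inter> B"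
  from CB h(1) obtain g where g: "g \<in> Hom" "\<And>f. f \<in> carrier Free \<Longrightarrow> g f \<in> C"
    "\<And>f. f \<in> carrier Free \<Longrightarrow> h f - g (dd i f) \<in> B"
    by (rule ext_zeroD) (use h assms(3) in auto)
  from g(1) A B R_closed(6) obtain \<alpha> \<beta> where ab: "\<alpha> \<in> Hom" "\<beta> \<in> Hom" "\<And>f. f \<in> carrier Free \<Longrightarrow> \<alpha> f \<in> A"
    "\<And>f. f \<in> carrier Free \<Longrightarrow> \<beta> f \<in> B" "\<And>f. f \<in> carrier Free \<Longrightarrow> g f = \<alpha> f + 1 * \<beta> f"
    by (rule Hom_decompose) (use g(2) C in auto)
  have "h f - \<alpha> (dd i f) \<in> B" if f: "f \<in> carrier Free" for f
  proof -
    have "h f - \<alpha> (dd i f) = (h f - g (dd i f)) + \<beta> (dd i f)" using ab(5)[OF dd_closed[OF f]] by simp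
    then show ?thesis using g(3)[OF f] ab(4)[OF dd_closed[OF f]] ideal_closed(3)[OF B] by metis
  qed
  then show "\<exists>g\<in>Hom. (\<forall>f\<in>carrier Free. g f \<in> A) \<and> (\<forall>f\<in>carrier Free. h f - g (dd i f) \<in> A \<inter> B)"
    using h ab dd_closed ideal_closed(4)[OF A] by (intro bexI[of _ \<alpha>]) auto
qed

text \<open>Multiplication by \<open>v\<close> identifies \<open>R/(I : v)\<close> with \<open>(I + (v))/I\<close>.\<close>

lemma ext_zero_colon:
  assumes I: "ideal I R" and K: "ideal K R" and v: "v \<in> carrier R" "v \<in> K"
    and dec: "\<And>c. c \<in> K \<Longrightarrow> \<exists>a\<in>I. \<exists>b\<in>carrier R. c = a + v * b"
    and J: "J = {p \<in> carrier R. v * p \<in> I}" and SJ: "ext_zero i (carrier R) J"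
  shows "ext_zero i K I"
  unfolding ext_zero_def
proof (intro ballI impI)
  fix h assume h: "h \<in> Hom" "\<forall>f\<in>carrier Free. h f \<in> K" "\<forall>f\<in>syz i. h f \<in> I"
  from h(1) I oneideal v(1) obtain \<alpha> \<beta> where ab: "\<alpha> \<in> Hom" "\<beta> \<in> Hom" "\<And>f. f \<in> carrier Free \<Longrightarrow> \<alpha> f \<in> I"
    "\<And>f. f \<in> carrier Free \<Longrightarrow> \<beta> f \<in> carrier R" "\<And>f. f \<in> carrier Free \<Longrightarrow> h f = \<alpha> f + v * \<beta> f"
    by (rule Hom_decompose) (use h(2) dec in auto)
  have "\<beta> f \<in> J" if f: "f \<in> syz i" for f
  proof -
    have "v * \<beta> f = h f - \<alpha> f" using ab(5)[OF syz_Free[OF f]] by simp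
    then show ?thesis unfolding J
      using h(3) f ab(3,4)[OF syz_Free[OF f]] ideal_closed(4)[OF I] by auto
  qed
  with SJ ab(2,4) obtain g where g: "g \<in> Hom" "\<And>f. f \<in> carrier Free \<Longrightarrow> g f \<in> carrier R"
    "\<And>f. f \<in> carrier Free \<Longrightarrow> \<beta> f - g (dd i f) \<in> J"
    by (rule ext_zeroD) auto
  have "h f - v * g (dd i f) \<in> I" if f: "f \<in> carrier Free" for f
  proof -
    have "h f - v * g (dd i f) = \<alpha> f + v * (\<beta> f - g (dd i f))" using ab(5)[OF f] by (simp add: algebra_simps)
    then show ?thesis using g(3)[OF f] ab(3)[OF f] ideal_closed(3)[OF I] unfolding J by auto
  qed
  then show "\<exists>g\<in>Hom. (\<forall>f\<in>carrier Free. g f \<in> K) \<and> (\<forall>f\<in>carrier Free. h f - g (dd i f) \<in> I)"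
    by (intro bexI[of _ "\<lambda>f. v * g f"] Hom_scale g(1) v(1))
      (use g(2) ideal_closed(7)[OF K _ v(2)] in auto)
qed

text \<open>A homomorphism that vanishes on \<open>syz 0\<close> modulo \<open>I\<close> vanishes modulo \<open>I\<close> on all multiples by
  \<open>v\<close>, because \<open>v\<close> maps the free module into \<open>syz 0\<close>; regularity cancels the factor.\<close>

lemma ext_zero_0_regular:
  assumes I: "ideal I R" and v: "v \<in> \<mm>" and reg: "\<And>p. p \<in> carrier R \<Longrightarrow> v * p \<in> I \<Longrightarrow> p \<in> I"
  shows "ext_zero 0 (carrier R) I"
  unfolding ext_zero_def
proof (intro ballI impI)
  fix h assume h: "h \<in> Hom" "\<forall>f\<in>syz 0. h f \<in> I"
  have vR: "v \<in> carrier R" using v ideal_closed(1)[OF ideal_m] by blast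
  have "h f \<in> I" if f: "f \<in> carrier Free" for f
  proof (rule reg)
    show "h f \<in> carrier R" using HomD(1)[OF h(1) f] .
    have "v \<odot>\<^bsub>Free\<^esub> f \<in> syz 0"
      using f v vR ideal_closed(7)[OF ideal_m] by (auto simp: Free_simps lookup_scale R_closed)
    then show "v * h f \<in> I" using h(2) HomD(3)[OF h(1) vR f] by metis
  qed
  then show "\<exists>g\<in>Hom. (\<forall>f\<in>carrier Free. g f \<in> carrier R) \<and> (\<forall>f\<in>carrier Free. h f - g (dd 0 f) \<in> I)"
    using h(1) HomD[OF h(1)] by (intro bexI[of _ h]) (auto simp: dd_def)
qed

text \<open>In the long exact sequence of \<open>0 \<rightarrow> R/I \<rightarrow> R/I \<rightarrow> R/(I + (v)) \<rightarrow> 0\<close>, multiplication by \<open>v\<close> is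
  both zero on Ext and, in degree \<open>Suc i\<close>, injective.\<close>

lemma ext_zero_regular:
  assumes I: "ideal I R" and v: "v \<in> \<mm>" and reg: "\<And>p. p \<in> carrier R \<Longrightarrow> v * p \<in> I \<Longrightarrow> p \<in> I"
    and K: "ideal K R" "I \<subseteq> K" "v \<in> K" and dec: "\<And>c. c \<in> K \<Longrightarrow> \<exists>a\<in>I. \<exists>b\<in>carrier R. c = a + v * b"
    and SK: "ext_zero i (carrier R) K"
  shows "ext_zero (Suc i) (carrier R) I"
  unfolding ext_zero_def
proof (intro ballI impI)
  fix h assume h: "h \<in> Hom" "\<forall>f\<in>syz (Suc i). h f \<in> I"
  have vR: "v \<in> carrier R" using v ideal_closed(1)[OF ideal_m] by blast
  obtain k k' where k: "k \<in> mod_hom R Free Free" "k' \<in> mod_hom R Free Free"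
    "\<And>f. f \<in> carrier Free \<Longrightarrow> v \<odot>\<^bsub>Free\<^esub> f = dd (Suc (Suc i)) (k f) + k' (dd (Suc i) f)"
    using homotopy[OF v, of "Suc i"] by blast
  note c = mod_homD(1)[OF k(1)] mod_homD(1)[OF k(2)]
  \<comment> \<open>The homotopy exhibits \<open>v h\<close> as a coboundary modulo \<open>I\<close>, of \<open>h \<circ> k'\<close>.\<close>
  have cob: "v * h f - h (k' (dd (Suc i) f)) \<in> I" if f: "f \<in> carrier Free" for f
  proof -
    have "v * h f = h (dd (Suc (Suc i)) (k f)) + h (k' (dd (Suc i) f))"
      unfolding HomD(3)[OF h(1) vR f, symmetric] k(3)[OF f]
      by (rule HomD(2)[OF h(1) dd_closed[OF c(1)[OF f]] c(2)[OF dd_closed[OF f]]])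
    then show ?thesis using bspec[OF h(2) dd_syz[OF c(1)[OF f]]] by simp
  qed
  have hk: "(\<lambda>f. h (k' f)) \<in> Hom" by (rule Hom_comp[OF h(1) k(2)])
  have "h (k' f) \<in> K" if f: "f \<in> syz i" for f
  proof -
    obtain f' where f': "f' \<in> carrier Free" "f = dd (Suc i) f'" using f dd_image[of i] by blast
    have "h (k' f) = v * h f' - (v * h f' - h (k' (dd (Suc i) f')))" using f' by simp
    also have "\<dots> \<in> K"
      by (intro ideal_closed(4)[OF K(1)] subsetD[OF K(2)] cob[OF f'(1)] ideal_closed(7)[OF K(1) HomD(1)[OF h(1) f'(1)] K(3)])
    finally show ?thesis .
  qed
  \<comment> \<open>Modulo \<open>I + (v)\<close> the map \<open>h \<circ> k'\<close> is a cocycle, so it can be corrected by a coboundary to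
    a map into \<open>I + (v)\<close>; its \<open>v\<close>-part is the required cochain.\<close>
  with SK hk HomD(1)[OF hk] obtain g where g: "g \<in> Hom" "\<And>f. f \<in> carrier Free \<Longrightarrow> h (k' f) - g (dd i f) \<in> K"
    by (rule ext_zeroD) auto
  from Hom_diff[OF hk Hom_comp[OF g(1) dd_hom]] I oneideal vR
  obtain \<alpha> \<beta> where ab: "\<alpha> \<in> Hom" "\<beta> \<in> Hom" "\<And>f. f \<in> carrier Free \<Longrightarrow> \<alpha> f \<in> I"
    "\<And>f. f \<in> carrier Free \<Longrightarrow> \<beta> f \<in> carrier R" "\<And>f. f \<in> carrier Free \<Longrightarrow> h (k' f) - g (dd i f) = \<alpha> f + v * \<beta> f"
    by (rule Hom_decompose) (use g(2) dec in auto)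
  have "h f - \<beta> (dd (Suc i) f) \<in> I" if f: "f \<in> carrier Free" for f
  proof (rule reg)
    let ?f = "dd (Suc i) f"
    have "g (dd i ?f) = 0" using dd_zero[OF dd_syz[OF f]] HomD(4)[OF g(1)] by simp
    then have "v * (h f - \<beta> ?f) = (v * h f - h (k' ?f)) + \<alpha> ?f"
      using ab(5)[OF dd_closed[OF f], of "Suc i"] by (simp add: algebra_simps)
    then show "v * (h f - \<beta> ?f) \<in> I"
      using ideal_closed(3)[OF I cob[OF f] ab(3)[OF dd_closed[OF f]], of "Suc i"] by simp
    show "h f - \<beta> ?f \<in> carrier R" by (intro R_closed(3) HomD(1)[OF h(1) f] ab(4) dd_closed f)
  qed
  then show "\<exists>g\<in>Hom. (\<forall>f\<in>carrier Free. g f \<in> carrier R) \<and> (\<forall>f\<in>carrier Free. h f - g (dd (Suc i) f) \<in> I)"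
    using ab(4) by (intro bexI[OF _ ab(2)]) simp
qed

definition ext_depth_ge :: "nat \<Rightarrow> 'a set \<Rightarrow> bool" where
  "ext_depth_ge d I \<longleftrightarrow> (\<forall>i<d. ext_zero i (carrier R) I)"

lemma ext_depth_ge_mono: "ext_depth_ge d I \<Longrightarrow> d' \<le> d \<Longrightarrow> ext_depth_ge d' I"
  by (auto simp: ext_depth_ge_def)

lemma ext_depth_ge_regular:
  assumes "ideal I R" "v \<in> \<mm>" "\<And>p. p \<in> carrier R \<Longrightarrow> v * p \<in> I \<Longrightarrow> p \<in> I"
    "ideal K R" "I \<subseteq> K" "v \<in> K" "\<And>c. c \<in> K \<Longrightarrow> \<exists>a\<in>I. \<exists>b\<in>carrier R. c = a + v * b"
    and d: "ext_depth_ge d K"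
  shows "ext_depth_ge (Suc d) I"
  unfolding ext_depth_ge_def
proof (intro allI impI)
  fix i assume "i < Suc d"
  then show "ext_zero i (carrier R) I"
    using ext_zero_0_regular[OF assms(1-3)] ext_zero_regular[OF assms(1-7)] d
    by (cases i) (auto simp: ext_depth_ge_def)
qed

lemma ext_depth_ge_colon:
  assumes "ideal I R" "ideal K R" "v \<in> carrier R" "v \<in> K" "I \<subseteq> K"
    "\<And>c. c \<in> K \<Longrightarrow> \<exists>a\<in>I. \<exists>b\<in>carrier R. c = a + v * b"
    "J = {p \<in> carrier R. v * p \<in> I}" and "ext_depth_ge d J" "ext_depth_ge d K"
  shows "ext_depth_ge d I"
  using ext_zero_colon[OF assms(1-4,6,7)] ext_zero_extension[OF oneideal ideal_closed(1)[OF assms(2)] assms(5)] assms(8,9)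
  by (auto simp: ext_depth_ge_def)

lemma ext_depth_ge_inter:
  assumes A: "ideal A R" and B: "ideal B R" and C: "ideal C R" "A \<subseteq> C" "B \<subseteq> C"
    "\<And>c. c \<in> C \<Longrightarrow> \<exists>a\<in>A. \<exists>b\<in>B. c = a + b"
    and d: "ext_depth_ge d A" "ext_depth_ge d B" "ext_depth_ge (d - 1) C"
  shows "ext_depth_ge d (A \<inter> B)"
  unfolding ext_depth_ge_def
proof (intro allI impI)
  fix i assume i: "i < d"
  have "ext_zero i C B"
    by (rule ext_zero_sub[OF C(1) C(3) ideal_closed(1)[OF C(1)]]) (use d i in \<open>auto simp: ext_depth_ge_def\<close>)
  have "ext_zero i A (A \<inter> B)"
    by (rule ext_zero_second_isomorphism[OF A B C(2) C(4) \<open>ext_zero i C B\<close>])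
  then show "ext_zero i (carrier R) (A \<inter> B)"
    by (rule ext_zero_extension[OF oneideal ideal_closed(1)[OF A] Int_lower1])
      (use d(1) i in \<open>auto simp: ext_depth_ge_def\<close>)
qed

end

section \<open>Maps into injective modules\<close>

lemma (in abelian_group) minus_eq_zero_iff:
  assumes "x \<in> carrier G" "y \<in> carrier G"
  shows "x \<ominus> y = \<zero> \<longleftrightarrow> x = y"
proof -
  have "\<zero> = x \<oplus> \<ominus> y \<longleftrightarrow> x = \<zero> \<oplus> y"
    using add.inv_solve_right[of \<zero> x y] assms by (simp add: a_inv_def)
  then show ?thesis using assms by (auto simp: a_minus_def)
qed

text \<open>Injectivity is defined by test modules on one type only.  Any module that embeds into that type
  can be transported there.\<close>

lemma injective_module_extend:
  fixes Q :: "('a, 'u) module" and B :: "('a, 'b) module" and \<iota> :: "'b \<Rightarrow> 'u"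
  assumes Q: "injective_module R Q" and B: "Module.module R B" and \<iota>: "inj_on \<iota> (carrier B)"
    and A: "submodule A R B" and f: "f \<in> mod_hom R (B\<lparr>carrier := A\<rparr>) Q"
  obtains g where "g \<in> mod_hom R B Q" "\<And>x. x \<in> A \<Longrightarrow> g x = f x"
proof -
  interpret B: Module.module R B by fact
  note subA = B.submoduleE[OF A]
  define j where "j = inv_into (carrier B) \<iota>"
  have j: "j (\<iota> x) = x" if "x \<in> carrier B" for x
    unfolding j_def by (rule inv_into_f_f[OF \<iota> that])
  define B' :: "('a, 'u) module" where
    "B' = \<lparr>carrier = \<iota> ` carrier B, mult = undefined, one = undefined, zero = \<iota> \<zero>\<^bsub>B\<^esub>,
       add = (\<lambda>x y. \<iota> (j x \<oplus>\<^bsub>B\<^esub> j y)), smult = (\<lambda>r x. \<iota> (r \<odot>\<^bsub>B\<^esub> j x))\<rparr>"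
  have B's: "carrier B' = \<iota> ` carrier B" "zero B' = \<iota> \<zero>\<^bsub>B\<^esub>"
    "\<And>x y. x \<oplus>\<^bsub>B'\<^esub> y = \<iota> (j x \<oplus>\<^bsub>B\<^esub> j y)" "\<And>r x. r \<odot>\<^bsub>B'\<^esub> x = \<iota> (r \<odot>\<^bsub>B\<^esub> j x)"
    by (simp_all add: B'_def)
  have ag: "abelian_group B'"
  proof (rule abelian_groupI, unfold B's)
    show "\<exists>y\<in>\<iota> ` carrier B. \<iota> (j y \<oplus>\<^bsub>B\<^esub> j x) = \<iota> \<zero>\<^bsub>B\<^esub>" if x: "x \<in> \<iota> ` carrier B" for x
    proof -
      obtain b where "x = \<iota> b" "b \<in> carrier B" using x by (rule imageE)
      then show ?thesis
        by (intro bexI[of _ "\<iota> (\<ominus>\<^bsub>B\<^esub> b)"]) (simp_all add: j B.M.l_neg)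
    qed
  qed ((elim imageE)?, simp add: j B.M.a_ac)+
  have B': "Module.module R B'"
    by (rule moduleI[OF B.R.is_cring ag], unfold B's)
      ((elim imageE)?, simp add: j B.smult_l_distr B.smult_r_distr B.smult_assoc1)+
  have A': "submodule (\<iota> ` A) R B'"
  proof -
    interpret B': Module.module R B' by (rule B')
    have inv: "\<ominus>\<^bsub>B'\<^esub> \<iota> b = \<iota> (\<ominus>\<^bsub>B\<^esub> b)" if "b \<in> carrier B" for b
      by (rule B'.M.minus_equality) (use that in \<open>auto simp: B's j B.M.l_neg\<close>)
    have z: "\<zero>\<^bsub>B\<^esub> \<in> A" using subgroup.one_closed[OF submodule.axioms(1)[OF A]] by simp
    show ?thesis
      by (rule B'.submoduleI) (use subA z in \<open>auto simp: B's inv j subset_iff\<close>)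
  qed
  have "(\<lambda>x. f (j x)) \<in> mod_hom R (B'\<lparr>carrier := \<iota> ` A\<rparr>) Q"
    using mod_homD[OF f] subA by (intro mod_homI) (auto simp: B's j subset_iff)
  then have "\<exists>g\<in>mod_hom R B' Q. \<forall>x\<in>\<iota> ` A. g x = f (j x)"
    using Q[unfolded injective_module_def, THEN conjunct2, rule_format, OF conjI[OF B' conjI[OF A']]] by simp
  then obtain g where g: "g \<in> mod_hom R B' Q" "\<forall>x\<in>\<iota> ` A. g x = f (j x)" by (rule bexE)
  show ?thesis
  proof (rule that)
    show "(\<lambda>x. g (\<iota> x)) \<in> mod_hom R B Q"
    proof (rule mod_homI)
      show "g (\<iota> x) \<in> carrier Q" if "x \<in> carrier B" for x
        using mod_homD(1)[OF g(1)] that by (simp add: B's)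
      show "g (\<iota> (x \<oplus>\<^bsub>B\<^esub> y)) = g (\<iota> x) \<oplus>\<^bsub>Q\<^esub> g (\<iota> y)" if "x \<in> carrier B" "y \<in> carrier B" for x y
        using mod_homD(2)[OF g(1), of "\<iota> x" "\<iota> y"] that by (simp add: B's j)
      show "g (\<iota> (r \<odot>\<^bsub>B\<^esub> x)) = r \<odot>\<^bsub>Q\<^esub> g (\<iota> x)" if "r \<in> carrier R" "x \<in> carrier B" for r x
        using mod_homD(3)[OF g(1), of r "\<iota> x"] that by (simp add: B's j)
    qed
    show "g (\<iota> x) = f x" if "x \<in> A" for x
      using g(2) that subA(1) j by auto
  qed
qed

text \<open>A map that vanishes on the kernel of \<open>f\<close> is defined on the image of \<open>f\<close>, and extends from there
  by injectivity.\<close>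

lemma injective_module_factor:
  fixes Q :: "('a, 'u) module" and N :: "('a, 'b) module" and \<iota> :: "'b \<Rightarrow> 'u"
  assumes Q: "injective_module R Q" and M: "Module.module R M" and N: "Module.module R N"
    and \<iota>: "inj_on \<iota> (carrier N)" and f: "f \<in> mod_hom R M N" and h: "h \<in> mod_hom R M Q"
    and ker: "\<And>x. x \<in> carrier M \<Longrightarrow> f x = \<zero>\<^bsub>N\<^esub> \<Longrightarrow> h x = \<zero>\<^bsub>Q\<^esub>"
  obtains g where "g \<in> mod_hom R N Q" "\<And>x. x \<in> carrier M \<Longrightarrow> g (f x) = h x"
proof -
  have Qm: "Module.module R Q" using Q by (simp add: injective_module_def)
  interpret M: Module.module R M by fact
  interpret N: Module.module R N by fact
  interpret Q: Module.module R Q by fact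
  note F = mod_homD[OF f] and H = mod_homD[OF h]
  define j where "j = inv_into (carrier M) f"
  have hj: "h (j (f x)) = h x" if x: "x \<in> carrier M" for x
  proof -
    let ?y = "j (f x)"
    have y: "?y \<in> carrier M" "f ?y = f x"
      unfolding j_def using x by (auto intro: inv_into_into f_inv_into_f)
    have "f (?y \<ominus>\<^bsub>M\<^esub> x) = \<zero>\<^bsub>N\<^esub>"
      using F(2)[OF y(1) M.M.a_inv_closed[OF x]] mod_hom_uminus[OF M N f x] y F(1)[OF x]
      by (simp add: a_minus_def N.M.r_neg)
    then have "h (?y \<ominus>\<^bsub>M\<^esub> x) = \<zero>\<^bsub>Q\<^esub>" using ker x y by simp
    then have "h ?y \<ominus>\<^bsub>Q\<^esub> h x = \<zero>\<^bsub>Q\<^esub>"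
      using H(2)[OF y(1) M.M.a_inv_closed[OF x]] mod_hom_uminus[OF M Qm h x] by (simp add: a_minus_def)
    then show ?thesis using H(1) x y(1) by (simp add: Q.M.minus_eq_zero_iff)
  qed
  have fA: "submodule (f ` carrier M) R N"
  proof (rule N.submoduleI)
    show "\<zero>\<^bsub>N\<^esub> \<in> f ` carrier M"
      by (rule image_eqI[of _ f "\<zero>\<^bsub>M\<^esub>"]) (simp_all add: mod_hom_zero[OF M N f])
    show "\<ominus>\<^bsub>N\<^esub> a \<in> f ` carrier M" if a: "a \<in> f ` carrier M" for a
    proof -
      obtain x where "a = f x" "x \<in> carrier M" using a by (rule imageE)
      then show ?thesis
        by (intro image_eqI[of _ f "\<ominus>\<^bsub>M\<^esub> x"]) (simp_all add: mod_hom_uminus[OF M N f])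
    qed
    show "a \<oplus>\<^bsub>N\<^esub> b \<in> f ` carrier M" if a: "a \<in> f ` carrier M" and b: "b \<in> f ` carrier M" for a b
    proof -
      obtain x where x: "a = f x" "x \<in> carrier M" using a by (rule imageE)
      obtain y where y: "b = f y" "y \<in> carrier M" using b by (rule imageE)
      show ?thesis using x y by (intro image_eqI[of _ f "x \<oplus>\<^bsub>M\<^esub> y"]) (simp_all add: F(2))
    qed
    show "r \<odot>\<^bsub>N\<^esub> a \<in> f ` carrier M" if r: "r \<in> carrier R" and a: "a \<in> f ` carrier M" for r a
    proof -
      obtain x where "a = f x" "x \<in> carrier M" using a by (rule imageE)
      then show ?thesis using r by (intro image_eqI[of _ f "r \<odot>\<^bsub>M\<^esub> x"]) (simp_all add: F(3))
    qed
  qed (use F in auto)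
  have hyp: "(\<lambda>y. h (j y)) \<in> mod_hom R (N\<lparr>carrier := f ` carrier M\<rparr>) Q"
  proof (rule mod_homI)
    fix x y assume "x \<in> carrier (N\<lparr>carrier := f ` carrier M\<rparr>)" "y \<in> carrier (N\<lparr>carrier := f ` carrier M\<rparr>)"
    then obtain a b where ab: "a \<in> carrier M" "b \<in> carrier M" "x = f a" "y = f b" by auto
    show "h (j (x \<oplus>\<^bsub>N\<lparr>carrier := f ` carrier M\<rparr>\<^esub> y)) = h (j x) \<oplus>\<^bsub>Q\<^esub> h (j y)"
      using hj[of "a \<oplus>\<^bsub>M\<^esub> b"] hj[of a] hj[of b] ab by (simp add: F H)
  next
    fix r x assume r: "r \<in> carrier R" and "x \<in> carrier (N\<lparr>carrier := f ` carrier M\<rparr>)"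
    then obtain a where a: "a \<in> carrier M" "x = f a" by auto
    show "h (j (r \<odot>\<^bsub>N\<lparr>carrier := f ` carrier M\<rparr>\<^esub> x)) = r \<odot>\<^bsub>Q\<^esub> h (j x)"
      using hj[of "r \<odot>\<^bsub>M\<^esub> a"] hj[of a] a r by (simp add: F H)
  qed (use hj H in auto)
  show ?thesis
  proof (rule injective_module_extend[OF Q N \<iota> fA hyp])
    fix g assume g: "g \<in> mod_hom R N Q" and gf: "\<And>x. x \<in> f ` carrier M \<Longrightarrow> g x = h (j x)"
    show thesis
    proof (rule that[OF g])
      show "g (f x) = h x" if x: "x \<in> carrier M" for x
        using gf[OF imageI[OF x]] hj[OF x] by simp
    qed
  qed
qed

lemma quot_module_projection:
  fixes M :: "('a, 'm) module"
  assumes M: "Module.module R M" and N: "submodule N R M"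
  shows "(\<lambda>x. N +>\<^bsub>M\<^esub> x) \<in> mod_hom R M (quot_module M N)"
    and "(\<lambda>x. N +>\<^bsub>M\<^esub> x) ` carrier M = carrier (quot_module M N)"
    and "x \<in> carrier M \<Longrightarrow> N +>\<^bsub>M\<^esub> x = \<zero>\<^bsub>quot_module M N\<^esub> \<longleftrightarrow> x \<in> N"
proof -
  interpret M: Module.module R M by fact
  interpret S: submodule N R M by fact
  interpret N: abelian_subgroup N M
    by (rule abelian_subgroupI3) (auto intro!: additive_subgroup.intro S.subgroup_axioms M.abelian_group_axioms)
  show im: "(\<lambda>x. N +>\<^bsub>M\<^esub> x) ` carrier M = carrier (quot_module M N)"
    unfolding quot_module_def A_RCOSETS_def' by auto
  have N0: "N +>\<^bsub>M\<^esub> \<zero>\<^bsub>M\<^esub> = N" using N.a_rcos_const[OF N.zero_closed] by simp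
  show "N +>\<^bsub>M\<^esub> x = \<zero>\<^bsub>quot_module M N\<^esub> \<longleftrightarrow> x \<in> N" if "x \<in> carrier M"
    using N.a_rcos_const[of x] N.a_rcos_self[OF that] by (auto simp: quot_module_def)
  show "(\<lambda>x. N +>\<^bsub>M\<^esub> x) \<in> mod_hom R M (quot_module M N)"
  proof (rule mod_homI)
    show "N +>\<^bsub>M\<^esub> (x \<oplus>\<^bsub>M\<^esub> y) = (N +>\<^bsub>M\<^esub> x) \<oplus>\<^bsub>quot_module M N\<^esub> (N +>\<^bsub>M\<^esub> y)"
      if "x \<in> carrier M" "y \<in> carrier M" for x y
      using N.a_rcos_sum[OF that] by (simp add: quot_module_def)
    fix r x assume r: "r \<in> carrier R" and x: "x \<in> carrier M"
    have "N +>\<^bsub>M\<^esub> (r \<odot>\<^bsub>M\<^esub> y) = N +>\<^bsub>M\<^esub> (r \<odot>\<^bsub>M\<^esub> x)" if y: "y \<in> N +>\<^bsub>M\<^esub> x" for y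
    proof -
      obtain h where h: "h \<in> N" "y = h \<oplus>\<^bsub>M\<^esub> x" using y by (auto simp: a_r_coset_def')
      have "r \<odot>\<^bsub>M\<^esub> y = r \<odot>\<^bsub>M\<^esub> h \<oplus>\<^bsub>M\<^esub> r \<odot>\<^bsub>M\<^esub> x" "r \<odot>\<^bsub>M\<^esub> h \<in> N"
        using h r x N.a_subset by (auto simp: M.smult_r_distr)
      then have "r \<odot>\<^bsub>M\<^esub> y \<in> N +>\<^bsub>M\<^esub> (r \<odot>\<^bsub>M\<^esub> x)" by (auto simp: a_r_coset_def')
      then show ?thesis using M.M.a_repr_independence[OF _ _ N.a_subgroup] r x by (metis M.smult_closed)
    qed
    then have "(\<Union>y\<in>N +>\<^bsub>M\<^esub> x. N +>\<^bsub>M\<^esub> (r \<odot>\<^bsub>M\<^esub> y)) = N +>\<^bsub>M\<^esub> (r \<odot>\<^bsub>M\<^esub> x)"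
      using N.a_rcos_self[OF x] by blast
    then show "N +>\<^bsub>M\<^esub> (r \<odot>\<^bsub>M\<^esub> x) = r \<odot>\<^bsub>quot_module M N\<^esub> (N +>\<^bsub>M\<^esub> x)"
      by (simp add: quot_module_def)
  qed (unfold im[symmetric], rule imageI)
qed

section \<open>From Ext to local cohomology\<close>

lemma a_kernel_eq: "a_kernel M N h = {x \<in> carrier M. h x = \<zero>\<^bsub>N\<^esub>}"
  by (simp add: a_kernel_def kernel_def)

locale resolved_quotient = residue_resolution +
  fixes I and Q :: "nat \<Rightarrow> ('a, 'a list \<Rightarrow> 'a set) module" and d e
  assumes ideal_I: "ideal I R" and res: "injective_resolution R (quot_module RM I) Q d e"
begin

lemma Q_injective: "injective_module R (Q k)"
  using res by (simp add: injective_resolution_def)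

lemma Q_module: "Module.module R (Q k)"
  using Q_injective by (simp add: injective_module_def)

lemma d_hom: "d k \<in> mod_hom R (Q k) (Q (Suc k))"
  using res by (simp add: injective_resolution_def)

lemma kernel_d_Suc: "d k ` carrier (Q k) = {z \<in> carrier (Q (Suc k)). d (Suc k) z = \<zero>\<^bsub>Q (Suc (Suc k))\<^esub>}"
  using res by (simp add: injective_resolution_def a_kernel_eq)

lemma d_d: "z \<in> carrier (Q k) \<Longrightarrow> d (Suc k) (d k z) = \<zero>\<^bsub>Q (Suc (Suc k))\<^esub>"
  using kernel_d_Suc by blast

text \<open>The augmentation of the resolution, as a map from the ring with kernel \<open>I\<close>.\<close>

definition aug :: "'a \<Rightarrow> 'a list \<Rightarrow> 'a set" where "aug x = e (I +>\<^bsub>RM\<^esub> x)"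

lemma I_submodule: "submodule I R RM"
  by (rule ideal_submodule[OF is_cring ideal_I])

lemma aug_hom: "aug \<in> mod_hom R RM (Q 0)"
  unfolding aug_def
  by (rule mod_hom_comp[OF quot_module_projection(1)[OF RM_module I_submodule]])
    (use res in \<open>simp add: injective_resolution_def\<close>)

lemma aug_image: "aug ` carrier R = {z \<in> carrier (Q 0). d 0 z = \<zero>\<^bsub>Q (Suc 0)\<^esub>}"
proof -
  have "aug ` carrier R = e ` (\<lambda>x. I +>\<^bsub>RM\<^esub> x) ` carrier RM" by (auto simp: aug_def)
  also have "\<dots> = e ` carrier (quot_module RM I)"
    by (simp only: quot_module_projection(2)[OF RM_module I_submodule])
  finally show ?thesis using res by (simp add: injective_resolution_def a_kernel_eq)
qed

lemma aug_zero: assumes "x \<in> carrier R" shows "aug x = \<zero>\<^bsub>Q 0\<^esub> \<longleftrightarrow> x \<in> I"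
proof -
  let ?M = "quot_module RM I"
  have M: "Module.module R ?M" by (rule quot_module_is_module[OF RM_module I_submodule])
  have e: "e \<in> mod_hom R ?M (Q 0)" "inj_on e (carrier ?M)"
    using res by (simp_all add: injective_resolution_def)
  have "I +>\<^bsub>RM\<^esub> x \<in> carrier ?M"
    using mod_homD(1)[OF quot_module_projection(1)[OF RM_module I_submodule]] assms by simp
  moreover have "\<zero>\<^bsub>?M\<^esub> \<in> carrier ?M"
    using M by (meson Module.module.axioms(2) abelian_group.axioms(1) abelian_monoid.zero_closed)
  ultimately have "aug x = \<zero>\<^bsub>Q 0\<^esub> \<longleftrightarrow> I +>\<^bsub>RM\<^esub> x = \<zero>\<^bsub>?M\<^esub>"
    using mod_hom_zero[OF M Q_module e(1)] e(2) unfolding aug_def by (metis inj_onD)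
  then show ?thesis using quot_module_projection(3)[OF RM_module I_submodule] assms by simp
qed

text \<open>Let \<open>Z\<^sub>j\<close> be the kernel of \<open>d j\<close>.  The claim is \<open>Ext\<^bsup>i + 1\<^esup>(R/\<mm>, Z\<^sub>j) = 0\<close> for \<open>i + 1 + j < n\<close>.
  It is the hypothesis for \<open>j = 0\<close>, where \<open>Z\<^sub>0\<close> is \<open>R/I\<close>, and the sequences
  \<open>0 \<rightarrow> Z\<^sub>j \<rightarrow> Q\<^sub>j \<rightarrow> Z\<^bsub>j + 1\<^esub> \<rightarrow> 0\<close> with \<open>Q\<^sub>j\<close> injective give the step.\<close>

lemma dimension_shift:
  assumes D: "ext_depth_ge n I" and "Suc i + j < n"
    and "\<phi> \<in> mod_hom R Free (Q j)" "\<And>f. f \<in> carrier Free \<Longrightarrow> d j (\<phi> f) = \<zero>\<^bsub>Q (Suc j)\<^esub>"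
    "\<And>f. f \<in> syz (Suc i) \<Longrightarrow> \<phi> f = \<zero>\<^bsub>Q j\<^esub>"
  shows "\<exists>\<psi>\<in>mod_hom R Free (Q j). (\<forall>f\<in>carrier Free. d j (\<psi> f) = \<zero>\<^bsub>Q (Suc j)\<^esub>) \<and>
    (\<forall>f\<in>carrier Free. \<phi> f = \<psi> (dd (Suc i) f))"
  using assms(2-)
proof (induction j arbitrary: i \<phi>)
  case 0
  note \<phi> = 0(2-4)
  interpret Q0: Module.module R "Q 0" by (rule Q_module)
  have "\<phi> f \<in> aug ` carrier RM" if "f \<in> carrier Free" for f
    using mod_homD(1)[OF \<phi>(1) that] \<phi>(2)[OF that] aug_image by simp
  then obtain h where h: "h \<in> Hom" "\<And>f. f \<in> carrier Free \<Longrightarrow> aug (h f) = \<phi> f"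
    by (rule projective[OF RM_module Q_module \<phi>(1) aug_hom]) blast+
  have hI: "h f \<in> I" if "f \<in> syz (Suc i)" for f
    using h(2)[OF syz_Free[OF that]] \<phi>(3)[OF that] aug_zero[OF HomD(1)[OF h(1) syz_Free[OF that]]] by simp
  have "ext_zero (Suc i) (carrier R) I" using D 0(1) by (auto simp: ext_depth_ge_def)
  then obtain g where g: "g \<in> Hom" "\<And>f. f \<in> carrier Free \<Longrightarrow> h f - g (dd (Suc i) f) \<in> I"
    by (rule ext_zeroD[OF _ h(1) HomD(1)[OF h(1)] hI]) blast+
  have "\<phi> f = aug (g (dd (Suc i) f))" if f: "f \<in> carrier Free" for f
  proof -
    have c: "h f \<in> carrier R" "g (dd (Suc i) f) \<in> carrier R"
      using HomD(1)[OF h(1) f] HomD(1)[OF g(1) dd_closed[OF f]] .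
    then have "h f - g (dd (Suc i) f) \<in> carrier R" by (rule R_closed)
    then have "aug (h f) = aug (h f - g (dd (Suc i) f)) \<oplus>\<^bsub>Q 0\<^esub> aug (g (dd (Suc i) f))"
      using mod_homD(2)[OF aug_hom, of "h f - g (dd (Suc i) f)" "g (dd (Suc i) f)"] c by simp
    also have "aug (h f - g (dd (Suc i) f)) = \<zero>\<^bsub>Q 0\<^esub>"
      using aug_zero g(2)[OF f] \<open>h f - g (dd (Suc i) f) \<in> carrier R\<close> by blast
    finally show ?thesis using h(2)[OF f] mod_homD(1)[OF aug_hom] c(2) by simp
  qed
  moreover have "d 0 (aug (g f)) = \<zero>\<^bsub>Q (Suc 0)\<^esub>" if "f \<in> carrier Free" for f
    using aug_image HomD(1)[OF g(1) that] by blast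
  ultimately show ?case
    by (intro bexI[OF _ mod_hom_comp[OF g(1) aug_hom]]) simp
next
  case (Suc j)
  note \<phi> = Suc.prems(2-4)
  interpret Qj: Module.module R "Q j" by (rule Q_module)
  interpret QSj: Module.module R "Q (Suc j)" by (rule Q_module)
  have "\<phi> f \<in> d j ` carrier (Q j)" if "f \<in> carrier Free" for f
    using mod_homD(1)[OF \<phi>(1) that] \<phi>(2)[OF that] kernel_d_Suc by simp
  then obtain \<alpha> where \<alpha>: "\<alpha> \<in> mod_hom R Free (Q j)" "\<And>f. f \<in> carrier Free \<Longrightarrow> d j (\<alpha> f) = \<phi> f"
    by (rule projective[OF Q_module Q_module \<phi>(1) d_hom]) blast+
  have "\<exists>\<psi>\<in>mod_hom R Free (Q j). (\<forall>f\<in>carrier Free. d j (\<psi> f) = \<zero>\<^bsub>Q (Suc j)\<^esub>) \<and>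
    (\<forall>f\<in>carrier Free. \<alpha> (dd (Suc (Suc i)) f) = \<psi> (dd (Suc (Suc i)) f))"
  proof (rule Suc.IH)
    show "Suc (Suc i) + j < n" using Suc.prems(1) by simp
    show "(\<lambda>f. \<alpha> (dd (Suc (Suc i)) f)) \<in> mod_hom R Free (Q j)" by (rule mod_hom_comp[OF dd_hom \<alpha>(1)])
    show "d j (\<alpha> (dd (Suc (Suc i)) f)) = \<zero>\<^bsub>Q (Suc j)\<^esub>" if "f \<in> carrier Free" for f
      using \<alpha>(2)[OF dd_closed[OF that]] \<phi>(3)[OF dd_syz[OF that]] by simp
    show "\<alpha> (dd (Suc (Suc i)) f) = \<zero>\<^bsub>Q j\<^esub>" if "f \<in> syz (Suc (Suc i))" for f
      using dd_zero[OF that] mod_hom_zero[OF Free_module Q_module \<alpha>(1)] by (simp add: Free_simps(3))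
  qed
  then obtain \<psi> where \<psi>: "\<psi> \<in> mod_hom R Free (Q j)" "\<And>f. f \<in> carrier Free \<Longrightarrow> d j (\<psi> f) = \<zero>\<^bsub>Q (Suc j)\<^esub>"
    "\<And>f. f \<in> carrier Free \<Longrightarrow> \<alpha> (dd (Suc (Suc i)) f) = \<psi> (dd (Suc (Suc i)) f)" by blast
  \<comment> \<open>\<open>\<alpha>\<close> lifts \<open>\<phi>\<close> along \<open>d j\<close>, and subtracting \<open>\<psi>\<close> makes the lift vanish on the syzygies, so that
    it factors through the differential \<open>dd (Suc i)\<close>.\<close>
  let ?\<delta> = "\<lambda>f. \<alpha> f \<ominus>\<^bsub>Q j\<^esub> \<psi> f"
  have \<delta>: "?\<delta> \<in> mod_hom R Free (Q j)" by (rule mod_hom_diff[OF Free_module Q_module \<alpha>(1) \<psi>(1)])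
  note a = mod_homD(1)[OF \<alpha>(1)] and p = mod_homD(1)[OF \<psi>(1)]
  have ker: "?\<delta> f = \<zero>\<^bsub>Q j\<^esub>" if f: "f \<in> carrier Free" "dd (Suc i) f = \<zero>\<^bsub>Free\<^esub>" for f
  proof -
    have "f \<in> syz (Suc i)" using f by (simp add: syz_Suc_iff Free_simps(3) del: syz.simps)
    then obtain f' where "f' \<in> carrier Free" "f = dd (Suc (Suc i)) f'" using dd_image by blast
    then show ?thesis using \<psi>(3) p f(1) by (simp add: Qj.M.minus_eq_zero_iff)
  qed
  have inj: "inj_on (\<lambda>f l. {lookup f l}) (carrier Free)"
    by (intro inj_onI poly_mapping_eqI) (metis singleton_inject)
  obtain \<gamma> where \<gamma>: "\<gamma> \<in> mod_hom R Free (Q j)" "\<And>f. f \<in> carrier Free \<Longrightarrow> \<gamma> (dd (Suc i) f) = ?\<delta> f"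
    by (rule injective_module_factor[OF Q_injective Free_module Free_module inj dd_hom \<delta> ker]) blast+
  have "\<phi> f = d j (\<gamma> (dd (Suc i) f))" if f: "f \<in> carrier Free" for f
  proof -
    have "d j (?\<delta> f) = d j (\<alpha> f) \<ominus>\<^bsub>Q (Suc j)\<^esub> d j (\<psi> f)"
      using mod_homD(2)[OF d_hom a[OF f] Qj.M.a_inv_closed[OF p[OF f]]] mod_hom_uminus[OF Q_module Q_module d_hom p[OF f]]
      by (simp add: a_minus_def)
    also have "\<dots> = \<phi> f" using \<psi>(2)[OF f] \<alpha>(2)[OF f] mod_homD(1)[OF \<phi>(1) f]
      by (simp add: a_minus_def)
    finally show ?thesis using \<gamma>(2)[OF f] by simp
  qed
  moreover have "d (Suc j) (d j (\<gamma> f)) = \<zero>\<^bsub>Q (Suc (Suc j))\<^esub>" if "f \<in> carrier Free" for f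
    by (rule d_d[OF mod_homD(1)[OF \<gamma>(1) that]])
  ultimately show ?case
    by (intro bexI[OF _ mod_hom_comp[OF \<gamma>(1) d_hom]]) simp
qed

definition kills :: "'a set \<Rightarrow> nat \<Rightarrow> ('a list \<Rightarrow> 'a set) \<Rightarrow> bool" where
  "kills b k z \<longleftrightarrow> (\<forall>r\<in>b. r \<odot>\<^bsub>Q k\<^esub> z = \<zero>\<^bsub>Q k\<^esub>)"

text \<open>\<open>Hom(R/b, Q)\<close> is exact in degrees below \<open>n\<close>, that is \<open>Ext\<^sup>j(R/b, R/I) = 0\<close> for \<open>j < n\<close>.\<close>

definition acyclic_below :: "nat \<Rightarrow> 'a set \<Rightarrow> bool" where
  "acyclic_below n b \<longleftrightarrow> (\<forall>j<n. \<forall>z\<in>carrier (Q j). d j z = \<zero>\<^bsub>Q (Suc j)\<^esub> \<longrightarrow> kills b j z \<longrightarrow>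
     (case j of 0 \<Rightarrow> z = \<zero>\<^bsub>Q 0\<^esub> | Suc k \<Rightarrow> \<exists>w\<in>carrier (Q k). kills b k w \<and> d k w = z))"

lemma coefficient_hom:
  assumes N: "Module.module R N" and z: "z \<in> carrier N"
  shows "(\<lambda>f. lookup f [] \<odot>\<^bsub>N\<^esub> z) \<in> mod_hom R Free N"
proof -
  interpret N: Module.module R N by fact
  show ?thesis
    by (rule mod_homI)
      (use z N.smult_l_distr N.smult_assoc1 in \<open>auto simp: Free_simps lookup_add lookup_scale ops\<close>)
qed

lemma acyclic_below_m:
  assumes D: "ext_depth_ge n I"
  shows "acyclic_below n \<mm>"
  unfolding acyclic_below_def
proof (intro allI impI ballI)
  fix j z assume j: "j < n" and z: "z \<in> carrier (Q j)" "d j z = \<zero>\<^bsub>Q (Suc j)\<^esub>" "kills \<mm> j z"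
  have b1: "basis [] \<in> carrier Free" by (intro Free_closed R_closed)
  show "case j of 0 \<Rightarrow> z = \<zero>\<^bsub>Q 0\<^esub> | Suc k \<Rightarrow> \<exists>w\<in>carrier (Q k). kills \<mm> k w \<and> d k w = z"
  proof (cases j)
    case 0
    interpret Q0: Module.module R "Q 0" by (rule Q_module)
    have z0: "z \<in> carrier (Q 0)" using z(1) 0 by simp
    note \<phi> = coefficient_hom[OF Q_module z0]
    let ?\<phi> = "\<lambda>f. lookup f [] \<odot>\<^bsub>Q 0\<^esub> z"
    have "z \<in> aug ` carrier RM" using aug_image z 0 by simp
    then obtain x where x: "x \<in> carrier R" "z = aug x" by auto
    have "?\<phi> f \<in> aug ` carrier RM" if "f \<in> carrier Free" for f
      unfolding x(2) using mod_homD(3)[OF aug_hom, of _ x] that x(1) R_closed(2)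
      by (auto simp: Free_simps intro!: image_eqI[of _ aug "lookup f [] * x"])
    then obtain h where h: "h \<in> Hom" "\<And>f. f \<in> carrier Free \<Longrightarrow> aug (h f) = ?\<phi> f"
      by (rule projective[OF RM_module Q_module \<phi> aug_hom]) blast+
    have hI: "h f \<in> I" if f: "f \<in> syz 0" for f
    proof -
      have "?\<phi> f = \<zero>\<^bsub>Q 0\<^esub>" using z(3) f 0 unfolding kills_def by auto
      then show ?thesis using aug_zero[OF HomD(1)[OF h(1) syz_Free[OF f]]] h(2)[OF syz_Free[OF f]] by simp
    qed
    have "ext_zero 0 (carrier R) I" using D j 0 by (auto simp: ext_depth_ge_def)
    then obtain g where g: "g \<in> Hom" "\<And>f. f \<in> carrier Free \<Longrightarrow> h f - g (dd 0 f) \<in> I"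
      by (rule ext_zeroD[OF _ h(1) HomD(1)[OF h(1)] hI]) blast+
    have "h (basis []) \<in> I" using g(2)[OF b1] HomD(4)[OF g(1)] by (simp add: dd_def)
    then have "?\<phi> (basis []) = \<zero>\<^bsub>Q 0\<^esub>"
      using aug_zero[OF HomD(1)[OF h(1) b1]] h(2)[OF b1] by simp
    then have "z = \<zero>\<^bsub>Q 0\<^esub>" using z0 Q0.smult_one[OF z0] by (simp add: ops)
    then show ?thesis using 0 by simp
  next
    case (Suc k)
    interpret Qk: Module.module R "Q k" by (rule Q_module)
    interpret Qj: Module.module R "Q (Suc k)" by (rule Q_module)
    \<comment> \<open>The element \<open>z\<close> is a map from \<open>R/\<mm>\<close> to the cocycles.  A lift \<open>a\<close> along \<open>d k\<close> need not be killed by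
      \<open>\<mm>\<close>; dimension shifting supplies the cocycle \<open>\<psi> (basis [])\<close> that corrects it.\<close>
    have zz: "z \<in> d k ` carrier (Q k)" using z(1,2) kernel_d_Suc Suc by simp
    obtain a where a: "z = d k a" "a \<in> carrier (Q k)" using zz by (rule imageE)
    let ?\<alpha> = "\<lambda>f. lookup f [] \<odot>\<^bsub>Q k\<^esub> a"
    note \<alpha> = coefficient_hom[OF Q_module a(2)]
    have da: "d k (?\<alpha> f) = lookup f [] \<odot>\<^bsub>Q (Suc k)\<^esub> z" if "f \<in> carrier Free" for f
      using mod_homD(3)[OF d_hom _ a(2)] that a(1) by (simp add: Free_simps)
    have syz0: "lookup f [] \<odot>\<^bsub>Q (Suc k)\<^esub> z = \<zero>\<^bsub>Q (Suc k)\<^esub>" if "f \<in> syz 0" for f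
      using z(3) that Suc unfolding kills_def by auto
    have "\<exists>\<psi>\<in>mod_hom R Free (Q k). (\<forall>f\<in>carrier Free. d k (\<psi> f) = \<zero>\<^bsub>Q (Suc k)\<^esub>) \<and>
      (\<forall>f\<in>carrier Free. ?\<alpha> (dd (Suc 0) f) = \<psi> (dd (Suc 0) f))"
    proof (rule dimension_shift[OF D])
      show "Suc 0 + k < n" using j Suc by simp
      show "(\<lambda>f. ?\<alpha> (dd (Suc 0) f)) \<in> mod_hom R Free (Q k)" by (rule mod_hom_comp[OF dd_hom \<alpha>])
      show "d k (?\<alpha> (dd (Suc 0) f)) = \<zero>\<^bsub>Q (Suc k)\<^esub>" if "f \<in> carrier Free" for f
        using da[OF dd_closed[OF that]] syz0[OF dd_syz[OF that]] by simp
      show "?\<alpha> (dd (Suc 0) f) = \<zero>\<^bsub>Q k\<^esub>" if "f \<in> syz (Suc 0)" for f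
        using dd_zero[OF that] Qk.smult_l_null[OF a(2)] by (simp add: ops)
    qed
    then obtain \<psi> where \<psi>: "\<psi> \<in> mod_hom R Free (Q k)" "\<And>f. f \<in> carrier Free \<Longrightarrow> d k (\<psi> f) = \<zero>\<^bsub>Q (Suc k)\<^esub>"
      "\<And>f. f \<in> carrier Free \<Longrightarrow> ?\<alpha> (dd (Suc 0) f) = \<psi> (dd (Suc 0) f)" by blast
    let ?\<delta> = "\<lambda>f. ?\<alpha> f \<ominus>\<^bsub>Q k\<^esub> \<psi> f"
    have \<delta>: "?\<delta> \<in> mod_hom R Free (Q k)" by (rule mod_hom_diff[OF Free_module Q_module \<alpha> \<psi>(1)])
    have "?\<delta> f = \<zero>\<^bsub>Q k\<^esub>" if f: "f \<in> syz 0" for f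
    proof -
      obtain f' where "f' \<in> carrier Free" "f = dd (Suc 0) f'" using f dd_image by blast
      then show ?thesis using \<psi>(3) mod_homD(1)[OF \<psi>(1)] mod_homD(1)[OF \<alpha>] dd_closed
        by (simp add: Qk.M.minus_eq_zero_iff)
    qed
    then have "r \<odot>\<^bsub>Q k\<^esub> ?\<delta> (basis []) = \<zero>\<^bsub>Q k\<^esub>" if r: "r \<in> \<mm>" for r
    proof -
      have rR: "r \<in> carrier R" using r ideal_closed(1)[OF ideal_m] by blast
      have "single [] r \<in> syz 0" using r Free_closed(5)[OF rR] by simp
      then have "?\<delta> (single [] r) = \<zero>\<^bsub>Q k\<^esub>" using \<open>\<And>f. f \<in> syz 0 \<Longrightarrow> ?\<delta> f = \<zero>\<^bsub>Q k\<^esub>\<close> by blast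
      then show ?thesis using mod_homD(3)[OF \<delta> rR b1] unfolding scale_basis by simp
    qed
    then have "kills \<mm> k (?\<delta> (basis []))" by (simp add: kills_def)
    moreover have "d k (?\<delta> (basis [])) = z"
    proof -
      note c = mod_homD(1)[OF \<alpha> b1] mod_homD(1)[OF \<psi>(1) b1]
      have "d k (?\<delta> (basis [])) = d k (?\<alpha> (basis [])) \<ominus>\<^bsub>Q (Suc k)\<^esub> d k (\<psi> (basis []))"
        using mod_homD(2)[OF d_hom c(1) Qk.M.a_inv_closed[OF c(2)]] mod_hom_uminus[OF Q_module Q_module d_hom c(2)]
        by (simp add: a_minus_def)
      also have "\<dots> = z" using \<psi>(2)[OF b1] da[OF b1] z(1) Suc Qj.smult_one[of z] by (simp add: a_minus_def ops)
      finally show ?thesis .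
    qed
    ultimately show ?thesis using mod_homD(1)[OF \<delta> b1] Suc by auto
  qed
qed

lemma acyclic_below_unit:
  assumes b: "1 \<in> b" "b \<subseteq> carrier R"
  shows "acyclic_below n b"
proof -
  have zero: "z = \<zero>\<^bsub>Q j\<^esub>" if "z \<in> carrier (Q j)" "kills b j z" for j z
  proof -
    have "z = 1 \<odot>\<^bsub>Q j\<^esub> z" using Module.module.smult_one[OF Q_module that(1)] by (simp add: ops)
    then show ?thesis using that(2) b(1) by (simp add: kills_def)
  qed
  have triv: "\<exists>w\<in>carrier (Q k). kills b k w \<and> d k w = \<zero>\<^bsub>Q (Suc k)\<^esub>" for k
  proof -
    interpret Module.module R "Q k" by (rule Q_module)
    show ?thesis using mod_hom_zero[OF Q_module Q_module d_hom] b(2)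
      by (intro bexI[of _ "\<zero>\<^bsub>Q k\<^esub>"]) (auto simp: kills_def)
  qed
  show ?thesis unfolding acyclic_below_def
  proof (intro allI impI ballI)
    fix j z assume "z \<in> carrier (Q j)" "kills b j z"
    then have "z = \<zero>\<^bsub>Q j\<^esub>" by (rule zero)
    then show "case j of 0 \<Rightarrow> z = \<zero>\<^bsub>Q 0\<^esub> | Suc k \<Rightarrow> \<exists>w\<in>carrier (Q k). kills b k w \<and> d k w = z"
      using triv by (cases j) auto
  qed
qed

text \<open>The long exact sequence of \<open>0 \<rightarrow> R/(b : v) \<rightarrow> R/b \<rightarrow> R/(b + (v)) \<rightarrow> 0\<close>.\<close>

lemma acyclic_below_colon:
  assumes b: "ideal b R" and v: "v \<in> carrier R"
    and colon: "acyclic_below n {p \<in> carrier R. v * p \<in> b}"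
    and sum: "acyclic_below n {a + v * r | a r. a \<in> b \<and> r \<in> carrier R}"
  shows "acyclic_below n b"
  unfolding acyclic_below_def
proof (intro allI impI ballI)
  let ?J = "{p \<in> carrier R. v * p \<in> b}" and ?c = "{a + v * r | a r. a \<in> b \<and> r \<in> carrier R}"
  fix j z assume j: "j < n" and z: "z \<in> carrier (Q j)" "d j z = \<zero>\<^bsub>Q (Suc j)\<^esub>" "kills b j z"
  have bR: "b \<subseteq> carrier R" by (rule ideal_closed(1)[OF b])
  have ann: "kills ?c j' y" if y: "y \<in> carrier (Q j')" "kills b j' y" "v \<odot>\<^bsub>Q j'\<^esub> y = \<zero>\<^bsub>Q j'\<^esub>" for j' y
  proof -
    interpret N: Module.module R "Q j'" by (rule Q_module)
    have "(a + v * r) \<odot>\<^bsub>Q j'\<^esub> y = \<zero>\<^bsub>Q j'\<^esub>" if ar: "a \<in> b" "r \<in> carrier R" for a r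
    proof -
      have "(a + v * r) \<odot>\<^bsub>Q j'\<^esub> y = a \<odot>\<^bsub>Q j'\<^esub> y \<oplus>\<^bsub>Q j'\<^esub> (r * v) \<odot>\<^bsub>Q j'\<^esub> y"
        using N.smult_l_distr[of a "v * r" y] ar bR y(1) v by (auto simp: ops mult.commute R_closed)
      also have "(r * v) \<odot>\<^bsub>Q j'\<^esub> y = \<zero>\<^bsub>Q j'\<^esub>"
        using N.smult_assoc1[of r v y] ar v y by (simp add: ops)
      finally show ?thesis using y(2) ar(1) by (simp add: kills_def)
    qed
    then show ?thesis unfolding kills_def by blast
  qed
  interpret Qj: Module.module R "Q j" by (rule Q_module)
  let ?vz = "v \<odot>\<^bsub>Q j\<^esub> z"
  have vz: "?vz \<in> carrier (Q j)" using v z by simp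
  have dvz: "d j ?vz = \<zero>\<^bsub>Q (Suc j)\<^esub>"
    using mod_homD(3)[OF d_hom v z(1)] z(2) Module.module.smult_r_null[OF Q_module v] by simp
  have kvz: "kills ?J j ?vz"
    unfolding kills_def
  proof
    fix r assume r: "r \<in> ?J"
    then have "r \<odot>\<^bsub>Q j\<^esub> ?vz = (v * r) \<odot>\<^bsub>Q j\<^esub> z"
      using Qj.smult_assoc1[of r v z] v z(1) by (simp add: ops mult.commute)
    then show "r \<odot>\<^bsub>Q j\<^esub> ?vz = \<zero>\<^bsub>Q j\<^esub>" using r z(3) by (simp add: kills_def)
  qed
  show "case j of 0 \<Rightarrow> z = \<zero>\<^bsub>Q 0\<^esub> | Suc k \<Rightarrow> \<exists>w\<in>carrier (Q k). kills b k w \<and> d k w = z"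
  proof (cases j)
    case 0
    have "?vz = \<zero>\<^bsub>Q j\<^esub>" using colon[unfolded acyclic_below_def, rule_format, OF j vz dvz kvz] 0 by simp
    then show ?thesis using sum[unfolded acyclic_below_def, rule_format, OF j z(1,2) ann[OF z(1,3)]] 0 by simp
  next
    case (Suc k)
    interpret Qk: Module.module R "Q k" by (rule Q_module)
    obtain w' where w': "w' \<in> carrier (Q k)" "kills ?J k w'" "d k w' = ?vz"
      using colon[unfolded acyclic_below_def, rule_format, OF j vz dvz kvz] Suc by auto
    \<comment> \<open>\<open>w'\<close> is divided by \<open>v\<close> within the elements killed by \<open>b\<close>: it is a map on \<open>R/(b : v)\<close>, which extends
      to \<open>R/b\<close> because \<open>Q k\<close> is injective.\<close>
    have bs: "submodule b R RM" by (rule ideal_submodule[OF is_cring b])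
    note p = quot_module_projection[OF RM_module bs]
    note p1 = mod_homD[OF p(1)]
    have vh: "(\<lambda>r. v * r) \<in> mod_hom R RM RM"
      by (rule mod_homI) (use v in \<open>auto simp: R_closed algebra_simps\<close>)
    have wh: "(\<lambda>r. r \<odot>\<^bsub>Q k\<^esub> w') \<in> mod_hom R RM (Q k)"
      by (rule mod_homI) (use w' Qk.smult_l_distr Qk.smult_assoc1 in \<open>auto simp: ops\<close>)
    have inj: "inj_on (\<lambda>C (l :: 'a list). C) (carrier (quot_module RM b))" by (auto intro: inj_onI dest: fun_cong)
    have ker: "r \<odot>\<^bsub>Q k\<^esub> w' = \<zero>\<^bsub>Q k\<^esub>"
      if "r \<in> carrier RM" "b +>\<^bsub>RM\<^esub> (v * r) = \<zero>\<^bsub>quot_module RM b\<^esub>" for r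
      using that w'(2) p(3)[of "v * r"] v R_closed(2) by (auto simp: kills_def)
    obtain \<gamma> where \<gamma>: "\<gamma> \<in> mod_hom R (quot_module RM b) (Q k)"
      "\<And>r. r \<in> carrier RM \<Longrightarrow> \<gamma> (b +>\<^bsub>RM\<^esub> (v * r)) = r \<odot>\<^bsub>Q k\<^esub> w'"
      by (rule injective_module_factor[OF Q_injective RM_module quot_module_is_module[OF RM_module bs] inj
            mod_hom_comp[OF vh p(1)] wh ker]) blast+
    define w where "w = \<gamma> (b +>\<^bsub>RM\<^esub> 1)"
    have one: "(1 :: 'a) \<in> carrier RM" using R_closed by simp
    have wc: "w \<in> carrier (Q k)" unfolding w_def by (rule mod_homD(1)[OF \<gamma>(1) p1(1)[OF one]])
    have rw: "r \<odot>\<^bsub>Q k\<^esub> w = \<gamma> (b +>\<^bsub>RM\<^esub> r)" if "r \<in> carrier R" for r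
      unfolding w_def using mod_homD(3)[OF \<gamma>(1) that p1(1)[OF one]] p1(3)[OF that one] by simp
    have kw: "kills b k w"
      unfolding kills_def
    proof
      fix r assume r: "r \<in> b"
      have "b +>\<^bsub>RM\<^esub> r = \<zero>\<^bsub>quot_module RM b\<^esub>" using p(3)[of r] r bR by auto
      then show "r \<odot>\<^bsub>Q k\<^esub> w = \<zero>\<^bsub>Q k\<^esub>"
        using rw[of r] r bR mod_hom_zero[OF quot_module_is_module[OF RM_module bs] Q_module \<gamma>(1)] by auto
    qed
    have vw: "v \<odot>\<^bsub>Q k\<^esub> w = w'"
      using rw[OF v] \<gamma>(2)[OF one] Qk.smult_one[OF w'(1)] by (simp add: ops)
    have dw: "d k w \<in> carrier (Q j)" using mod_homD(1)[OF d_hom wc] Suc by simp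
    \<comment> \<open>What remains of \<open>z\<close> is killed by \<open>v\<close> too.\<close>
    let ?y = "z \<ominus>\<^bsub>Q j\<^esub> d k w"
    have y: "?y \<in> carrier (Q j)" using z(1) dw by simp
    have smy: "r \<odot>\<^bsub>Q j\<^esub> ?y = r \<odot>\<^bsub>Q j\<^esub> z \<ominus>\<^bsub>Q j\<^esub> d k (r \<odot>\<^bsub>Q k\<^esub> w)" if "r \<in> carrier R" for r
      using that z(1) dw mod_homD(3)[OF d_hom that wc, folded Suc]
      by (simp add: a_minus_def Qj.smult_r_distr Qj.smult_r_minus)
    have d0: "d k \<zero>\<^bsub>Q k\<^esub> = \<zero>\<^bsub>Q j\<^esub>" using mod_hom_zero[OF Q_module Q_module d_hom, of k, folded Suc] .
    have "v \<odot>\<^bsub>Q j\<^esub> ?y = \<zero>\<^bsub>Q j\<^esub>" unfolding smy[OF v] vw w'(3) using vz by (simp add: Qj.M.minus_eq_zero_iff)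
    moreover have "kills b j ?y"
      unfolding kills_def
    proof
      fix r assume "r \<in> b"
      then show "r \<odot>\<^bsub>Q j\<^esub> ?y = \<zero>\<^bsub>Q j\<^esub>" using smy[of r] bR z(3) kw d0
        by (auto simp: kills_def Qj.M.minus_eq_zero_iff)
    qed
    ultimately have ky: "kills ?c j ?y" by (intro ann[OF y])
    have "d j ?y = d j z \<ominus>\<^bsub>Q (Suc j)\<^esub> d j (d k w)"
      using mod_homD(2)[OF d_hom z(1) Qj.M.a_inv_closed[OF dw]] mod_hom_uminus[OF Q_module Q_module d_hom dw]
      by (simp add: a_minus_def)
    also have "\<dots> = \<zero>\<^bsub>Q (Suc j)\<^esub>"
      using z(2) d_d[OF wc] Suc Module.module.axioms(2)[OF Q_module]
      by (metis abelian_group.minus_eq_zero_iff mod_homD(1)[OF d_hom z(1)])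
    finally obtain u where u: "u \<in> carrier (Q k)" "kills ?c k u" "d k u = ?y"
      using sum[unfolded acyclic_below_def, rule_format, OF j y _ ky] Suc by auto
    have ku: "kills b k u"
      unfolding kills_def
    proof
      fix a assume "a \<in> b"
      then have "a + v * 0 \<in> ?c" using R_closed(5) by blast
      then show "a \<odot>\<^bsub>Q k\<^esub> u = \<zero>\<^bsub>Q k\<^esub>" using u(2) by (simp add: kills_def)
    qed
    have "kills b k (w \<oplus>\<^bsub>Q k\<^esub> u)"
      using ku kw wc u(1) bR by (auto simp: kills_def Qk.smult_r_distr subset_iff)
    moreover have "d k (w \<oplus>\<^bsub>Q k\<^esub> u) = z"
      using mod_homD(2)[OF d_hom wc u(1)] u(3) z(1) dw Suc
      by (simp add: a_minus_def Qj.M.a_ac) (metis Qj.M.a_inv_closed Qj.M.a_lcomm Qj.M.r_neg Qj.M.r_zero)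
    ultimately show ?thesis using wc u(1) Suc by auto
  qed
qed

text \<open>Every module \<open>R/b\<close> on which the elements of \<open>X\<close> act nilpotently is built from quotients by
  ideals that contain \<open>X\<close>: passing to \<open>b : v\<close> lowers the exponent of \<open>v\<close> by one, passing to \<open>b + (v)\<close> lowers
  it to one.\<close>

lemma acyclic_below_powers:
  assumes X: "finite X" "X \<subseteq> carrier R" and base: "\<And>b. ideal b R \<Longrightarrow> X \<subseteq> b \<Longrightarrow> acyclic_below n b"
    and b: "ideal b R" "\<And>v. v \<in> X \<Longrightarrow> v ^ N v \<in> b"
  shows "acyclic_below n b"
  using b
proof (induction "\<Sum>v\<in>X. N v" arbitrary: b N rule: less_induct)
  case less
  show ?case
  proof (cases "\<exists>v\<in>X. N v \<noteq> 1")
    case False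
    then show ?thesis using base less(2,3) by fastforce
  next
    case True
    then obtain v where v: "v \<in> X" "N v \<noteq> 1" by blast
    show ?thesis
    proof (cases "N v = 0")
      case True
      then show ?thesis using less(3)[OF v(1)] acyclic_below_unit ideal_closed(1)[OF less(2)] by simp
    next
      case False
      then have N2: "N v \<ge> 2" using v(2) by linarith
      have vR: "v \<in> carrier R" using v X by blast
      have smaller: "(\<Sum>u\<in>X. (N(v := k)) u) < (\<Sum>u\<in>X. N u)" if "k < N v" for k
        using that v(1) X(1) by (intro sum_strict_mono_ex1) auto
      show ?thesis
      proof (rule acyclic_below_colon[OF less(2) vR])
        show "acyclic_below n {p \<in> carrier R. v * p \<in> b}"
        proof (rule less(1)[OF _ ideal_colon[OF less(2) vR]])
          show "(\<Sum>u\<in>X. (N(v := N v - 1)) u) < (\<Sum>u\<in>X. N u)" by (rule smaller) (use N2 in simp)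
          fix u assume u: "u \<in> X"
          have "v * v ^ (N v - 1) = v ^ N v" using N2 by (cases "N v") auto
          moreover have "v * u ^ N u \<in> b" by (rule ideal_closed(6)[OF less(2) vR less(3)[OF u]])
          moreover have "u ^ k \<in> carrier R" for k using R_power_closed u X by blast
          ultimately show "u ^ (N(v := N v - 1)) u \<in> {p \<in> carrier R. v * p \<in> b}"
            using less(3)[OF v(1)] by auto
        qed
        show "acyclic_below n {a + v * r | a r. a \<in> b \<and> r \<in> carrier R}"
        proof (rule less(1)[OF _ ideal_adjoin[OF less(2) vR]])
          show "(\<Sum>u\<in>X. (N(v := 1)) u) < (\<Sum>u\<in>X. N u)" by (rule smaller) (use N2 in simp)
          fix u assume u: "u \<in> X"
          show "u ^ (N(v := 1)) u \<in> {a + v * r | a r. a \<in> b \<and> r \<in> carrier R}"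
          proof (cases "u = v")
            case True
            have "0 + v * 1 \<in> {a + v * r | a r. a \<in> b \<and> r \<in> carrier R}"
              using R_closed(6) ideal_closed(2)[OF less(2)] by blast
            then show ?thesis using True by simp
          next
            case False
            have "u ^ N u + v * 0 \<in> {a + v * r | a r. a \<in> b \<and> r \<in> carrier R}"
              using R_closed(5) less(3)[OF u] by blast
            then show ?thesis using False by simp
          qed
        qed
      qed
    qed
  qed
qed

lemma torsion_part_zero: "\<zero>\<^bsub>Q k\<^esub> \<in> torsion_part R \<mm> (Q k)"
proof -
  interpret Qk: Module.module R "Q k" by (rule Q_module)
  have "\<exists>k'::nat. \<forall>r\<in>\<mm> [^]\<^bsub>ideals_set R\<^esub> k'. r \<odot>\<^bsub>Q k\<^esub> \<zero>\<^bsub>Q k\<^esub> = \<zero>\<^bsub>Q k\<^esub>"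
    by (rule exI[of _ 0], rule ballI, rule Qk.smult_r_null,
        rule subsetD[OF ideal_closed(1)[OF ideal_power(1)[OF ideal_m]]])
  then show ?thesis by (simp add: torsion_part_def)
qed

lemma torsion_part_closed:
  assumes z: "z \<in> torsion_part R \<mm> (Q k)" and w: "w \<in> torsion_part R \<mm> (Q k)"
  shows "z \<oplus>\<^bsub>Q k\<^esub> w \<in> torsion_part R \<mm> (Q k)" and "\<ominus>\<^bsub>Q k\<^esub> z \<in> torsion_part R \<mm> (Q k)"
proof -
  interpret Qk: Module.module R "Q k" by (rule Q_module)
  let ?p = "\<lambda>k::nat. \<mm> [^]\<^bsub>ideals_set R\<^esub> k"
  have pR: "?p k \<subseteq> carrier R" for k by (rule ideal_closed(1)[OF ideal_power(1)[OF ideal_m]])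
  obtain a b where a: "\<And>r. r \<in> ?p a \<Longrightarrow> r \<odot>\<^bsub>Q k\<^esub> z = \<zero>\<^bsub>Q k\<^esub>" and b: "\<And>r. r \<in> ?p b \<Longrightarrow> r \<odot>\<^bsub>Q k\<^esub> w = \<zero>\<^bsub>Q k\<^esub>"
    and zw: "z \<in> carrier (Q k)" "w \<in> carrier (Q k)"
    using z w by (auto simp: torsion_part_def)
  have "r \<odot>\<^bsub>Q k\<^esub> (z \<oplus>\<^bsub>Q k\<^esub> w) = \<zero>\<^bsub>Q k\<^esub>" if r: "r \<in> ?p (a + b)" for r
  proof -
    have "r \<in> ?p a" "r \<in> ?p b" using r ideal_power(3)[OF ideal_m, of a b] ideal_power(3)[OF ideal_m, of b a]
      by (auto simp: add.commute)
    then show ?thesis using a[of r] b[of r] zw pR[of a] by (auto simp: Qk.smult_r_distr)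
  qed
  then show "z \<oplus>\<^bsub>Q k\<^esub> w \<in> torsion_part R \<mm> (Q k)" using zw by (auto simp: torsion_part_def)
  have "r \<odot>\<^bsub>Q k\<^esub> (\<ominus>\<^bsub>Q k\<^esub> z) = \<zero>\<^bsub>Q k\<^esub>" if "r \<in> ?p a" for r
    using that pR[of a] a[OF that] zw by (auto simp: Qk.smult_r_minus)
  then show "\<ominus>\<^bsub>Q k\<^esub> z \<in> torsion_part R \<mm> (Q k)" using zw by (auto simp: torsion_part_def)
qed

lemma torsion_cohomology_trivial:
  assumes D: "ext_depth_ge n I" and i: "i < n"
    and X: "finite X" "X \<subseteq> carrier R" "\<mm> = Idl X"
    and maximal: "\<And>b. ideal b R \<Longrightarrow> \<mm> \<subseteq> b \<Longrightarrow> b = \<mm> \<or> 1 \<in> b"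
  shows "carrier (torsion_cohomology R \<mm> Q d i) = {\<zero>\<^bsub>torsion_cohomology R \<mm> Q d i\<^esub>}"
proof -
  interpret Qi: Module.module R "Q i" by (rule Q_module)
  let ?T = "\<lambda>k. torsion_part R \<mm> (Q k)"
  let ?Z = "?T i \<inter> a_kernel (Q i) (Q (Suc i)) (d i)"
  let ?B = "case i of 0 \<Rightarrow> {\<zero>\<^bsub>Q 0\<^esub>} | Suc j \<Rightarrow> d j ` ?T j"
  have Z0: "\<zero>\<^bsub>Q i\<^esub> \<in> ?Z" using torsion_part_zero mod_hom_zero[OF Q_module Q_module d_hom] by (simp add: a_kernel_eq)
  have ZB: "z \<in> ?B" if z: "z \<in> ?Z" for z
  proof -
    obtain k where k: "\<forall>r\<in>\<mm> [^]\<^bsub>ideals_set R\<^esub> (k::nat). r \<odot>\<^bsub>Q i\<^esub> z = \<zero>\<^bsub>Q i\<^esub>"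
      using z by (auto simp: torsion_part_def)
    let ?b = "\<mm> [^]\<^bsub>ideals_set R\<^esub> k"
    have Xm: "X \<subseteq> \<mm>" using genideal_self[OF X(2)] X(3) by simp
    have "acyclic_below n ?b"
    proof (rule acyclic_below_powers[OF X(1,2)])
      show "acyclic_below n b" if b: "ideal b R" "X \<subseteq> b" for b
      proof -
        have "\<mm> \<subseteq> b" unfolding X(3) by (rule genideal_minimal[OF b])
        then show ?thesis using maximal[OF b(1)] acyclic_below_m[OF D] acyclic_below_unit ideal_closed(1)[OF b(1)] by blast
      qed
      show "ideal ?b R" by (rule ideal_power(1)[OF ideal_m])
      show "v ^ k \<in> ?b" if "v \<in> X" for v using ideal_power(2)[OF ideal_m] that Xm by blast
    qed
    then have "case i of 0 \<Rightarrow> z = \<zero>\<^bsub>Q 0\<^esub> | Suc j \<Rightarrow> \<exists>w\<in>carrier (Q j). kills ?b j w \<and> d j w = z"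
      using i z k unfolding acyclic_below_def kills_def by (simp add: a_kernel_eq)
    then show ?thesis by (cases i) (auto simp: kills_def torsion_part_def)
  qed
  have BZ: "?B \<subseteq> carrier (Q i)"
  proof (cases i)
    case (Suc j)
    then show ?thesis using mod_homD(1)[OF d_hom[of j]] by (auto simp: torsion_part_def)
  qed (use Qi.M.zero_closed in simp)
  have Bm: "x \<oplus>\<^bsub>Q i\<^esub> y \<in> ?B" "\<ominus>\<^bsub>Q i\<^esub> x \<in> ?B" if xy: "x \<in> ?B" "y \<in> ?B" for x y
  proof -
    have "x \<oplus>\<^bsub>Q i\<^esub> y \<in> ?B \<and> \<ominus>\<^bsub>Q i\<^esub> x \<in> ?B"
    proof (cases i)
      case 0
      then show ?thesis using xy Qi.M.add.inv_one Qi.M.l_zero[OF Qi.M.zero_closed] by (simp add: a_inv_def)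
    next
      case (Suc j)
      obtain a b where ab: "x = d j a" "y = d j b" "a \<in> ?T j" "b \<in> ?T j" using xy Suc by auto
      then have c: "a \<in> carrier (Q j)" "b \<in> carrier (Q j)" by (auto simp: torsion_part_def)
      have "x \<oplus>\<^bsub>Q i\<^esub> y = d j (a \<oplus>\<^bsub>Q j\<^esub> b)" "\<ominus>\<^bsub>Q i\<^esub> x = d j (\<ominus>\<^bsub>Q j\<^esub> a)"
        using mod_homD(2)[OF d_hom c] mod_hom_uminus[OF Q_module Q_module d_hom c(1)] ab Suc by simp_all
      then show ?thesis using torsion_part_closed[OF ab(3,4)] Suc by simp
    qed
    then show "x \<oplus>\<^bsub>Q i\<^esub> y \<in> ?B" "\<ominus>\<^bsub>Q i\<^esub> x \<in> ?B" by blast+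
  qed
  let ?N = "(Q i)\<lparr>carrier := ?Z\<rparr>"
  have coset: "?B +>\<^bsub>?N\<^esub> x = ?B" if x: "x \<in> ?B" for x
  proof
    show "?B +>\<^bsub>?N\<^esub> x \<subseteq> ?B" using Bm(1) x by (auto simp: a_r_coset_def')
    show "?B \<subseteq> ?B +>\<^bsub>?N\<^esub> x"
    proof
      fix y assume y: "y \<in> ?B"
      have "y = (y \<oplus>\<^bsub>Q i\<^esub> \<ominus>\<^bsub>Q i\<^esub> x) \<oplus>\<^bsub>Q i\<^esub> x"
        using x y BZ by (simp add: Qi.M.a_assoc Qi.M.l_neg subset_iff)
      moreover have "y \<oplus>\<^bsub>Q i\<^esub> \<ominus>\<^bsub>Q i\<^esub> x \<in> ?B" using Bm x y by blast
      ultimately show "y \<in> ?B +>\<^bsub>?N\<^esub> x" by (auto simp: a_r_coset_def')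
    qed
  qed
  have "a_rcosets\<^bsub>?N\<^esub> ?B = {?B}"
    using Z0 ZB coset unfolding A_RCOSETS_def' by auto
  then show ?thesis unfolding torsion_cohomology_def quot_module_def by simp
qed

end

text \<open>Local cohomology is defined by some injective resolution, and the vanishing holds for all of
  them.\<close>

theorem (in residue_resolution) depth_ge:
  assumes I: "ideal I R" and D: "ext_depth_ge n I" and K: "subfield K R"
    and X: "finite X" "X \<subseteq> carrier R" "\<mm> = Idl X"
    and maximal: "\<And>b. ideal b R \<Longrightarrow> \<mm> \<subseteq> b \<Longrightarrow> b = \<mm> \<or> 1 \<in> b"
  shows "depth R \<mm> (quot_module RM I) \<ge> enat n"
proof -
  let ?M = "quot_module RM I"
  obtain Q :: "nat \<Rightarrow> ('a, 'a list \<Rightarrow> 'a set) module" and d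
    where Qd: "(SOME (Q, d). \<exists>e. injective_resolution R ?M Q d e) = (Q, d)" by (metis surj_pair)
  have M: "Module.module R ?M"
    by (rule quot_module_is_module[OF RM_module ideal_submodule[OF is_cring I]])
  have "\<exists>p. case p of (Q :: nat \<Rightarrow> ('a, 'a list \<Rightarrow> 'a set) module, d) \<Rightarrow> \<exists>e. injective_resolution R ?M Q d e"
    using injective_resolution_exists[OF M K] by auto
  then obtain e where e: "injective_resolution R ?M Q d e"
    using someI_ex[of "\<lambda>(Q :: nat \<Rightarrow> ('a, 'a list \<Rightarrow> 'a set) module, d). \<exists>e. injective_resolution R ?M Q d e"] Qd by auto
  interpret resolved_quotient R \<mm> I Q d e
    by (intro resolved_quotient.intro resolved_quotient_axioms.intro residue_resolution_axioms I e)
  have LC: "local_cohomology R \<mm> ?M i = torsion_cohomology R \<mm> Q d i" for i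
    unfolding local_cohomology_def Qd by simp
  have big: "\<not> i < n" if "carrier (local_cohomology R \<mm> ?M i) \<noteq> {\<zero>\<^bsub>local_cohomology R \<mm> ?M i\<^esub>}" for i
    using that torsion_cohomology_trivial[OF D _ X maximal, of i] unfolding LC by blast
  have "enat n \<le> x" if x: "x \<in> {enat i | i. carrier (local_cohomology R \<mm> ?M i) \<noteq> {\<zero>\<^bsub>local_cohomology R \<mm> ?M i\<^esub>}}" for x
  proof -
    obtain i where i: "x = enat i" "carrier (local_cohomology R \<mm> ?M i) \<noteq> {\<zero>\<^bsub>local_cohomology R \<mm> ?M i\<^esub>}"
      using x by blast
    show ?thesis using big[OF i(2)] i(1) by simp
  qed
  then show ?thesis unfolding depth_def by (rule Inf_greatest)
qed

section \<open>The polynomial ring\<close>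

lemma poly_mapping_induct_monomials [consumes 1, case_names zero single add]:
  fixes p :: "'m \<Rightarrow>\<^sub>0 'c :: comm_monoid_add"
  assumes "keys p \<subseteq> A" and "P 0"
    and single: "\<And>m c. m \<in> A \<Longrightarrow> P (single m c)"
    and add: "\<And>p q. P p \<Longrightarrow> P q \<Longrightarrow> P (p + q)"
  shows "P p"
proof -
  have "P (\<Sum>m\<in>B. single m (lookup p m))" if "finite B" "B \<subseteq> A" for B
    using that by (induction B) (auto intro: assms)
  then have "P (\<Sum>m\<in>keys p. single m (lookup p m))" using assms(1) by simp
  moreover have "(\<Sum>m\<in>keys p. single m (lookup p m)) = p"
    by (rule poly_mapping_eqI) (simp add: lookup_sum lookup_single when_def in_keys_iff)
  ultimately show ?thesis by simp
qed

lemma xy_ring_simps: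
  "carrier (xy_ring n) = {p :: 'k :: field mpoly. \<forall>m\<in>keys p. keys m \<subseteq> vars_upto n}"
  "mult (xy_ring n) = ((*) :: 'k mpoly \<Rightarrow> _)" "one (xy_ring n) = (1 :: 'k mpoly)"
  "zero (xy_ring n) = (0 :: 'k mpoly)" "add (xy_ring n) = ((+) :: 'k mpoly \<Rightarrow> _)"
  by (simp_all add: xy_ring_def)

lemma xy_induct [consumes 1, case_names zero single add]:
  assumes "p \<in> carrier (xy_ring n)" and "P 0"
    and "\<And>m c. keys m \<subseteq> vars_upto n \<Longrightarrow> P (single m c)"
    and "\<And>p q. P p \<Longrightarrow> P q \<Longrightarrow> P (p + q)"
  shows "P (p :: 'k :: field mpoly)"
  by (rule poly_mapping_induct_monomials[of p "{m. keys m \<subseteq> vars_upto n}"])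
    (use assms in \<open>auto simp: xy_ring_simps\<close>)

lemma infinite_mpoly: "infinite (UNIV :: 'k :: field mpoly set)"
proof
  assume "finite (UNIV :: 'k mpoly set)"
  moreover have "inj (\<lambda>i. indet (VarX i) :: 'k mpoly)"
  proof (rule injI)
    fix i j :: nat assume "indet (VarX i) = (indet (VarX j) :: 'k mpoly)"
    then have "keys (indet (VarX i) :: 'k mpoly) = keys (indet (VarX j) :: 'k mpoly)" by simp
    then have "single (VarX i) (1 :: nat) = single (VarX j) 1" by (simp add: indet_def)
    then have "keys (single (VarX i) (1 :: nat)) = keys (single (VarX j) (1 :: nat))" by simp
    then show "i = j" by simp
  qed
  then have "infinite (range (\<lambda>i. indet (VarX i) :: 'k mpoly))" by (rule range_inj_infinite)
  ultimately show False using finite_subset[OF subset_UNIV] by blast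
qed

lemma residue_resolution_xy:
  "residue_resolution (xy_ring n :: 'k :: field mpoly ring) (irrelevant_ideal n)"
  by (intro residue_resolution.intro residue_resolution_axioms.intro typed_cring.intro typed_cring_axioms.intro
      cring_xy_ring ideal_irrelevant infinite_mpoly xy_ring_simps)

interpretation XY: residue_resolution "xy_ring n :: 'k :: field mpoly ring" "irrelevant_ideal n" for n
  by (rule residue_resolution_xy)

lemma single_closed: "keys m \<subseteq> vars_upto n \<Longrightarrow> single m c \<in> carrier (xy_ring n)"
  by (auto simp: xy_ring_simps)

lemma indet_mult_single:
  "indet v * single m c = (single (single v 1 + m) c :: 'k :: field mpoly)"
  by (simp add: indet_def mult_single)

lemma keys_plus_nat: "keys (a + b) = keys a \<union> keys (b :: 'v \<Rightarrow>\<^sub>0 nat)"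
  by (auto simp: in_keys_iff lookup_add)

lemma monomial_factor:
  assumes "v \<in> keys (m :: 'v \<Rightarrow>\<^sub>0 nat)"
  obtains m' where "m = single v 1 + m'" "keys m' \<subseteq> keys m"
proof
  show "m = single v 1 + (m - single v 1)"
    using assms by (intro poly_mapping_eqI) (auto simp: lookup_add lookup_minus lookup_single when_def in_keys_iff)
  show "keys (m - single v 1) \<subseteq> keys m"
    by (auto simp: in_keys_iff lookup_minus)
qed

lemma indet_irrelevant: "v \<in> vars_upto n \<Longrightarrow> indet v \<in> (irrelevant_ideal n :: 'k :: field mpoly set)"
proof -
  have "indet ` vars_upto n \<subseteq> (carrier (xy_ring n) :: 'k mpoly set)" by (auto simp: indet_closed)
  from XY.genideal_self[OF this] show "v \<in> vars_upto n \<Longrightarrow> indet v \<in> (irrelevant_ideal n :: 'k mpoly set)"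
    unfolding irrelevant_ideal_def by blast
qed

lemma irrelevant_ideal_maximal:
  assumes b: "ideal b (xy_ring n :: 'k :: field mpoly ring)" and sub: "irrelevant_ideal n \<subseteq> b"
  shows "b = irrelevant_ideal n \<or> 1 \<in> b"
proof (cases "b \<subseteq> irrelevant_ideal n")
  case False
  then obtain p where p: "p \<in> b" "p \<notin> irrelevant_ideal n" by blast
  note i = XY.ideal_closed[OF b] and m = XY.ideal_closed[OF ideal_irrelevant[of n]]
  have "\<exists>c. p - single 0 c \<in> irrelevant_ideal n" if "p \<in> carrier (xy_ring n)" for p :: "'k mpoly"
    using that
  proof (induction rule: xy_induct)
    case zero
    show ?case using m(2) by (intro exI[of _ 0]) simp
  next
    case (single mm c)
    show ?case
    proof (cases "mm = 0")
      case True
      then show ?thesis using m(2) by (intro exI[of _ c]) simp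
    next
      case False
      then obtain v where v: "v \<in> keys mm" by (metis keys_eq_empty equals0I)
      then obtain m' where m': "mm = single v 1 + m'" "keys m' \<subseteq> keys mm"
        by (rule monomial_factor)
      have "indet v * single m' c \<in> irrelevant_ideal n"
        using v m'(2) single by (intro m(7) indet_irrelevant single_closed) auto
      then show ?thesis unfolding indet_mult_single m'(1) by (intro exI[of _ 0]) simp
    qed
  next
    case (add p q)
    then obtain c c' where "p - single 0 c \<in> irrelevant_ideal n" "q - single 0 c' \<in> irrelevant_ideal n" by blast
    then have "(p - single 0 c) + (q - single 0 c') \<in> irrelevant_ideal n" by (rule m(3))
    then show ?case by (intro exI[of _ "c + c'"]) (simp add: single_add algebra_simps)
  qed
  then obtain c where c: "p - single 0 c \<in> irrelevant_ideal n" using p(1) i(1) by blast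
  then have c0: "c \<noteq> 0" using p(2) by auto
  have "p - (p - single 0 c) \<in> b" using i(4)[OF p(1)] c sub by blast
  then have "single 0 (inverse c) * single 0 c \<in> b"
    by (intro i(6) single_closed) simp_all
  then show ?thesis using c0 by (simp add: mult_single)
qed (use sub in blast)

theorem depth_xy_ge:
  assumes I: "ideal I (xy_ring n :: 'k :: field mpoly ring)" and D: "XY.ext_depth_ge n d I"
  shows "depth (xy_ring n) (irrelevant_ideal n) (quot_module (ring_module (xy_ring n)) I) \<ge> enat d"
  by (rule XY.depth_ge[OF I D subfield_constants _ _ irrelevant_ideal_def irrelevant_ideal_maximal])
    (auto simp: vars_upto_def indet_closed)

section \<open>Killing variables\<close>

text \<open>The substitution of \<open>0\<close> for the variables in \<open>Z\<close>.\<close>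

lift_definition kill :: "xy_var set \<Rightarrow> 'k :: field mpoly \<Rightarrow> 'k mpoly" is
  "\<lambda>Z p m. if keys m \<inter> Z = {} then p m else 0"
proof -
  fix Z and p :: "(xy_var \<Rightarrow>\<^sub>0 nat) \<Rightarrow> 'k" assume "finite {m. p m \<noteq> 0}"
  then show "finite {m. (if keys m \<inter> Z = {} then p m else 0) \<noteq> 0}"
    by (rule finite_subset[rotated]) auto
qed

lemma kill_add: "kill Z (p + q) = kill Z p + kill Z q"
  by (rule poly_mapping_eqI) (simp add: kill.rep_eq lookup_add)

lemma kill_0 [simp]: "kill Z 0 = 0"
  by (rule poly_mapping_eqI) (simp add: kill.rep_eq)

lemma kill_diff: "kill Z (p - q) = kill Z p - kill Z q"
  by (rule poly_mapping_eqI) (simp add: kill.rep_eq lookup_minus)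

lemma kill_single: "kill Z (single m c) = (if keys m \<inter> Z = {} then single m c else 0)"
  by (rule poly_mapping_eqI) (auto simp: kill.rep_eq lookup_single when_def)

lemma kill_mult: "kill Z (p * q) = kill Z p * kill Z q"
  using subset_UNIV[of "keys p"]
proof (induction p rule: poly_mapping_induct_monomials)
  case (single m c)
  show ?case
    using subset_UNIV[of "keys q"]
  proof (induction q rule: poly_mapping_induct_monomials)
    case (single m' c')
    show ?case by (auto simp: mult_single kill_single keys_plus_nat)
  qed (simp_all add: kill_add distrib_left)
qed (simp_all add: kill_add distrib_right)

lemma kill_closed: "p \<in> carrier (xy_ring n) \<Longrightarrow> kill Z p \<in> carrier (xy_ring n)"
  by (auto simp: xy_ring_simps in_keys_iff kill.rep_eq split: if_splits)

lemma kill_indet: "kill Z (indet v) = (if v \<in> Z then 0 else indet v)"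
  by (simp add: indet_def kill_single)

text \<open>Every monomial of \<open>c - kill Z c\<close> is divisible by a variable in \<open>Z\<close>.\<close>

lemma kill_remainder:
  assumes I: "ideal I (xy_ring n :: 'k :: field mpoly ring)" and f: "f \<in> carrier (xy_ring n)"
    and Zf: "\<And>z. z \<in> Z \<Longrightarrow> indet z * f \<in> I" and c: "c \<in> carrier (xy_ring n)"
  shows "(c - kill Z c) * f \<in> I"
  using c
proof (induction rule: xy_induct)
  case zero
  show ?case using XY.ideal_closed(2)[OF I] by simp
next
  case (single m a)
  show ?case
  proof (cases "keys m \<inter> Z = {}")
    case True
    then show ?thesis using XY.ideal_closed(2)[OF I] by (simp add: kill_single)
  next
    case False
    then obtain z where z: "z \<in> keys m" "z \<in> Z" by blast
    obtain m' where m': "m = single z 1 + m'" "keys m' \<subseteq> keys m"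
      using z(1) by (rule monomial_factor)
    have "single m' a * (indet z * f) \<in> I"
      using single m'(2) by (intro XY.ideal_closed(6)[OF I] Zf z(2) single_closed) auto
    also have "single m' a * (indet z * f) = single m a * f"
      by (simp only: m'(1) indet_mult_single[symmetric] mult.assoc mult.left_commute)
    finally show ?thesis using False by (simp add: kill_single)
  qed
next
  case (add p q)
  have "(p - kill Z p) * f + (q - kill Z q) * f \<in> I" by (rule XY.ideal_closed(3)[OF I add])
  then show ?case by (simp add: kill_add algebra_simps)
qed

section \<open>Ideals generated by variables and edge binomials\<close>

definition edge_binomial :: "nat \<Rightarrow> nat \<Rightarrow> 'k :: field mpoly" where
  "edge_binomial i j = indet (VarX i) * indet (VarY j) - indet (VarX j) * indet (VarY i)"

definition gens :: "xy_var set \<Rightarrow> nat set set \<Rightarrow> 'k :: field mpoly set" where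
  "gens W E = indet ` W \<union> {edge_binomial i j | i j. {i, j} \<in> E}"

text \<open>The reductions add variables to binomial edge ideals.  Deleting a vertex \<open>v\<close> from a graph
  means to keep the ring and to put \<open>VarX v\<close> and \<open>VarY v\<close> into \<open>W\<close>.\<close>

definition partial_ideal :: "nat \<Rightarrow> xy_var set \<Rightarrow> nat set set \<Rightarrow> 'k :: field mpoly set" where
  "partial_ideal n W E = Idl\<^bsub>xy_ring n\<^esub> (gens W E)"

lemma vars_upto_iff [simp]: "VarX i \<in> vars_upto n \<longleftrightarrow> i \<in> {1..n}" "VarY i \<in> vars_upto n \<longleftrightarrow> i \<in> {1..n}"
  by (auto simp: vars_upto_def)

lemma edge_binomial_closed: "i \<in> {1..n} \<Longrightarrow> j \<in> {1..n} \<Longrightarrow> edge_binomial i j \<in> carrier (xy_ring n)"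
  unfolding edge_binomial_def by (intro XY.R_closed indet_closed) auto

lemma gens_closed:
  assumes "W \<subseteq> vars_upto n" "simple_graph n E"
  shows "gens W E \<subseteq> (carrier (xy_ring n) :: 'k :: field mpoly set)"
proof -
  have "i \<in> {1..n} \<and> j \<in> {1..n}" if "{i, j} \<in> E" for i j
    using assms(2) that unfolding simple_graph_def by blast
  then show ?thesis using assms(1) by (auto simp: gens_def intro!: indet_closed edge_binomial_closed)
qed

context
  fixes n :: nat and W :: "xy_var set" and E :: "nat set set"
  assumes W: "W \<subseteq> vars_upto n" and E: "simple_graph n E"
begin

lemma ideal_partial_ideal: "ideal (partial_ideal n W E) (xy_ring n :: 'k :: field mpoly ring)"
  unfolding partial_ideal_def by (rule XY.genideal_ideal[OF gens_closed[OF W E]])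

lemma indet_in_partial_ideal: "w \<in> W \<Longrightarrow> indet w \<in> (partial_ideal n W E :: 'k :: field mpoly set)"
  using XY.genideal_self[OF gens_closed[OF W E]] unfolding partial_ideal_def gens_def by blast

lemma edge_in_partial_ideal: "{i, j} \<in> E \<Longrightarrow> edge_binomial i j \<in> (partial_ideal n W E :: 'k :: field mpoly set)"
  using XY.genideal_self[OF gens_closed[OF W E]] unfolding partial_ideal_def gens_def by blast

end

lemma partial_ideal_subset:
  assumes "ideal I (xy_ring n :: 'k :: field mpoly ring)" "\<And>w. w \<in> W \<Longrightarrow> indet w \<in> I"
    "\<And>i j. {i, j} \<in> E \<Longrightarrow> edge_binomial i j \<in> I"
  shows "partial_ideal n W E \<subseteq> I"
  unfolding partial_ideal_def by (rule XY.genideal_minimal[OF assms(1)]) (use assms in \<open>auto simp: gens_def\<close>)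

lemma binomial_edge_ideal_eq:
  assumes E: "simple_graph n E"
  shows "(binomial_edge_ideal n E :: 'k :: field mpoly set) = partial_ideal n {} E"
proof
  let ?G = "{indet (VarX i) * indet (VarY j) - indet (VarX j) * indet (VarY i) :: 'k mpoly | i j.
        {i, j} \<in> E \<and> 1 \<le> i \<and> i < j \<and> j \<le> n}"
  have G: "?G \<subseteq> gens {} E" by (auto simp: gens_def edge_binomial_def)
  have c: "gens {} E \<subseteq> (carrier (xy_ring n) :: 'k mpoly set)" by (rule gens_closed[OF _ E]) simp
  show "binomial_edge_ideal n E \<subseteq> (partial_ideal n {} E :: 'k mpoly set)"
    unfolding binomial_edge_ideal_def partial_ideal_def by (rule XY.subset_Idl_subset[OF c G])
  show "partial_ideal n {} E \<subseteq> (binomial_edge_ideal n E :: 'k mpoly set)"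
  proof (rule partial_ideal_subset[OF ideal_binomial_edge])
    fix i j assume ij: "{i, j} \<in> E"
    then have "i \<in> {1..n}" "j \<in> {1..n}" "i \<noteq> j" using E unfolding simple_graph_def by (auto simp: card_insert_if split: if_splits)
    moreover have *: "edge_binomial i j \<in> (binomial_edge_ideal n E :: 'k mpoly set)" if "{i, j} \<in> E" "1 \<le> i" "i < j" "j \<le> n" for i j
      using XY.genideal_self[of ?G n] G c that unfolding binomial_edge_ideal_def edge_binomial_def by blast
    moreover have "edge_binomial i j = - (edge_binomial j i :: 'k mpoly)" by (simp add: edge_binomial_def)
    ultimately show "edge_binomial i j \<in> (binomial_edge_ideal n E :: 'k mpoly set)"
      using ij *[of i j] XY.ideal_closed(5)[OF ideal_binomial_edge *[of j i]]
      by (cases "i < j") (simp_all add: insert_commute)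
  qed simp
qed

lemma partial_ideal_adjoin:
  assumes W: "W \<subseteq> vars_upto n" and u: "u \<in> vars_upto n" and E: "simple_graph n E"
    and c: "c \<in> (partial_ideal n (insert u W) E :: 'k :: field mpoly set)"
  shows "\<exists>a\<in>partial_ideal n W E. \<exists>r\<in>carrier (xy_ring n). c = a + indet u * r"
proof -
  let ?I = "partial_ideal n W E :: 'k mpoly set"
  note I = ideal_partial_ideal[OF W E]
  let ?K = "{a + indet u * r | a r. a \<in> ?I \<and> r \<in> carrier (xy_ring n)}"
  have K: "ideal ?K (xy_ring n)" by (rule XY.ideal_adjoin[OF I indet_closed[OF u]])
  have sub: "?I \<subseteq> ?K"
  proof
    fix a assume "a \<in> ?I"
    then have "a + indet u * 0 \<in> ?K" using XY.R_closed(5) by blast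
    then show "a \<in> ?K" by simp
  qed
  have "0 + indet u * 1 \<in> ?K" using XY.R_closed(6) XY.ideal_closed(2)[OF I] by blast
  then have uK: "indet u \<in> ?K" by (simp only: add_0 mult_1_right)
  have "partial_ideal n (insert u W) E \<subseteq> ?K"
  proof (rule partial_ideal_subset[OF K])
    fix w assume "w \<in> insert u W"
    then show "indet w \<in> ?K" using uK indet_in_partial_ideal[OF W E, of w] sub by (cases "w = u") blast+
  next
    fix i j assume "{i, j} \<in> E"
    then show "edge_binomial i j \<in> ?K" using edge_in_partial_ideal[OF W E, of i j] sub by blast
  qed
  then show ?thesis using c by blast
qed

lemma partial_ideal_mono:
  assumes "W' \<subseteq> vars_upto n" "simple_graph n E'" "W \<subseteq> W'" "E \<subseteq> E'"
  shows "partial_ideal n W E \<subseteq> (partial_ideal n W' E' :: 'k :: field mpoly set)"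
proof (rule partial_ideal_subset[OF ideal_partial_ideal[OF assms(1,2)]])
  show "indet w \<in> (partial_ideal n W' E' :: 'k mpoly set)" if "w \<in> W" for w
    by (rule indet_in_partial_ideal[OF assms(1,2) subsetD[OF assms(3) that]])
  show "edge_binomial i j \<in> (partial_ideal n W' E' :: 'k mpoly set)" if "{i, j} \<in> E" for i j
    by (rule edge_in_partial_ideal[OF assms(1,2) subsetD[OF assms(4) that]])
qed

section \<open>Completing a neighbourhood\<close>

definition complete_nbhd :: "nat set set \<Rightarrow> nat \<Rightarrow> nat set set" where
  "complete_nbhd E v = E \<union> {{a, b} | a b. {v, a} \<in> E \<and> {v, b} \<in> E \<and> a \<noteq> b}"

definition delete_vertex :: "nat set set \<Rightarrow> nat \<Rightarrow> nat set set" where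
  "delete_vertex E v = {e \<in> E. v \<notin> e}"

lemma simple_graph_edge:
  assumes "simple_graph n E" "{i, j} \<in> E"
  shows "i \<in> {1..n}" "j \<in> {1..n}" "i \<noteq> j"
  using assms unfolding simple_graph_def by (auto simp: card_insert_if split: if_splits)

lemma simple_graph_complete_nbhd: "simple_graph n E \<Longrightarrow> simple_graph n (complete_nbhd E v)"
  unfolding simple_graph_def complete_nbhd_def by fastforce

lemma simple_graph_delete_vertex: "simple_graph n E \<Longrightarrow> simple_graph n (delete_vertex E v)"
  unfolding simple_graph_def delete_vertex_def by blast

lemma kill_edge_binomial:
  "kill {VarX v, VarY v} (edge_binomial i j) = (if i = v \<or> j = v then 0 else edge_binomial i j)"
  by (auto simp: edge_binomial_def kill_diff kill_mult kill_indet)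

lemma delete_vertex_subset:
  assumes W: "W \<subseteq> vars_upto n" and E: "simple_graph n E" and v: "v \<in> {1..n}"
  shows "partial_ideal n W E \<subseteq>
    (partial_ideal n (W \<union> {VarX v, VarY v}) (delete_vertex E v) :: 'k :: field mpoly set)" (is "_ \<subseteq> ?B")
proof -
  have W': "W \<union> {VarX v, VarY v} \<subseteq> vars_upto n" using W v by auto
  note E' = simple_graph_delete_vertex[OF E, of v]
  note B = ideal_partial_ideal[OF W' E']
  note b = XY.ideal_closed[OF B]
  have X: "indet (VarX v) \<in> ?B" and Y: "indet (VarY v) \<in> ?B"
    using indet_in_partial_ideal[OF W' E'] by blast+
  show ?thesis
  proof (rule partial_ideal_subset[OF B])
    show "indet w \<in> ?B" if "w \<in> W" for w
      using indet_in_partial_ideal[OF W' E', of w] that by blast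
    show "edge_binomial i j \<in> ?B" if ij: "{i, j} \<in> E" for i j
    proof (cases "i = v \<or> j = v")
      case True
      have c: "indet (VarX k) \<in> carrier (xy_ring n)" "indet (VarY k) \<in> carrier (xy_ring n)" if "k \<in> {i, j}" for k
        using simple_graph_edge[OF E ij] that by (auto intro!: indet_closed)
      show ?thesis unfolding edge_binomial_def
      proof (cases "i = v")
        case True
        then show "indet (VarX i) * indet (VarY j) - indet (VarX j) * indet (VarY i) \<in> ?B"
          using b(4)[OF b(7)[OF c(2) X] b(6)[OF c(1) Y], of j j] by simp
      next
        case False
        then show "indet (VarX i) * indet (VarY j) - indet (VarX j) * indet (VarY i) \<in> ?B"
          using \<open>i = v \<or> j = v\<close> b(4)[OF b(6)[OF c(1) Y] b(7)[OF c(2) X], of i i] by simp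
      qed
    next
      case False
      then show ?thesis
        by (intro edge_in_partial_ideal[OF W' E']) (use ij in \<open>simp add: delete_vertex_def\<close>)
    qed
  qed
qed

text \<open>The key is the relation \<open>x\<^sub>v f\<^bsub>ab\<^esub> = x\<^sub>a f\<^bsub>vb\<^esub> - x\<^sub>b f\<^bsub>va\<^esub>\<close> for neighbours \<open>a\<close>, \<open>b\<close> of \<open>v\<close>, and likewise with \<open>y\<close>.  Since
  \<open>f\<^bsub>ab\<^esub>\<close> does not involve the variables of \<open>v\<close>, it shows that an element \<open>h\<close> of the first ideal \<open>A\<close> agrees,
  modulo \<open>J\<^sub>G\<close>, with the result of setting the variables of \<open>v\<close> to \<open>0\<close> in \<open>h\<close>.  For an element of the
  second ideal \<open>B\<close> that result lies in \<open>J\<^sub>G\<close>.\<close>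

lemma complete_nbhd_inter:
  assumes W: "W \<subseteq> vars_upto n" and E: "simple_graph n E" and v: "v \<in> {1..n}"
  shows "partial_ideal n W (complete_nbhd E v) \<inter> partial_ideal n (W \<union> {VarX v, VarY v}) (delete_vertex E v)
    = (partial_ideal n W E :: 'k :: field mpoly set)" (is "?A \<inter> ?B = ?I")
proof
  let ?Z = "{VarX v, VarY v}"
  note Ev = simple_graph_complete_nbhd[OF E, of v]
  have I: "ideal ?I (xy_ring n)" by (rule ideal_partial_ideal[OF W E])
  note i = XY.ideal_closed[OF I]
  have "E \<subseteq> complete_nbhd E v" by (simp add: complete_nbhd_def)
  then show "?I \<subseteq> ?A \<inter> ?B"
    using partial_ideal_mono[OF W Ev order_refl] delete_vertex_subset[OF W E v] by blast
  \<comment> \<open>The multiplier \<open>c\<close> turns the set of all \<open>h\<close> with \<open>h - kill h \<in> J\<^sub>G\<close> into an ideal, so that it is enough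
    to look at generators.\<close>
  define L where "L = {h \<in> carrier (xy_ring n). \<forall>c\<in>carrier (xy_ring n). c * h - kill ?Z (c * h) \<in> ?I}"
  have L: "ideal L (xy_ring n)"
  proof (rule XY.idealI')
    show "L \<subseteq> carrier (xy_ring n)" by (auto simp: L_def)
    show "0 \<in> L" using i(2) by (simp add: L_def XY.R_closed(5))
    show "x + y \<in> L" if "x \<in> L" "y \<in> L" for x y
    proof -
      have "c * (x + y) - kill ?Z (c * (x + y)) \<in> ?I" if "c \<in> carrier (xy_ring n)" for c
      proof -
        have "(c * x - kill ?Z (c * x)) + (c * y - kill ?Z (c * y)) \<in> ?I"
          using that \<open>x \<in> L\<close> \<open>y \<in> L\<close> i(3) by (simp add: L_def)
        then show ?thesis by (simp add: distrib_left kill_add algebra_simps)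
      qed
      then show ?thesis using that by (simp add: L_def XY.R_closed(1))
    qed
    show "r * x \<in> L" if "r \<in> carrier (xy_ring n)" "x \<in> L" for r x
      using that by (simp add: L_def mult.assoc[symmetric] XY.R_closed(2))
  qed
  have good: "h \<in> L" if h: "h \<in> ?I" "kill ?Z h = h \<or> kill ?Z h = 0" for h
  proof -
    have "c * h - kill ?Z (c * h) \<in> ?I" if c: "c \<in> carrier (xy_ring n)" for c
      using h i(4)[OF i(6)[OF c h(1)] i(6)[OF kill_closed[OF c] h(1)]] i(6)[OF c h(1)]
      by (auto simp: kill_mult)
    then show ?thesis using h(1) i(1) by (auto simp: L_def)
  qed
  have AL: "?A \<subseteq> L"
  proof (rule partial_ideal_subset[OF L])
    show "indet w \<in> L" if "w \<in> W" for w
      by (rule good[OF indet_in_partial_ideal[OF W E that]]) (simp add: kill_indet)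
  next
    fix a b assume ab: "{a, b} \<in> complete_nbhd E v"
    show "edge_binomial a b \<in> L"
    proof (cases "{a, b} \<in> E")
      case True
      show ?thesis by (rule good[OF edge_in_partial_ideal[OF W E True]]) (simp add: kill_edge_binomial)
    next
      case False
      then have vab: "{v, a} \<in> E" "{v, b} \<in> E"
        using ab by (auto simp: complete_nbhd_def doubleton_eq_iff)
      note va = simple_graph_edge[OF E vab(1)] and vb = simple_graph_edge[OF E vab(2)]
      have f: "edge_binomial a b \<in> (carrier (xy_ring n) :: 'k mpoly set)" using va vb by (intro edge_binomial_closed)
      note e = edge_in_partial_ideal[OF W E vab(1)] edge_in_partial_ideal[OF W E vab(2)]
      have "indet (VarX v) * edge_binomial a b = indet (VarX a) * edge_binomial v b - (indet (VarX b) * edge_binomial v a :: 'k mpoly)"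
        "indet (VarY v) * edge_binomial a b = indet (VarY a) * edge_binomial v b - (indet (VarY b) * edge_binomial v a :: 'k mpoly)"
        by (simp_all add: edge_binomial_def algebra_simps)
      moreover have "indet (VarX a) * edge_binomial v b - (indet (VarX b) * edge_binomial v a :: 'k mpoly) \<in> ?I"
        "indet (VarY a) * edge_binomial v b - (indet (VarY b) * edge_binomial v a :: 'k mpoly) \<in> ?I"
        using va vb by (intro i(4) i(6) e indet_closed; simp)+
      ultimately have Zf: "indet z * edge_binomial a b \<in> ?I" if "z \<in> ?Z" for z using that by auto
      have "c * edge_binomial a b - kill ?Z (c * edge_binomial a b) \<in> ?I" if "c \<in> carrier (xy_ring n)" for c
        using kill_remainder[of ?I n _ ?Z, OF I f Zf that] va vb by (simp add: kill_mult kill_edge_binomial left_diff_distrib)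
      then show ?thesis using f by (simp add: L_def)
    qed
  qed
  have "ideal {h \<in> carrier (xy_ring n). kill ?Z h \<in> ?I} (xy_ring n)"
    by (rule XY.idealI') (use i in \<open>auto simp: kill_add kill_mult kill_closed XY.R_closed\<close>)
  then have "?B \<subseteq> {h \<in> carrier (xy_ring n). kill ?Z h \<in> ?I}"
  proof (rule partial_ideal_subset)
    show "indet w \<in> {h \<in> carrier (xy_ring n). kill ?Z h \<in> ?I}" if "w \<in> W \<union> ?Z" for w
      using that W v i(2) indet_in_partial_ideal[OF W E] by (auto simp: kill_indet intro!: indet_closed)
    show "edge_binomial a b \<in> {h \<in> carrier (xy_ring n). kill ?Z h \<in> ?I}" if "{a, b} \<in> delete_vertex E v" for a b
      using that edge_in_partial_ideal[OF W E, of a b] simple_graph_edge[OF E, of a b] edge_binomial_closed[of a n b] i(2)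
      by (auto simp: kill_edge_binomial delete_vertex_def)
  qed
  then have BI: "kill ?Z h \<in> ?I" if "h \<in> ?B" for h using that by blast
  show "?A \<inter> ?B \<subseteq> ?I"
  proof
    fix h assume h: "h \<in> ?A \<inter> ?B"
    then have "h \<in> L" using AL by blast
    then have "1 * h - kill ?Z (1 * h) \<in> ?I"
      unfolding L_def by (blast intro: XY.R_closed(6))
    then have "h - kill ?Z h \<in> ?I" by simp
    moreover have "kill ?Z h \<in> ?I" using BI h by blast
    ultimately have "(h - kill ?Z h) + kill ?Z h \<in> ?I" by (rule i(3))
    then show "h \<in> ?I" by simp
  qed
qed

lemma complete_nbhd_sum:
  assumes W: "W \<subseteq> vars_upto n" and E: "simple_graph n E" and v: "v \<in> {1..n}"
    and c: "c \<in> (partial_ideal n (W \<union> {VarX v, VarY v}) (delete_vertex (complete_nbhd E v) v) :: 'k :: field mpoly set)"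
  shows "\<exists>a\<in>partial_ideal n W (complete_nbhd E v).
    \<exists>b\<in>partial_ideal n (W \<union> {VarX v, VarY v}) (delete_vertex E v). c = a + b"
proof -
  let ?A = "partial_ideal n W (complete_nbhd E v) :: 'k mpoly set"
  let ?B = "partial_ideal n (W \<union> {VarX v, VarY v}) (delete_vertex E v) :: 'k mpoly set"
  note Ev = simple_graph_complete_nbhd[OF E, of v]
  have W': "W \<union> {VarX v, VarY v} \<subseteq> vars_upto n" using W v by auto
  note A = ideal_partial_ideal[OF W Ev] and B = ideal_partial_ideal[OF W' simple_graph_delete_vertex[OF E]]
  let ?S = "{a + b | a b. a \<in> ?A \<and> b \<in> ?B}"
  have "?B \<subseteq> ?S" using XY.ideal_closed(2)[OF A] by force
  moreover have "?A \<subseteq> ?S" using XY.ideal_closed(2)[OF B] by force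
  moreover have "partial_ideal n (W \<union> {VarX v, VarY v}) (delete_vertex (complete_nbhd E v) v) \<subseteq> ?S"
  proof (rule partial_ideal_subset[OF XY.ideal_sum[OF A B]])
    show "indet w \<in> ?S" if "w \<in> W \<union> {VarX v, VarY v}" for w
      by (rule subsetD[OF \<open>?B \<subseteq> ?S\<close> indet_in_partial_ideal[OF W' simple_graph_delete_vertex[OF E] that]])
    show "edge_binomial i j \<in> ?S" if "{i, j} \<in> delete_vertex (complete_nbhd E v) v" for i j
      by (rule subsetD[OF \<open>?A \<subseteq> ?S\<close> edge_in_partial_ideal[OF W Ev]]) (use that in \<open>simp add: delete_vertex_def\<close>)
  qed
  ultimately show ?thesis using c by blast
qed

text \<open>The intersection rule for \<open>complete_nbhd_inter\<close>; the sum of the two ideals belongs to the graph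
  with \<open>v\<close> deleted after its neighbourhood has been completed.\<close>

lemma ext_depth_complete_nbhd:
  assumes W: "W \<subseteq> vars_upto n" and E: "simple_graph n E" and v: "v \<in> {1..n}"
    and d: "XY.ext_depth_ge n d (partial_ideal n W (complete_nbhd E v) :: 'k :: field mpoly set)"
    "XY.ext_depth_ge n d (partial_ideal n (W \<union> {VarX v, VarY v}) (delete_vertex E v) :: 'k mpoly set)"
    "XY.ext_depth_ge n (d - 1) (partial_ideal n (W \<union> {VarX v, VarY v}) (delete_vertex (complete_nbhd E v) v) :: 'k mpoly set)"
  shows "XY.ext_depth_ge n d (partial_ideal n W E :: 'k mpoly set)"
proof -
  note Ev = simple_graph_complete_nbhd[OF E, of v]
  have W': "W \<union> {VarX v, VarY v} \<subseteq> vars_upto n" using W v by auto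
  note Ed = simple_graph_delete_vertex[OF E, of v] and Evd = simple_graph_delete_vertex[OF Ev, of v]
  have sub: "delete_vertex E v \<subseteq> delete_vertex (complete_nbhd E v) v"
    by (auto simp: delete_vertex_def complete_nbhd_def)
  show ?thesis
    unfolding complete_nbhd_inter[OF W E v, symmetric]
    by (rule XY.ext_depth_ge_inter[OF ideal_partial_ideal[OF W Ev] ideal_partial_ideal[OF W' Ed]
          ideal_partial_ideal[OF W' Evd] delete_vertex_subset[OF W Ev v]
          partial_ideal_mono[OF W' Evd order_refl sub] complete_nbhd_sum[OF W E v] d])
qed

section \<open>Disjoint unions of complete graphs\<close>

definition clique_edges :: "nat set set \<Rightarrow> nat set set" where
  "clique_edges P = {{i, j} | i j C. C \<in> P \<and> i \<in> C \<and> j \<in> C \<and> i \<noteq> j}"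

lemma clique_edges_iff: "{i, j} \<in> clique_edges P \<longleftrightarrow> i \<noteq> j \<and> (\<exists>C\<in>P. i \<in> C \<and> j \<in> C)"
  by (auto simp: clique_edges_def doubleton_eq_iff)

lemma simple_graph_clique_edges: "P \<subseteq> Pow {1..n} \<Longrightarrow> simple_graph n (clique_edges P)"
  by (auto simp: simple_graph_def clique_edges_def)

text \<open>For a disjoint union of complete graphs with vertex sets \<open>P\<close>, these are the degrees of the finest
  grading for which the edge binomials are homogeneous: the degree at each vertex and the
  \<open>x\<close>-degree of each clique.  A vertex outside \<open>\<Union>P\<close> counts as a clique of its own.\<close>

definition same_degrees :: "nat set set \<Rightarrow> (xy_var \<Rightarrow>\<^sub>0 nat) \<Rightarrow> (xy_var \<Rightarrow>\<^sub>0 nat) \<Rightarrow> bool" where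
  "same_degrees P m m' \<longleftrightarrow>
     (\<forall>i. lookup m (VarX i) + lookup m (VarY i) =
          lookup m' (VarX i) + lookup m' (VarY i)) \<and>
     (\<forall>C\<in>P. (\<Sum>i\<in>C. lookup m (VarX i)) = (\<Sum>i\<in>C. lookup m' (VarX i))) \<and>
     (\<forall>i. i \<notin> \<Union>P \<longrightarrow> lookup m (VarX i) = lookup m' (VarX i))"

text \<open>Modulo the ideal of \<open>W\<close> and the edge binomials of the cliques, all monomials of the same degree agree and
  those that meet \<open>W\<close> vanish.  So the ideal is the common kernel of these functionals (\<open>class_sum_partial_ideal\<close>, \<open>class_sum_zero_imp\<close>),
  one for each degree, and multiplication by a variable outside \<open>W\<close> just shifts them.\<close>

definition class_sum :: "nat set set \<Rightarrow> xy_var set \<Rightarrow> (xy_var \<Rightarrow>\<^sub>0 nat) \<Rightarrow> 'k :: field mpoly \<Rightarrow> 'k" where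
  "class_sum P W s p = (\<Sum>m\<in>keys p.
     if same_degrees P m s \<and> keys m \<inter> W = {} then lookup p m else 0)"

lemma class_sum_add: "class_sum P W s (p + q) = class_sum P W s p + class_sum P W s q"
  unfolding class_sum_def
  by (rule setsum_keys_plus_distrib[of "\<lambda>m c. if same_degrees P m s \<and> keys m \<inter> W = {} then c else 0"]) auto

lemma class_sum_0 [simp]: "class_sum P W s 0 = 0"
  by (simp add: class_sum_def)

lemma class_sum_single: "class_sum P W s (single m c) =
   (if same_degrees P m s \<and> keys m \<inter> W = {} then c else 0)"
  by (simp add: class_sum_def)

lemma class_sum_diff: "class_sum P W s (p - q) = class_sum P W s p - class_sum P W s q"
  using class_sum_add[of P W s "p - q" q] by simp

lemma same_degrees_cancel:
  "same_degrees P (a + m) (a + m') \<longleftrightarrow> same_degrees P m m'"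
  by (simp add: same_degrees_def lookup_add sum.distrib algebra_simps)

lemma class_sum_indet_mult:
  assumes u: "u \<notin> W"
  shows "class_sum P W (single u 1 + s) (indet u * p) = class_sum P W s p"
  using subset_UNIV[of "keys p"]
proof (induction p rule: poly_mapping_induct_monomials)
  case (single m c)
  have "keys (single u 1 + m) \<inter> W = {} \<longleftrightarrow> keys m \<inter> W = {}"
    using u by (auto simp: keys_plus_nat)
  then show ?case by (simp only: indet_mult_single class_sum_single same_degrees_cancel)
qed (simp_all add: distrib_left class_sum_add)

lemma exists_larger:
  fixes f g :: "nat \<Rightarrow> nat"
  assumes "finite C" "sum f C = sum g C" "i \<in> C" "f i > g i"
  obtains j where "j \<in> C" "f j < g j"
proof (rule ccontr)
  assume "\<not> thesis"
  then have "\<forall>j\<in>C. g j \<le> f j" using that by (meson not_le)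
  then have "sum g C < sum f C" using assms by (intro sum_strict_mono_ex1) auto
  then show False using assms(2) by simp
qed

context
  fixes n :: nat and W :: "xy_var set" and P :: "nat set set"
  assumes W: "W \<subseteq> vars_upto n" and P: "P \<subseteq> Pow {1..n}"
    and disj: "\<And>C D i. C \<in> P \<Longrightarrow> D \<in> P \<Longrightarrow> i \<in> C \<Longrightarrow> i \<in> D \<Longrightarrow> C = D"
    and avoid: "\<And>C i. C \<in> P \<Longrightarrow> i \<in> C \<Longrightarrow> VarX i \<notin> W \<and> VarY i \<notin> W"
begin

lemma same_degrees_exchange:
  assumes "C \<in> P" "i \<in> C" "j \<in> C"
  shows "same_degrees P (single (VarX i) 1 + single (VarY j) 1)
    (single (VarX j) 1 + single (VarY i) 1)"
proof -
  have fin: "finite D" if "D \<in> P" for D using P that by (meson PowD finite_atLeastAtMost finite_subset subsetD)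
  have "(\<Sum>k\<in>D. lookup (single (VarX i) 1 + single (VarY j) (1::nat)) (VarX k)) =
    (\<Sum>k\<in>D. lookup (single (VarX j) 1 + single (VarY i) 1) (VarX k))" if D: "D \<in> P" for D
  proof -
    have "i \<in> D \<longleftrightarrow> j \<in> D" using disj[OF assms(1) D] assms(2,3) by blast
    then show ?thesis using fin[OF D] by (simp add: lookup_add lookup_single when_def)
  qed
  then show ?thesis using assms
    by (auto simp: same_degrees_def lookup_add lookup_single when_def)
qed

lemma class_sum_partial_ideal:
  assumes p: "p \<in> (partial_ideal n W (clique_edges P) :: 'k :: field mpoly set)"
  shows "class_sum P W s p = 0"
proof -
  define L where "L = {h :: 'k mpoly. h \<in> carrier (xy_ring n) \<and> (\<forall>c\<in>carrier (xy_ring n). class_sum P W s (c * h) = 0)}"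
  have L: "ideal L (xy_ring n)"
    by (rule XY.idealI') (auto simp: L_def XY.R_closed distrib_left class_sum_add mult.assoc[symmetric])
  have "partial_ideal n W (clique_edges P) \<subseteq> L"
  proof (rule partial_ideal_subset[OF L])
    fix w assume w: "w \<in> W"
    have "class_sum P W s (c * indet w) = 0" if "c \<in> carrier (xy_ring n)" for c :: "'k mpoly"
      using that
    proof (induction rule: xy_induct)
      case (single m a)
      show ?case unfolding mult.commute[of _ "indet w"] indet_mult_single class_sum_single
        using w by (auto simp: keys_plus_nat)
    qed (simp_all add: distrib_right class_sum_add)
    then show "indet w \<in> L" using w W by (auto simp: L_def indet_closed)
  next
    fix i j assume "{i, j} \<in> clique_edges P"
    then obtain C where C: "C \<in> P" "i \<in> C" "j \<in> C" by (auto simp: clique_edges_iff)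
    note ex = same_degrees_exchange[OF C]
    let ?a = "single (VarX i) 1 + single (VarY j) (1 :: nat)"
    let ?b = "single (VarX j) 1 + single (VarY i) (1 :: nat)"
    have e: "edge_binomial i j = single ?a 1 - (single ?b 1 :: 'k mpoly)"
      by (simp add: edge_binomial_def indet_def mult_single)
    have "class_sum P W s (c * edge_binomial i j) = 0" if "c \<in> carrier (xy_ring n)" for c :: "'k mpoly"
      using that
    proof (induction rule: xy_induct)
      case (single m a)
      have "same_degrees P (m + ?a) (m + ?b)" using ex same_degrees_cancel by blast
      then have "same_degrees P (m + ?a) s \<longleftrightarrow> same_degrees P (m + ?b) s"
        by (simp add: same_degrees_def)
      moreover have "keys (m + ?a) \<inter> W = {} \<longleftrightarrow> keys (m + ?b) \<inter> W = {}"
        using avoid[OF C(1,2)] avoid[OF C(1,3)] by (auto simp: keys_plus_nat)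
      ultimately show ?case
        by (simp only: e right_diff_distrib mult_single mult_1_right class_sum_diff class_sum_single) simp
    qed (simp_all add: distrib_right class_sum_add)
    moreover have "i \<in> {1..n}" "j \<in> {1..n}" using C P by blast+
    ultimately show "edge_binomial i j \<in> L" by (simp add: L_def edge_binomial_closed)
  qed
  then have "class_sum P W s (1 * p) = 0" using p unfolding L_def by (blast intro: XY.R_closed(6))
  then show ?thesis by simp
qed

text \<open>If \<open>m\<close> has more \<open>x\<^sub>i\<close> than \<open>m'\<close>, then it has fewer \<open>x\<^sub>j\<close> for some \<open>j\<close> in the same clique, hence more
  \<open>y\<^sub>j\<close>, so that \<open>x\<^sub>i y\<^sub>j\<close> divides \<open>m\<close>.  Exchanging it for \<open>x\<^sub>j y\<^sub>i\<close> brings \<open>m\<close> closer to \<open>m'\<close>.\<close>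

lemma same_degrees_congruent:
  assumes "same_degrees P m m'" "keys m \<subseteq> vars_upto n"
  shows "single m c - single m' c \<in> (partial_ideal n W (clique_edges P) :: 'k :: field mpoly set)"
  using assms
proof (induction "\<Sum>i\<in>\<Union>P. lookup m (VarX i) - lookup m' (VarX i)" arbitrary: m rule: less_induct)
  case less
  let ?x = "\<lambda>m i. lookup m (VarX i) :: nat" and ?y = "\<lambda>m i. lookup m (VarY i) :: nat"
  let ?I = "partial_ideal n W (clique_edges P) :: 'k mpoly set"
  note E = simple_graph_clique_edges[OF P]
  have I: "ideal ?I (xy_ring n)" by (rule ideal_partial_ideal[OF W E])
  have fin: "finite D" if "D \<in> P" for D using P that by (meson PowD finite_atLeastAtMost finite_subset subsetD)
  have "finite P" using P finite_subset by blast
  then have finU: "finite (\<Union>P)" using fin by blast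
  have deg: "?x m i + ?y m i = ?x m' i + ?y m' i" and sums: "C \<in> P \<Longrightarrow> sum (?x m) C = sum (?x m') C"
    and out: "i \<notin> \<Union>P \<Longrightarrow> ?x m i = ?x m' i" for i C
    using less(2) by (simp_all add: same_degrees_def)
  show ?case
  proof (cases "\<exists>i. ?x m' i < ?x m i")
    case False
    then have le: "?x m i \<le> ?x m' i" for i by (meson not_le)
    have "?x m i = ?x m' i" for i
    proof (cases "i \<in> \<Union>P")
      case True
      then obtain C where C: "C \<in> P" "i \<in> C" by blast
      show ?thesis
      proof (rule ccontr)
        assume "?x m i \<noteq> ?x m' i"
        then have "sum (?x m) C < sum (?x m') C"
          using le[of i] C(2) by (intro sum_strict_mono_ex1 fin[OF C(1)] ballI le bexI[of _ i]) simp_all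
        then show False using sums[OF C(1)] by simp
      qed
    qed (rule out)
    moreover from this have "?y m i = ?y m' i" for i using deg[of i] by simp
    ultimately have "m = m'" by (intro poly_mapping_eqI) (metis xy_var.exhaust)
    then show ?thesis using XY.ideal_closed(2)[OF I] by simp
  next
    case True
    then obtain i where i: "?x m' i < ?x m i" by blast
    then obtain C where C: "C \<in> P" "i \<in> C" using out by (metis UnionE less_irrefl)
    obtain j where j: "j \<in> C" "?x m j < ?x m' j"
      by (rule exists_larger[OF fin[OF C(1)] sums[OF C(1)] C(2) i])
    have ij: "i \<noteq> j" using i j by auto
    have yj: "?y m j > 0" using deg[of j] j by simp
    let ?a = "single (VarX i) 1 + single (VarY j) (1 :: nat)"
    let ?b = "single (VarX j) 1 + single (VarY i) (1 :: nat)"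
    define m0 where "m0 = m - ?a"
    have m: "m = m0 + ?a"
      using i yj ij unfolding m0_def
      by (intro poly_mapping_eqI) (auto simp: lookup_add lookup_minus lookup_single when_def)
    define m1 where "m1 = m0 + ?b"
    have "keys m0 \<subseteq> vars_upto n" using less(3) by (auto simp: m keys_plus_nat)
    then have m0c: "single m0 c \<in> carrier (xy_ring n)" by (rule single_closed)
    have "single m0 c * edge_binomial i j \<in> ?I"
      by (rule XY.ideal_closed(6)[OF I m0c edge_in_partial_ideal[OF W E]]) (use C j ij in \<open>auto simp: clique_edges_iff\<close>)
    also have "single m0 c * edge_binomial i j = (single m c - single m1 c :: 'k mpoly)"
      by (simp add: edge_binomial_def indet_def mult_single right_diff_distrib m m1_def)
    finally have 1: "single m c - single m1 c \<in> ?I" .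
    have s1: "same_degrees P m1 m'"
    proof -
      have "same_degrees P m m1" unfolding m m1_def same_degrees_cancel
        by (rule same_degrees_exchange[OF C j(1)])
      then show ?thesis using less(2) by (simp add: same_degrees_def)
    qed
    have x1: "?x m1 k = (if k = i then ?x m i - 1 else if k = j then ?x m j + 1 else ?x m k)" for k
      using ij by (auto simp: m1_def m lookup_add lookup_single when_def)
    have "(\<Sum>k\<in>\<Union>P. ?x m1 k - ?x m' k) < (\<Sum>k\<in>\<Union>P. ?x m k - ?x m' k)"
    proof (rule sum_strict_mono_ex1[OF finU])
      show "\<forall>k\<in>\<Union>P. ?x m1 k - ?x m' k \<le> ?x m k - ?x m' k" using j by (auto simp: x1)
      show "\<exists>k\<in>\<Union>P. ?x m1 k - ?x m' k < ?x m k - ?x m' k" using C i by (intro bexI[of _ i]) (auto simp: x1)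
    qed
    moreover have "keys m1 \<subseteq> vars_upto n"
      using less(3) C j P by (auto simp: m1_def m keys_plus_nat)
    ultimately have 2: "single m1 c - single m' c \<in> ?I" using less(1) s1 by blast
    show ?thesis using XY.ideal_closed(3)[OF I 1 2] by simp
  qed
qed

text \<open>The polynomial loses a monomial at each step: a monomial that meets \<open>W\<close> lies in the ideal, and
  any other one shares its degree with another monomial of the polynomial, as their coefficients
  add up to \<open>0\<close>.\<close>

lemma class_sum_zero_imp:
  assumes "p \<in> (carrier (xy_ring n) :: 'k :: field mpoly set)" "\<And>s. class_sum P W s p = 0"
  shows "p \<in> partial_ideal n W (clique_edges P)"
  using assms
proof (induction "card (keys p)" arbitrary: p rule: less_induct)
  case less
  let ?I = "partial_ideal n W (clique_edges P) :: 'k mpoly set"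
  note E = simple_graph_clique_edges[OF P]
  have I: "ideal ?I (xy_ring n)" by (rule ideal_partial_ideal[OF W E])
  show ?case
  proof (cases "p = 0")
    case False
    then obtain m where m: "m \<in> keys p" by (metis keys_eq_empty equals0I)
    have mv: "keys m \<subseteq> vars_upto n" using less(2) m by (auto simp: xy_ring_simps)
    let ?c = "lookup p m"
    have "\<exists>q\<in>?I. lookup q m = ?c \<and> keys q \<subseteq> keys p"
    proof (cases "keys m \<inter> W = {}")
      case False
      then obtain w where w: "w \<in> keys m" "w \<in> W" by blast
      obtain m' where m': "m = single w 1 + m'" "keys m' \<subseteq> keys m"
        using w(1) by (rule monomial_factor)
      have "indet w * single m' ?c \<in> ?I"
        using m'(2) mv by (intro XY.ideal_closed(7)[OF I] indet_in_partial_ideal[OF W E w(2)] single_closed) auto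
      then have "single m ?c \<in> ?I" by (simp only: indet_mult_single m'(1))
      then show ?thesis using m by (intro bexI[of _ "single m ?c"]) auto
    next
      case True
      have "\<exists>m'\<in>keys p - {m}. same_degrees P m' m"
      proof (rule ccontr)
        assume no: "\<not> ?thesis"
        have "class_sum P W m p = (\<Sum>k\<in>keys p. if k = m then ?c else 0)"
          unfolding class_sum_def using no True by (intro sum.cong) (auto simp: same_degrees_def)
        also have "\<dots> = ?c" using m by simp
        finally show False using less(3) m by (simp add: in_keys_iff)
      qed
      then obtain m' where m': "m' \<in> keys p" "m' \<noteq> m" "same_degrees P m' m" by blast
      have "same_degrees P m m'" using m'(3) by (simp add: same_degrees_def)
      then have "single m ?c - single m' ?c \<in> ?I" by (rule same_degrees_congruent[OF _ mv])
      then show ?thesis using m m'(1,2)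
        by (intro bexI[of _ "single m ?c - single m' ?c"])
          (auto simp: lookup_minus lookup_single when_def in_keys_iff split: if_splits)
    qed
    then obtain q where q: "q \<in> ?I" "lookup q m = ?c" "keys q \<subseteq> keys p" by blast
    have "keys (p - q) \<subseteq> keys p - {m}"
      using q(2) subsetD[OF q(3)] by (auto simp: in_keys_iff lookup_minus)
    then have "card (keys (p - q)) < card (keys p)"
      using m by (intro psubset_card_mono) auto
    moreover have "p - q \<in> carrier (xy_ring n)"
      using less(2) q(1) XY.ideal_closed(1)[OF I] by (intro XY.R_closed(3)) auto
    moreover have "class_sum P W s (p - q) = 0" for s
      using less(3) class_sum_partial_ideal[OF q(1)] by (simp add: class_sum_diff)
    ultimately have "p - q \<in> ?I" using less(1) by blast
    then have "(p - q) + q \<in> ?I" using q(1) by (rule XY.ideal_closed(3)[OF I])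
    then show ?thesis by simp
  qed (use XY.ideal_closed(2)[OF I] in simp)
qed

text \<open>Multiplication by \<open>u\<close> shifts the functionals whose common kernel is the ideal.\<close>

lemma indet_regular:
  assumes u: "u \<notin> W" and p: "p \<in> (carrier (xy_ring n) :: 'k :: field mpoly set)"
    and up: "indet u * p \<in> partial_ideal n W (clique_edges P)"
  shows "p \<in> partial_ideal n W (clique_edges P)"
  by (rule class_sum_zero_imp[OF p]) (metis class_sum_indet_mult[OF u] class_sum_partial_ideal[OF up])

end

lemma card_vars: "A \<subseteq> {1..n} \<Longrightarrow> card (VarX ` A \<union> VarY ` A) = 2 * card A"
  by (subst card_Un_disjoint) (auto simp: card_image inj_on_def finite_subset)

lemma finite_vars_upto: "finite (vars_upto n)"
  by (simp add: vars_upto_def)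

lemma ext_depth_adjoin:
  assumes W: "W \<subseteq> vars_upto n" and E: "simple_graph n E" and u: "u \<in> vars_upto n"
    and reg: "\<And>p. p \<in> (carrier (xy_ring n) :: 'k :: field mpoly set) \<Longrightarrow> indet u * p \<in> partial_ideal n W E \<Longrightarrow> p \<in> partial_ideal n W E"
    and d: "XY.ext_depth_ge n d (partial_ideal n (insert u W) E :: 'k mpoly set)"
  shows "XY.ext_depth_ge n (Suc d) (partial_ideal n W E :: 'k mpoly set)"
proof -
  have W': "insert u W \<subseteq> vars_upto n" using W u by blast
  show ?thesis
    by (rule XY.ext_depth_ge_regular[OF ideal_partial_ideal[OF W E] indet_irrelevant[OF u] reg
          ideal_partial_ideal[OF W' E] partial_ideal_mono[OF W' E subset_insertI order_refl]
          indet_in_partial_ideal[OF W' E insertI1] partial_ideal_adjoin[OF W u E] d])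
qed

lemma ext_depth_adjoin_colon:
  assumes W: "W \<subseteq> vars_upto n" and E: "simple_graph n E" and u: "u \<in> vars_upto n"
    and J: "J = {p \<in> carrier (xy_ring n). indet u * p \<in> partial_ideal n W E}"
    and d: "XY.ext_depth_ge n d (J :: 'k :: field mpoly set)"
      "XY.ext_depth_ge n d (partial_ideal n (insert u W) E :: 'k mpoly set)"
  shows "XY.ext_depth_ge n d (partial_ideal n W E :: 'k mpoly set)"
proof -
  have W': "insert u W \<subseteq> vars_upto n" using W u by blast
  show ?thesis
    by (rule XY.ext_depth_ge_colon[OF ideal_partial_ideal[OF W E] ideal_partial_ideal[OF W' E] indet_closed[OF u]
          indet_in_partial_ideal[OF W' E insertI1] partial_ideal_mono[OF W' E subset_insertI order_refl]
          partial_ideal_adjoin[OF W u E] J d])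
qed

text \<open>The binomials \<open>x\<^sub>i y\<^sub>v - x\<^sub>v y\<^sub>i\<close> show that \<open>y\<^sub>v\<close> multiplies every \<open>x\<^sub>i\<close> of the clique into the ideal once
  \<open>x\<^sub>v\<close> is there.  Conversely the ideal on the left contains the one of which
  the colon is taken, and \<open>y\<^sub>v\<close> is regular modulo it.\<close>

lemma clique_colon:
  assumes W: "W \<subseteq> vars_upto n" and P: "P \<subseteq> Pow {1..n}"
    and disj: "\<And>C D i. C \<in> P \<Longrightarrow> D \<in> P \<Longrightarrow> i \<in> C \<Longrightarrow> i \<in> D \<Longrightarrow> C = D"
    and avoid: "\<And>C i. C \<in> P \<Longrightarrow> i \<in> C \<Longrightarrow> VarX i \<notin> W \<and> VarY i \<notin> W"
    and C: "C \<in> P" "v \<in> C"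
  shows "partial_ideal n (W \<union> VarX ` C) (clique_edges (P - {C})) =
    {p \<in> carrier (xy_ring n). indet (VarY v) * p \<in> (partial_ideal n (insert (VarX v) W) (clique_edges P) :: 'k :: field mpoly set)}"
    (is "?J = {p \<in> carrier _. _ * p \<in> ?K}")
proof
  have CR: "C \<subseteq> {1..n}" using C P by blast
  have v: "v \<in> {1..n}" using C CR by blast
  have PC: "P - {C} \<subseteq> Pow {1..n}" using P by blast
  have WK: "insert (VarX v) W \<subseteq> vars_upto n" using W v by auto
  have WJ: "W \<union> VarX ` C \<subseteq> vars_upto n" using W CR by auto
  note E = simple_graph_clique_edges[OF P] and EJ = simple_graph_clique_edges[OF PC]
  have K: "ideal ?K (xy_ring n)" by (rule ideal_partial_ideal[OF WK E])
  have J: "ideal ?J (xy_ring n)" by (rule ideal_partial_ideal[OF WJ EJ])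
  have Yv: "indet (VarY v) \<in> (carrier (xy_ring n) :: 'k mpoly set)" using v by (intro indet_closed) simp
  show "?J \<subseteq> {p \<in> carrier (xy_ring n). indet (VarY v) * p \<in> ?K}"
  proof (rule partial_ideal_subset[OF XY.ideal_colon[OF K Yv, unfolded xy_ring_simps(2)]])
    fix w assume w: "w \<in> W \<union> VarX ` C"
    then have wc: "indet w \<in> (carrier (xy_ring n) :: 'k mpoly set)" using WJ by (intro indet_closed) blast
    have "indet (VarY v) * indet w \<in> ?K"
    proof (cases "w \<in> insert (VarX v) W")
      case True
      then show ?thesis by (intro XY.ideal_closed(6)[OF K Yv] indet_in_partial_ideal[OF WK E])
    next
      case False
      then obtain i where i: "i \<in> C" "i \<noteq> v" "w = VarX i" using w by auto
      have iR: "i \<in> {1..n}" using i CR by blast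
      have "edge_binomial i v \<in> ?K"
        using i C by (intro edge_in_partial_ideal[OF WK E]) (auto simp: clique_edges_iff)
      moreover have "indet (VarX v) * indet (VarY i) \<in> ?K"
        using iR by (intro XY.ideal_closed(7)[OF K] indet_closed indet_in_partial_ideal[OF WK E]) auto
      ultimately have "edge_binomial i v + indet (VarX v) * indet (VarY i) \<in> ?K" by (rule XY.ideal_closed(3)[OF K])
      also have "edge_binomial i v + indet (VarX v) * indet (VarY i) = (indet (VarY v) * indet w :: 'k mpoly)"
        by (simp add: edge_binomial_def i(3) mult.commute)
      finally show ?thesis .
    qed
    then show "indet w \<in> {p \<in> carrier (xy_ring n). indet (VarY v) * p \<in> ?K}" using wc by simp
  next
    fix i j assume "{i, j} \<in> clique_edges (P - {C})"
    then have ij: "{i, j} \<in> clique_edges P" by (auto simp: clique_edges_iff)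
    then show "edge_binomial i j \<in> {p \<in> carrier (xy_ring n). indet (VarY v) * p \<in> ?K}"
      using XY.ideal_closed(6)[OF K Yv edge_in_partial_ideal[OF WK E ij]] edge_binomial_closed simple_graph_edge[OF E ij]
      by simp
  qed
  have KJ: "?K \<subseteq> ?J"
  proof (rule partial_ideal_subset[OF J])
    show "indet w \<in> ?J" if "w \<in> insert (VarX v) W" for w
      by (rule indet_in_partial_ideal[OF WJ EJ]) (use that C in auto)
    fix i j assume ij: "{i, j} \<in> clique_edges P"
    show "edge_binomial i j \<in> ?J"
    proof (cases "i \<in> C")
      case True
      then have "j \<in> C" using ij C disj by (auto simp: clique_edges_iff)
      have "indet (VarX i) * indet (VarY j) \<in> ?J" "indet (VarX j) * indet (VarY i) \<in> ?J"
        using True \<open>j \<in> C\<close> CR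
        by (intro XY.ideal_closed(7)[OF J] indet_closed indet_in_partial_ideal[OF WJ EJ]; auto)+
      then show ?thesis unfolding edge_binomial_def by (rule XY.ideal_closed(4)[OF J])
    next
      case False
      then show ?thesis
        by (intro edge_in_partial_ideal[OF WJ EJ]) (use ij in \<open>auto simp: clique_edges_iff\<close>)
    qed
  qed
  show "{p \<in> carrier (xy_ring n). indet (VarY v) * p \<in> ?K} \<subseteq> ?J"
  proof
    fix p assume p: "p \<in> {p \<in> carrier (xy_ring n). indet (VarY v) * p \<in> ?K}"
    show "p \<in> ?J"
    proof (rule indet_regular[OF WJ PC])
      show "C' = D" if "C' \<in> P - {C}" "D \<in> P - {C}" "i \<in> C'" "i \<in> D" for C' D i
        using disj that by blast
      show "VarX i \<notin> W \<union> VarX ` C \<and> VarY i \<notin> W \<union> VarX ` C" if "C' \<in> P - {C}" "i \<in> C'" for C' i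
        using that avoid[of C' i] disj[of C C' i] C by auto
      show "VarY v \<notin> W \<union> VarX ` C" using avoid[OF C] by auto
      show "p \<in> carrier (xy_ring n)" "indet (VarY v) * p \<in> ?J" using p KJ by auto
    qed
  qed
qed

lemma partial_ideal_delete_clique_vertex:
  assumes W: "W \<subseteq> vars_upto n" and P: "P \<subseteq> Pow {1..n}"
    and C: "C \<in> P" "v \<in> C"
  shows "partial_ideal n (insert (VarY v) (insert (VarX v) W)) (clique_edges P) =
    (partial_ideal n (insert (VarY v) (insert (VarX v) W)) (clique_edges (insert (C - {v}) (P - {C}))) :: 'k :: field mpoly set)"
    (is "partial_ideal n ?W _ = ?R")
proof
  have CR: "C \<subseteq> {1..n}" using C P by blast
  have P': "insert (C - {v}) (P - {C}) \<subseteq> Pow {1..n}" using P CR by blast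
  have v: "v \<in> {1..n}" using C CR by blast
  have W': "?W \<subseteq> vars_upto n" using W v by auto
  note E = simple_graph_clique_edges[OF P] and E' = simple_graph_clique_edges[OF P']
  have "clique_edges (insert (C - {v}) (P - {C})) \<subseteq> clique_edges P" using C by (auto simp: clique_edges_def)
  then show "?R \<subseteq> partial_ideal n ?W (clique_edges P)" by (rule partial_ideal_mono[OF W' E order_refl])
  have del: "delete_vertex (clique_edges P) v \<subseteq> clique_edges (insert (C - {v}) (P - {C}))"
  proof
    fix e assume "e \<in> delete_vertex (clique_edges P) v"
    then obtain i j D where e: "e = {i, j}" "D \<in> P" "i \<in> D" "j \<in> D" "i \<noteq> j" "i \<noteq> v" "j \<noteq> v"
      by (auto simp: delete_vertex_def clique_edges_def)
    then show "e \<in> clique_edges (insert (C - {v}) (P - {C}))"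
      by (cases "D = C") (auto simp: clique_edges_iff)
  qed
  have "partial_ideal n ?W (clique_edges P) \<subseteq> (partial_ideal n (?W \<union> {VarX v, VarY v}) (delete_vertex (clique_edges P) v) :: 'k mpoly set)"
    by (rule delete_vertex_subset[OF W' E v])
  also have "\<dots> \<subseteq> ?R" by (rule partial_ideal_mono[OF W' E' _ del]) auto
  finally show "partial_ideal n ?W (clique_edges P) \<subseteq> ?R" .
qed

text \<open>The bound is the dimension of the quotient ring: each variable outside \<open>W\<close> counts, and a clique
  \<open>C\<close> costs \<open>card C - 1\<close>.  Adding \<open>x\<^sub>v\<close> for a vertex \<open>v\<close> of a clique lowers it by one, and the
  two ideals that the colon rule for \<open>y\<^sub>v\<close> then produces both have this lower bound.\<close>

lemma clique_depth:
  assumes "W \<subseteq> vars_upto n" and "P \<subseteq> Pow {1..n}"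
    and "\<And>C D i. C \<in> P \<Longrightarrow> D \<in> P \<Longrightarrow> i \<in> C \<Longrightarrow> i \<in> D \<Longrightarrow> C = D"
    and "\<And>C i. C \<in> P \<Longrightarrow> i \<in> C \<Longrightarrow> VarX i \<notin> W \<and> VarY i \<notin> W"
    and "d + (\<Sum>C\<in>P. card C - 1) \<le> card (vars_upto n - W)"
  shows "XY.ext_depth_ge n d (partial_ideal n W (clique_edges P) :: 'k :: field mpoly set)"
  using assms
proof (induction "card (vars_upto n - W)" arbitrary: W P d rule: less_induct)
  case less
  note W = less(2) and P = less(3) and disj = less(4) and avoid = less(5) and bound = less(6)
  note E = simple_graph_clique_edges[OF P]
  have finP: "finite P" using P finite_subset by blast
  have smaller: "card (vars_upto n - W') < card (vars_upto n - W)" if "W \<subseteq> W'" "u \<in> W'" "u \<in> vars_upto n" "u \<notin> W" for W' u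
    using that by (intro psubset_card_mono) (auto simp: finite_vars_upto)
  show ?case
  proof (cases d)
    case 0
    then show ?thesis by (simp add: XY.ext_depth_ge_def)
  next
    case (Suc d')
    show ?thesis
    proof (cases "\<exists>C\<in>P. card C \<ge> 2")
      case False
      have "\<not> (i \<in> C \<and> j \<in> C \<and> i \<noteq> j)" if C: "C \<in> P" for C i j
      proof
        assume ij: "i \<in> C \<and> j \<in> C \<and> i \<noteq> j"
        have "finite C" using C P by (meson PowD finite_atLeastAtMost finite_subset subsetD)
        then have "card {i, j} \<le> card C" using ij by (intro card_mono) auto
        then show False using False C ij by auto
      qed
      then have e: "clique_edges P = clique_edges {}" by (auto simp: clique_edges_def)
      have "card (vars_upto n - W) \<noteq> 0" using bound Suc by simp
      then obtain u where u: "u \<in> vars_upto n" "u \<notin> W" by (metis DiffE card.empty equals0I)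
      have E0: "simple_graph n (clique_edges {})" by (rule simple_graph_clique_edges) simp
      have reg: "p \<in> partial_ideal n W (clique_edges {})"
        if "p \<in> (carrier (xy_ring n) :: 'k mpoly set)" "indet u * p \<in> partial_ideal n W (clique_edges {})" for p
        by (rule indet_regular[OF W _ _ _ u(2) that]) auto
      have D': "XY.ext_depth_ge n d' (partial_ideal n (insert u W) (clique_edges {}) :: 'k mpoly set)"
      proof (rule less(1))
        have "vars_upto n - W = insert u (vars_upto n - insert u W)" using u by blast
        then have "card (vars_upto n - W) = Suc (card (vars_upto n - insert u W))"
          using finite_vars_upto by (metis Diff_iff card_insert_disjoint finite_Diff insertI1)
        then show "d' + (\<Sum>C\<in>{}. card C - 1) \<le> card (vars_upto n - insert u W)" using bound Suc by simp
        show "card (vars_upto n - insert u W) < card (vars_upto n - W)" by (rule smaller[OF _ _ u]) auto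
      qed (use W u in auto)
      show ?thesis unfolding e Suc
        by (rule ext_depth_adjoin[OF W E0 u(1) reg D'])
    next
      case True
      then obtain C where C: "C \<in> P" "card C \<ge> 2" by blast
      have CR: "C \<subseteq> {1..n}" using C P by blast
      have finC: "finite C" using CR finite_subset by blast
      from C(2) obtain v where v: "v \<in> C" by fastforce
      have vR: "v \<in> {1..n}" using v CR by blast
      have xv: "VarX v \<in> vars_upto n" "VarY v \<in> vars_upto n" using vR by auto
      note av = avoid[OF C(1) v]
      have W1: "insert (VarX v) W \<subseteq> vars_upto n" using W xv by blast
      have sumP: "(\<Sum>D\<in>P. card D - 1) = (card C - 1) + (\<Sum>D\<in>P - {C}. card D - 1)"
        by (rule sum.remove[OF finP C(1)])
      have reg: "p \<in> partial_ideal n W (clique_edges P)"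
        if "p \<in> (carrier (xy_ring n) :: 'k mpoly set)" "indet (VarX v) * p \<in> partial_ideal n W (clique_edges P)" for p
        by (rule indet_regular[OF W P disj avoid _ that]) (use av in auto)
      have D': "XY.ext_depth_ge n d' (partial_ideal n (insert (VarX v) W) (clique_edges P) :: 'k mpoly set)"
      proof (rule ext_depth_adjoin_colon[OF W1 E xv(2) clique_colon[OF W P disj avoid C(1) v]])
        show "XY.ext_depth_ge n d' (partial_ideal n (W \<union> VarX ` C) (clique_edges (P - {C})) :: 'k mpoly set)"
        proof (rule less(1))
          show "card (vars_upto n - (W \<union> VarX ` C)) < card (vars_upto n - W)"
            by (rule smaller[of _ "VarX v"]) (use xv av v in auto)
          show "W \<union> VarX ` C \<subseteq> vars_upto n" using W CR by auto
          show "P - {C} \<subseteq> Pow {1..n}" using P by blast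
          show "C' = D" if "C' \<in> P - {C}" "D \<in> P - {C}" "i \<in> C'" "i \<in> D" for C' D i
            using disj that by blast
          show "VarX i \<notin> W \<union> VarX ` C \<and> VarY i \<notin> W \<union> VarX ` C" if "C' \<in> P - {C}" "i \<in> C'" for C' i
            using that avoid[of C' i] disj[of C C' i] C by auto
          have "VarX ` C \<subseteq> vars_upto n - W" using CR avoid[OF C(1)] by auto
          then have "card (vars_upto n - W - VarX ` C) = card (vars_upto n - W) - card (VarX ` C)"
            by (intro card_Diff_subset) (use finC in auto)
          moreover have "vars_upto n - (W \<union> VarX ` C) = vars_upto n - W - VarX ` C" by blast
          moreover have "card (VarX ` C) = card C" by (simp add: card_image inj_on_def)
          ultimately show "d' + (\<Sum>D\<in>P - {C}. card D - 1) \<le> card (vars_upto n - (W \<union> VarX ` C))"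
            using bound Suc sumP C(2) by simp
        qed
        let ?P = "insert (C - {v}) (P - {C})"
        let ?W = "insert (VarY v) (insert (VarX v) W)"
        have "XY.ext_depth_ge n d' (partial_ideal n ?W (clique_edges ?P) :: 'k mpoly set)"
        proof (rule less(1))
          show "card (vars_upto n - ?W) < card (vars_upto n - W)"
            by (rule smaller[of _ "VarX v"]) (use xv av v in auto)
          show "?W \<subseteq> vars_upto n" using W1 xv by blast
          show "?P \<subseteq> Pow {1..n}" using P CR by blast
          show "C' = D" if "C' \<in> ?P" "D \<in> ?P" "i \<in> C'" "i \<in> D" for C' D i
            using disj that C(1) by blast
          show "VarX i \<notin> ?W \<and> VarY i \<notin> ?W" if "C' \<in> ?P" "i \<in> C'" for C' i
            using that avoid[of C' i] avoid[OF C(1), of i] disj[of C C' i] C v by auto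
          have "vars_upto n - ?W = vars_upto n - W - {VarX v, VarY v}" by blast
          moreover have "card (vars_upto n - W - {VarX v, VarY v}) = card (vars_upto n - W) - card {VarX v, VarY v}"
            by (intro card_Diff_subset) (use xv av in auto)
          moreover have "(\<Sum>D\<in>?P. card D - 1) \<le> (card C - 1 - 1) + (\<Sum>D\<in>P - {C}. card D - 1)"
            using finP finC v by (simp add: sum.insert_if)
          ultimately show "d' + (\<Sum>D\<in>?P. card D - 1) \<le> card (vars_upto n - ?W)"
            using bound Suc sumP C(2) by simp
        qed
        moreover have "partial_ideal n ?W (clique_edges P) = (partial_ideal n ?W (clique_edges ?P) :: 'k mpoly set)"
          by (rule partial_ideal_delete_clique_vertex[OF W P C(1) v])
        ultimately show "XY.ext_depth_ge n d' (partial_ideal n ?W (clique_edges P) :: 'k mpoly set)"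
          by simp
      qed
      show ?thesis unfolding Suc
        by (rule ext_depth_adjoin[OF W E xv(1) reg D'])
    qed
  qed
qed

section \<open>Graphs whose vertices are partitioned into blocks\<close>

definition block_weight :: "nat set set \<Rightarrow> nat set \<Rightarrow> nat" where
  "block_weight E C = (if complete_on E C then card C + 1 else 4)"

text \<open>Each block is a union of one or more connected components of the graph on \<open>A\<close>.\<close>

definition block_partition :: "nat \<Rightarrow> nat set \<Rightarrow> nat set set \<Rightarrow> nat set set \<Rightarrow> bool" where
  "block_partition n A E P \<longleftrightarrow> simple_graph n E \<and> A \<subseteq> {1..n} \<and> \<Union>P = A \<and> {} \<notin> P \<and>
     (\<forall>C\<in>P. \<forall>D\<in>P. C \<noteq> D \<longrightarrow> C \<inter> D = {}) \<and> (\<forall>e\<in>E. \<exists>C\<in>P. e \<subseteq> C)"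

text \<open>The variables of the vertices that have been deleted, if \<open>A\<close> is what is left.\<close>

definition dead_vars :: "nat \<Rightarrow> nat set \<Rightarrow> xy_var set" where
  "dead_vars n A = vars_upto n - (VarX ` A \<union> VarY ` A)"

lemma dead_vars_delete:
  "v \<in> {1..n} \<Longrightarrow> dead_vars n A \<union> {VarX v, VarY v} = dead_vars n (A - {v})"
  by (auto simp: dead_vars_def)

lemma block_weight_cong:
  assumes "\<And>i j. i \<in> D \<Longrightarrow> j \<in> D \<Longrightarrow> {i, j} \<in> E \<longleftrightarrow> {i, j} \<in> E'"
  shows "block_weight E D = block_weight E' D"
proof -
  have "complete_on E D = complete_on E' D" using assms by (auto simp: complete_on_def)
  then show ?thesis by (simp add: block_weight_def)
qed

lemma block_partition_finite:
  assumes "block_partition n A E P"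
  shows "finite P" "C \<in> P \<Longrightarrow> finite C" "card P \<le> n" "C \<in> P \<Longrightarrow> C \<subseteq> A"
proof -
  have A: "A \<subseteq> {1..n}" "\<Union>P = A" using assms by (simp_all add: block_partition_def)
  then have "P \<subseteq> Pow {1..n}" by blast
  then show fP: "finite P" using finite_subset by blast
  show sub: "C \<subseteq> A" if "C \<in> P" for C using A that by blast
  show fC: "finite C" if "C \<in> P" for C
    by (rule finite_subset[OF subset_trans[OF sub[OF that] A(1)]]) simp
  have "card P = (\<Sum>C\<in>P. 1)" by simp
  also have "\<dots> \<le> (\<Sum>C\<in>P. card C)"
  proof (rule sum_mono)
    fix C assume "C \<in> P"
    then have "C \<noteq> {}" "finite C" using assms fC by (auto simp: block_partition_def)
    then show "1 \<le> card C" by (simp add: Suc_leI card_gt_0_iff)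
  qed
  also have "\<dots> = card (\<Union>P)"
    using assms by (intro card_Union_disjoint[symmetric] fC)
      (auto simp: block_partition_def pairwise_def disjnt_def)
  also have "\<dots> \<le> card {1..n}" unfolding A(2) using A(1) by (intro card_mono) auto
  finally show "card P \<le> n" by simp
qed

text \<open>With two variables for each vertex, a block \<open>C\<close> contributes
  \<open>2 |C| - (|C| - 1) = |C| + 1\<close> to the bound for cliques.\<close>

lemma complete_blocks_depth:
  assumes bp: "block_partition n A E P" and c: "\<And>C. C \<in> P \<Longrightarrow> complete_on E C"
  shows "XY.ext_depth_ge n (\<Sum>C\<in>P. block_weight E C) (partial_ideal n (dead_vars n A) E :: 'k :: field mpoly set)"
proof -
  note fin = block_partition_finite[OF bp]
  have b: "simple_graph n E" "A \<subseteq> {1..n}" "\<Union>P = A" "{} \<notin> P"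
    "\<And>C D. C \<in> P \<Longrightarrow> D \<in> P \<Longrightarrow> C \<noteq> D \<Longrightarrow> C \<inter> D = {}" "\<And>e. e \<in> E \<Longrightarrow> \<exists>C\<in>P. e \<subseteq> C"
    using bp by (simp_all add: block_partition_def)
  have E: "E = clique_edges P"
  proof
    show "E \<subseteq> clique_edges P"
    proof
      fix e assume e: "e \<in> E"
      then obtain C where C: "C \<in> P" "e \<subseteq> C" using b(6) by blast
      have "card e = 2" using e b(1) by (simp add: simple_graph_def)
      then obtain i j where "e = {i, j}" "i \<noteq> j" by (meson card_2_iff)
      then show "e \<in> clique_edges P" using C by (auto simp: clique_edges_iff)
    qed
    show "clique_edges P \<subseteq> E" using c by (auto simp: clique_edges_def complete_on_def)
  qed
  have "card (vars_upto n - dead_vars n A) = card (VarX ` A \<union> VarY ` A)"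
    using b(2) by (intro arg_cong[of _ _ card]) (auto simp: dead_vars_def)
  also have "\<dots> = 2 * card (\<Union>P)" using card_vars[OF b(2)] b(3) by simp
  also have "card (\<Union>P) = (\<Sum>C\<in>P. card C)"
    using b(5) by (intro card_Union_disjoint fin(2)) (auto simp: pairwise_def disjnt_def)
  finally have card: "card (vars_upto n - dead_vars n A) = (\<Sum>C\<in>P. 2 * card C)" by (simp add: sum_distrib_left)
  have "(\<Sum>C\<in>P. block_weight E C) + (\<Sum>C\<in>P. card C - 1) = (\<Sum>C\<in>P. 2 * card C)"
    unfolding sum.distrib[symmetric]
  proof (rule sum.cong)
    fix C assume C: "C \<in> P"
    then have "C \<noteq> {}" using b(4) by blast
    then have "card C > 0" using fin(2)[OF C] by (simp add: card_gt_0_iff)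
    then show "block_weight E C + (card C - 1) = 2 * card C" using c[OF C] by (simp add: block_weight_def)
  qed simp
  then have le: "(\<Sum>C\<in>P. block_weight E C) + (\<Sum>C\<in>P. card C - 1) \<le> card (vars_upto n - dead_vars n A)" using card by simp
  have "XY.ext_depth_ge n (\<Sum>C\<in>P. block_weight E C) (partial_ideal n (dead_vars n A) (clique_edges P) :: 'k mpoly set)"
  proof (rule clique_depth[OF _ _ _ _ le])
    show "dead_vars n A \<subseteq> vars_upto n" by (auto simp: dead_vars_def)
    show "P \<subseteq> Pow {1..n}" using b(2,3) by blast
    show "C = D" if "C \<in> P" "D \<in> P" "i \<in> C" "i \<in> D" for C D i using b(5) that by blast
    show "VarX i \<notin> dead_vars n A \<and> VarY i \<notin> dead_vars n A" if "C \<in> P" "i \<in> C" for C i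
      using that b(3) by (auto simp: dead_vars_def)
  qed
  then show ?thesis using E by simp
qed

text \<open>The three measures decrease lexicographically: deleting a vertex lowers the first, completing a
  neighbourhood the second, and splitting a block the third.\<close>

lemma block_partition_depth:
  assumes "block_partition n A E P"
  shows "XY.ext_depth_ge n (\<Sum>C\<in>P. block_weight E C) (partial_ideal n (dead_vars n A) E :: 'k :: field mpoly set)"
  using assms
proof (induction "(A, E, P)" arbitrary: A E P rule: wf_induct_rule[OF wf_measures[of
    "[\<lambda>(A, E, P). card A, \<lambda>(A, E, P). card (Pow {1..n} - E), \<lambda>(A, E, P). n - card P]"]])
  case (1 A E P)
  note IH = 1(1) and bp = 1(2)
  note fin = block_partition_finite[OF bp]
  have b: "simple_graph n E" "A \<subseteq> {1..n}" "\<Union>P = A" "{} \<notin> P"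
    "\<And>C D. C \<in> P \<Longrightarrow> D \<in> P \<Longrightarrow> C \<noteq> D \<Longrightarrow> C \<inter> D = {}" "\<And>e. e \<in> E \<Longrightarrow> \<exists>C\<in>P. e \<subseteq> C"
    using bp by (simp_all add: block_partition_def)
  note edge = simple_graph_edge[OF b(1)]
  have W: "dead_vars n A \<subseteq> vars_upto n" by (auto simp: dead_vars_def)
  have finA: "finite A" by (rule finite_subset[OF b(2)]) simp
  have same: "C = D" if "C \<in> P" "D \<in> P" "i \<in> C" "i \<in> D" for C D i using b(5) that by blast
  show ?case
  proof (cases "\<exists>v a c. {v, a} \<in> E \<and> {v, c} \<in> E \<and> a \<noteq> c \<and> {a, c} \<notin> E")
    case True
    then obtain v a c where vac: "{v, a} \<in> E" "{v, c} \<in> E" "a \<noteq> c" "{a, c} \<notin> E" by blast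
    obtain C where C: "C \<in> P" "{v, a} \<subseteq> C" using b(6)[OF vac(1)] by blast
    have nb: "x \<in> C" if x: "{v, x} \<in> E" for x
    proof -
      obtain D where "D \<in> P" "{v, x} \<subseteq> D" using b(6)[OF x] by blast
      then show ?thesis using same[of C D v] C by simp
    qed
    have cC: "c \<in> C" using nb[OF vac(2)] .
    have va: "v \<noteq> a" "v \<noteq> c" using edge(3)[OF vac(1)] edge(3)[OF vac(2)] by auto
    have vR: "v \<in> {1..n}" using edge(1)[OF vac(1)] .
    have vA: "v \<in> A" using C b(3) by blast
    have card3: "card C \<ge> 3"
    proof -
      have "card {v, a, c} \<le> card C" using C cC fin(2) by (intro card_mono) auto
      then show ?thesis using va vac(3) by simp
    qed
    let ?R = "P - {C}"
    let ?Ev = "complete_nbhd E v"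
    note Ev = simple_graph_complete_nbhd[OF b(1), of v]
    have sumP: "(\<Sum>D\<in>P. block_weight E D) = 4 + (\<Sum>D\<in>?R. block_weight E D)"
    proof -
      have "\<not> complete_on E C" using C cC vac by (auto simp: complete_on_def)
      then show ?thesis using sum.remove[OF fin(1) C(1), of "block_weight E"] by (simp add: block_weight_def)
    qed
    have avoid: "x \<notin> D" if "D \<in> ?R" "x \<in> C" for D x using same[of C D x] C that by blast
    have Ev_iff: "{i, j} \<in> ?Ev \<longleftrightarrow> {i, j} \<in> E" if "D \<in> ?R" "i \<in> D" for D i j
    proof -
      have "\<not> {v, i} \<in> E" using avoid[OF that(1) nb] that(2) by blast
      then show ?thesis by (auto simp: complete_nbhd_def doubleton_eq_iff)
    qed
    have Ev_block: "\<exists>D\<in>P. e \<subseteq> D" if e: "e \<in> ?Ev" for e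
    proof (cases "e \<in> E")
      case False
      then have "e \<subseteq> C" using e nb by (auto simp: complete_nbhd_def)
      then show ?thesis using C(1) by blast
    qed (rule b(6))
    have R1: "(\<Sum>D\<in>?R. block_weight ?Ev D) = (\<Sum>D\<in>?R. block_weight E D)"
      using Ev_iff by (intro sum.cong block_weight_cong) auto
    have R2: "(\<Sum>D\<in>?R. block_weight (delete_vertex F v) D) = (\<Sum>D\<in>?R. block_weight E D)"
      if "\<And>D i j. D \<in> ?R \<Longrightarrow> i \<in> D \<Longrightarrow> {i, j} \<in> F \<longleftrightarrow> {i, j} \<in> E" for F
    proof (intro sum.cong block_weight_cong)
      fix D i j assume D: "D \<in> ?R" "i \<in> D" "j \<in> D"
      have "v \<notin> D" using avoid[OF D(1)] C by blast
      then show "{i, j} \<in> delete_vertex F v \<longleftrightarrow> {i, j} \<in> E" using that[OF D(1,2), of j] D by (auto simp: delete_vertex_def)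
    qed simp
    have bpv: "block_partition n A ?Ev P"
      using b Ev Ev_block by (simp add: block_partition_def)
    have ne: "C - {v} \<noteq> {}" using C va by blast
    have bpd: "block_partition n (A - {v}) (delete_vertex F v) (insert (C - {v}) ?R)"
      if F: "simple_graph n F" "\<And>e. e \<in> F \<Longrightarrow> \<exists>D\<in>P. e \<subseteq> D" for F
      unfolding block_partition_def
    proof (intro conjI ballI impI)
      show "simple_graph n (delete_vertex F v)" by (rule simple_graph_delete_vertex[OF F(1)])
      show "A - {v} \<subseteq> {1..n}" using b(2) by blast
      show "\<Union>(insert (C - {v}) ?R) = A - {v}" using b(3) C avoid[of _ v] by blast
      show "{} \<notin> insert (C - {v}) ?R" using b(4) ne by auto
      show "D \<inter> D' = {}" if "D \<in> insert (C - {v}) ?R" "D' \<in> insert (C - {v}) ?R" "D \<noteq> D'" for D D'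
        using that b(5)[of D D'] avoid by blast
      show "\<exists>D\<in>insert (C - {v}) ?R. e \<subseteq> D" if "e \<in> delete_vertex F v" for e
        using that F(2)[of e] by (auto simp: delete_vertex_def)
    qed
    have notin: "C - {v} \<notin> ?R"
    proof
      assume "C - {v} \<in> ?R"
      then show False using avoid[of "C - {v}"] ne by blast
    qed
    have sumD: "(\<Sum>D\<in>insert (C - {v}) ?R. w D) = w (C - {v}) + (\<Sum>D\<in>?R. w D)" for w :: "nat set \<Rightarrow> nat"
      using fin(1) notin by simp
    have Adec: "card (A - {v}) < card A" using finA vA by (intro psubset_card_mono) auto
    have Wv: "dead_vars n A \<union> {VarX v, VarY v} = dead_vars n (A - {v})" by (rule dead_vars_delete[OF vR])
    have D1: "XY.ext_depth_ge n (\<Sum>D\<in>P. block_weight ?Ev D) (partial_ideal n (dead_vars n A) ?Ev :: 'k mpoly set)"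
    proof (rule IH[OF _ bpv])
      have "{a, c} \<in> Pow {1..n} - E" using vac edge by auto
      moreover have "{a, c} \<in> ?Ev" using vac by (auto simp: complete_nbhd_def)
      moreover have "E \<subseteq> ?Ev" by (simp add: complete_nbhd_def)
      ultimately have "Pow {1..n} - ?Ev \<subset> Pow {1..n} - E" by blast
      then have "card (Pow {1..n} - ?Ev) < card (Pow {1..n} - E)" by (intro psubset_card_mono) auto
      then show "((A, ?Ev, P), (A, E, P)) \<in> measures [\<lambda>(A, E, P). card A, \<lambda>(A, E, P). card (Pow {1..n} - E), \<lambda>(A, E, P). n - card P]"
        by simp
    qed
    have D2: "XY.ext_depth_ge n (\<Sum>D\<in>insert (C - {v}) ?R. block_weight (delete_vertex E v) D)
      (partial_ideal n (dead_vars n (A - {v})) (delete_vertex E v) :: 'k mpoly set)"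
      by (rule IH[OF _ bpd[OF b(1) b(6)]]) (use Adec in simp_all)
    have D3: "XY.ext_depth_ge n (\<Sum>D\<in>insert (C - {v}) ?R. block_weight (delete_vertex ?Ev v) D)
      (partial_ideal n (dead_vars n (A - {v})) (delete_vertex ?Ev v) :: 'k mpoly set)"
      by (rule IH[OF _ bpd[OF Ev Ev_block]]) (use Adec in simp_all)
    \<comment> \<open>The completed block may have become complete, but it has at least three vertices.  Without \<open>v\<close> it
      still has at least two, which is enough as the sum of the two ideals may lose one.\<close>
    have w1: "block_weight ?Ev C \<ge> 4" using card3 by (simp add: block_weight_def)
    have w2: "block_weight (delete_vertex E v) (C - {v}) \<ge> 4"
    proof -
      have "a \<in> C - {v}" "c \<in> C - {v}" using C cC va by auto
      moreover have "{a, c} \<notin> delete_vertex E v" using vac by (simp add: delete_vertex_def)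
      ultimately have "\<not> complete_on (delete_vertex E v) (C - {v})"
        using vac(3) unfolding complete_on_def by blast
      then show ?thesis by (simp add: block_weight_def)
    qed
    have w3: "block_weight (delete_vertex ?Ev v) (C - {v}) \<ge> 3"
      using card3 C fin(2)[OF C(1)] by (auto simp: block_weight_def)
    show ?thesis
    proof (rule ext_depth_complete_nbhd[OF W b(1) vR])
      show "XY.ext_depth_ge n (\<Sum>D\<in>P. block_weight E D) (partial_ideal n (dead_vars n A) ?Ev :: 'k mpoly set)"
        by (rule XY.ext_depth_ge_mono[OF D1])
          (use sumP R1 w1 sum.remove[OF fin(1) C(1), of "block_weight ?Ev"] in simp)
      show "XY.ext_depth_ge n (\<Sum>D\<in>P. block_weight E D)
        (partial_ideal n (dead_vars n A \<union> {VarX v, VarY v}) (delete_vertex E v) :: 'k mpoly set)"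
        unfolding Wv by (rule XY.ext_depth_ge_mono[OF D2]) (use sumP R2[of E] w2 sumD in simp)
      show "XY.ext_depth_ge n ((\<Sum>D\<in>P. block_weight E D) - 1)
        (partial_ideal n (dead_vars n A \<union> {VarX v, VarY v}) (delete_vertex ?Ev v) :: 'k mpoly set)"
        unfolding Wv by (rule XY.ext_depth_ge_mono[OF D3]) (use sumP R2[of ?Ev] Ev_iff w3 sumD in simp)
    qed
  next
    case False
    then have trans: "{a, c} \<in> E" if "{v, a} \<in> E" "{v, c} \<in> E" "a \<noteq> c" for v a c using that by blast
    show ?thesis
    proof (cases "\<exists>C\<in>P. \<not> complete_on E C")
      case False
      then show ?thesis using complete_blocks_depth[OF bp] by blast
    next
      case True
      then obtain C where C: "C \<in> P" "\<not> complete_on E C" by blast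
      then obtain a c where ac: "a \<in> C" "c \<in> C" "a \<noteq> c" "{a, c} \<notin> E" by (auto simp: complete_on_def)
      \<comment> \<open>Adjacency is transitive in this case, so \<open>C1\<close> is the clique of \<open>a\<close> and there are no edges between it
        and the rest \<open>C2\<close> of the block, which contains \<open>c\<close>.\<close>
      define C1 where "C1 = {x \<in> C. x = a \<or> {a, x} \<in> E}"
      define C2 where "C2 = C - C1"
      let ?R = "P - {C}" and ?P = "insert C1 (insert C2 (P - {C}))"
      have C12: "a \<in> C1" "c \<in> C2" "C1 \<union> C2 = C" "C1 \<inter> C2 = {}" using ac by (auto simp: C1_def C2_def)
      have avoid: "x \<notin> D" if "D \<in> ?R" "x \<in> C" for D x using same[of C D x] C that by blast
      have closed: "j \<in> C1" if "{i, j} \<in> E" "i \<in> C1" "j \<in> C" for i j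
        using that trans[of i a j] by (auto simp: C1_def insert_commute)
      have bp': "block_partition n A E ?P"
        unfolding block_partition_def
      proof (intro conjI ballI impI)
        show "\<Union>?P = A" using b(3) C C12 by blast
        show "{} \<notin> ?P" using b(4) C12 by auto
        show "D \<inter> D' = {}" if "D \<in> ?P" "D' \<in> ?P" "D \<noteq> D'" for D D'
          using that b(5)[of D D'] avoid C12 by blast
        show "\<exists>D\<in>?P. e \<subseteq> D" if e: "e \<in> E" for e
        proof -
          obtain D where D: "D \<in> P" "e \<subseteq> D" using b(6)[OF e] by blast
          have "card e = 2" using e b(1) by (simp add: simple_graph_def)
          then obtain i j where ij: "e = {i, j}" "i \<noteq> j" by (meson card_2_iff)
          show ?thesis
          proof (cases "D = C")
            case True
            then have "i \<in> C1 \<longleftrightarrow> j \<in> C1" using closed[of i j] closed[of j i] e D ij by (auto simp: insert_commute)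
            then have "e \<subseteq> C1 \<or> e \<subseteq> C2" using ij D True by (auto simp: C2_def)
            then show ?thesis by blast
          qed (use D in blast)
        qed
      qed (use b in auto)
      have n1: "C2 \<notin> ?R" "C1 \<notin> insert C2 ?R" using avoid C12 by blast+
      have sum': "(\<Sum>D\<in>?P. w D) = w C1 + (w C2 + (\<Sum>D\<in>?R. w D))" for w :: "nat set \<Rightarrow> nat"
        using fin(1) n1 by simp
      have wt: "block_weight E D \<ge> 2" if "D \<in> ?P" for D
        using block_partition_finite(2)[OF bp' that] bp' that
        by (auto simp: block_weight_def block_partition_def Suc_le_eq card_gt_0_iff)
      have "XY.ext_depth_ge n (\<Sum>D\<in>?P. block_weight E D) (partial_ideal n (dead_vars n A) E :: 'k mpoly set)"
      proof (rule IH[OF _ bp'])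
        have "card ?P = card P + 1" using sum'[of "\<lambda>_. 1"] sum.remove[OF fin(1) C(1), of "\<lambda>_. 1 :: nat"] by simp
        moreover have "card ?P \<le> n" by (rule block_partition_finite(3)[OF bp'])
        ultimately have "n - card ?P < n - card P" by linarith
        then show "((A, E, ?P), (A, E, P)) \<in> measures [\<lambda>(A, E, P). card A, \<lambda>(A, E, P). card (Pow {1..n} - E), \<lambda>(A, E, P). n - card P]"
          by simp
      qed
      moreover have "(\<Sum>D\<in>P. block_weight E D) \<le> (\<Sum>D\<in>?P. block_weight E D)"
        using wt[of C1] wt[of C2] C(2) sum.remove[OF fin(1) C(1), of "block_weight E"]
        by (simp add: sum' block_weight_def[of E C])
      ultimately show ?thesis by (rule XY.ext_depth_ge_mono)
    qed
  qed
qed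

lemma components_block_partition:
  assumes E: "simple_graph n E"
  shows "block_partition n {1..n} E (components n E)"
proof -
  have sym: "connected_in E i j \<Longrightarrow> connected_in E j i" for i j
  proof -
    have "symp (\<lambda>i j. {i, j} \<in> E)" by (auto intro!: sympI simp: insert_commute)
    then have "symp (connected_in E)" unfolding connected_in_def by (rule symp_rtranclp)
    then show "connected_in E i j \<Longrightarrow> connected_in E j i" by (rule sympD)
  qed
  have tr: "connected_in E i k" if "connected_in E i j" "connected_in E j k" for i j k
    using that unfolding connected_in_def by (rule rtranclp_trans)
  have rf: "connected_in E i i" for i by (simp add: connected_in_def)
  have block: "C = {j \<in> {1..n}. connected_in E i j}" if "C \<in> components n E" "i \<in> C" for C i
    using that sym tr unfolding components_def by blast
  show ?thesis
    unfolding block_partition_def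
  proof (intro conjI ballI impI)
    show "\<Union>(components n E) = {1..n}" using rf unfolding components_def by blast
    show "{} \<notin> components n E" using rf unfolding components_def by blast
    show "C \<inter> D = {}" if "C \<in> components n E" "D \<in> components n E" "C \<noteq> D" for C D
      using that block by blast
    show "\<exists>C\<in>components n E. e \<subseteq> C" if e: "e \<in> E" for e
    proof -
      have "card e = 2" using e E by (simp add: simple_graph_def)
      then obtain i j where ij: "e = {i, j}" "i \<noteq> j" by (meson card_2_iff)
      have "connected_in E i j" using e ij unfolding connected_in_def by (simp add: r_into_rtranclp)
      then have "e \<subseteq> {k \<in> {1..n}. connected_in E i k}" using ij rf simple_graph_edge[OF E, of i j] e by auto
      moreover have "{k \<in> {1..n}. connected_in E i k} \<in> components n E"
        using simple_graph_edge(1)[OF E, of i j] e ij unfolding components_def by blast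
      ultimately show ?thesis by blast
    qed
  qed (use E in auto)
qed

lemma sum_block_weight_components:
  assumes E: "simple_graph n E"
  shows "(\<Sum>C\<in>components n E. block_weight E C) =
    4 * num_noncomplete n E + (\<Sum>i=1..n. num_complete n E i * (i + 1))"
proof -
  let ?P = "components n E"
  note bp = components_block_partition[OF E]
  note fin = block_partition_finite[OF bp]
  let ?c = "{C \<in> ?P. complete_on E C}" and ?d = "{C \<in> ?P. \<not> complete_on E C}"
  have "(\<Sum>C\<in>?P. block_weight E C) = (\<Sum>C\<in>?d. block_weight E C) + (\<Sum>C\<in>?c. block_weight E C)"
    using fin(1) by (subst sum.union_disjoint[symmetric]) (auto intro!: sum.cong)
  also have "(\<Sum>C\<in>?d. block_weight E C) = 4 * num_noncomplete n E"
    by (simp add: block_weight_def num_noncomplete_def)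
  also have "(\<Sum>C\<in>?c. block_weight E C) = (\<Sum>C\<in>?c. card C + 1)"
    by (intro sum.cong) (auto simp: block_weight_def)
  also have "\<dots> = (\<Sum>i\<in>{1..n}. \<Sum>C\<in>{C \<in> ?c. card C = i}. card C + 1)"
  proof (rule sum.group[symmetric])
    show "card ` ?c \<subseteq> {1..n}"
    proof
      fix k assume "k \<in> card ` ?c"
      then obtain C where C: "C \<in> ?P" "k = card C" by blast
      then have "C \<noteq> {}" "finite C" using bp fin(2) by (auto simp: block_partition_def)
      moreover have "card C \<le> card {1..n}" using fin(4)[OF C(1)] by (intro card_mono) auto
      ultimately show "k \<in> {1..n}" using C(2) by (simp add: Suc_leI card_gt_0_iff)
    qed
  qed (use fin in auto)
  also have "\<dots> = (\<Sum>i=1..n. num_complete n E i * (i + 1))"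
  proof (rule sum.cong)
    fix i
    have "(\<Sum>C\<in>{C \<in> ?c. card C = i}. card C + 1) = (\<Sum>C\<in>{C \<in> ?c. card C = i}. i + 1)" by (intro sum.cong) auto
    also have "\<dots> = card {C \<in> ?c. card C = i} * (i + 1)" by simp
    also have "card {C \<in> ?c. card C = i} = num_complete n E i"
      unfolding num_complete_def by (rule arg_cong[of _ _ card]) blast
    finally show "(\<Sum>C\<in>{C \<in> ?c. card C = i}. card C + 1) = num_complete n E i * (i + 1)" .
  qed simp
  finally show ?thesis .
qed

theorem theorem5p2:
  fixes n :: nat and E :: "nat set set"
  assumes "simple_graph n E"
  shows "depth (xy_ring n :: 'k :: field mpoly ring) (irrelevant_ideal n)
           (quot_module (ring_module (xy_ring n)) (binomial_edge_ideal n E))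
         \<ge> enat (4 * num_noncomplete n E + (\<Sum>i=1..n. num_complete n E i * (i + 1)))"
proof -
  have "dead_vars n {1..n} = {}" by (auto simp: dead_vars_def vars_upto_def)
  then have "XY.ext_depth_ge n (\<Sum>C\<in>components n E. block_weight E C) (binomial_edge_ideal n E :: 'k mpoly set)"
    using block_partition_depth[OF components_block_partition[OF assms]]
    unfolding binomial_edge_ideal_eq[OF assms] by metis
  from depth_xy_ge[OF ideal_binomial_edge this] show ?thesis
    unfolding sum_block_weight_components[OF assms] .
qed

end
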